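(* Let $(\Omega_1,\nu)$ and $(\Omega_2,\mu)$ be non-atomic measure spaces. Let $p(\cdot)\in\mathcal{P}_b(\Omega_1,\nu)$, $q(\cdot)\in\mathcal{P}_b(\Omega_2,\mu)$ and $1\le r\le\infty$. Then $k_{q(\cdot),p(\cdot)}(r)<\infty$ if and only if $r\in I(p_-,q_+)$. Also, $k_{1,p(\cdot)}(r)<\infty$ for every $1\le r<\infty$, and $k_{\infty,p(\cdot)}(r)<\infty$ for every $r\in I(p_-,\infty)$ (here $k_{1,p(\cdot)}$ and $k_{\infty,p(\cdot)}$ denote the constants obtained when $q(\cdot)$ is the constant exponent $1$, respectively $\infty$, on $\Omega_2$).
   Context: All measure spaces are $\sigma$-finite and complete, and function spaces are real. For a measure space $(\Omega,\nu)$, $\mathcal{P}(\Omega,\nu)$ is the set of all $\nu$-measurable functions $p:\Omega\to[1,\infty]$; $p_-=\operatorname{ess\,inf}_{\Omega}p$, $p_+=\operatorname{ess\,sup}_{\Omega}p$; and $\mathcal{P}_b(\Omega,\nu)=\{p\in\mathcal{P}(\Omega,\nu): 1<p_-\le p_+<\infty\}$. With $\Omega_\infty=\{x: p(x)=\infty\}$, put $\rho_{p(\cdot)}(f)=\int_{\Omega\setminus\Omega_\infty}|f(x)|^{p(x)}\,d\nu(x)+\|f\|_{L^\infty(\Omega_\infty)}$. The variable Lebesgue space $L^{p(\cdot)}(\Omega,\nu)$ consists of the measurable $f$ with $\rho_{p(\cdot)}(f/\lambda)<\infty$ for some $\lambda>0$, with norm $\|f\|_{L^{p(\cdot)}(\Omega,\nu)}=\inf\{\lambda>0:\rho_{p(\cdot)}(f/\lambda)\le1\}$.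 For $q(\cdot)\in\mathcal{P}(\Omega_2,\mu)$, $p(\cdot)\in\mathcal{P}(\Omega_1,\nu)$ and $1\le r\le\infty$, $k_{q(\cdot),p(\cdot)}(r)$ is the infimum of all constants $C\ge1$ such that $$\Big\|\Big(\sum_{k=1}^N|T(f_k)|^r\Big)^{1/r}\Big\|_{L^{p(\cdot)}(\Omega_1,\nu)}\le C\,\|T\|\,\Big\|\Big(\sum_{k=1}^N|f_k|^r\Big)^{1/r}\Big\|_{L^{q(\cdot)}(\Omega_2,\mu)}$$ for every bounded linear operator $T:L^{q(\cdot)}(\Omega_2,\mu)\to L^{p(\cdot)}(\Omega_1,\nu)$, every $N\in\mathbb{N}$ and every $f_1,\dots,f_N\in L^{q(\cdot)}(\Omega_2,\mu)$ (with $\max_k$ in place of the $\ell^r$-sum if $r=\infty$); $k_{q(\cdot),p(\cdot)}(r)=\infty$ if no such $C$ exists. For $p,q\in[1,\infty]$ the interval $I(p,q)$ is $$I(p,q)=\begin{cases}(q,2]&\text{if }p<q<2,\\ [2,p)&\text{if }2<p<q,\\ [\min\{2,q\},\max\{2,p\}]&\text{otherwise.}\end{cases}$$ *)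

theory Defs
  imports "HOL-Probability.Essential_Supremum"
begin

definition is_atom :: "'a measure \<Rightarrow> 'a set \<Rightarrow> bool" where
  "is_atom M A \<longleftrightarrow> A \<in> sets M \<and> emeasure M A > 0 \<and>
     (\<forall>B\<in>sets M. B \<subseteq> A \<longrightarrow> emeasure M B = 0 \<or> emeasure M (A - B) = 0)"

definition nonatomic :: "'a measure \<Rightarrow> bool" where
  "nonatomic M \<longleftrightarrow> (\<nexists>A. is_atom M A)"

definition essinf :: "'a measure \<Rightarrow> ('a \<Rightarrow> ennreal) \<Rightarrow> ennreal" where
  "essinf M f = Sup {z. AE x in M. z \<le> f x}"

definition exponents :: "'a measure \<Rightarrow> ('a \<Rightarrow> ennreal) set" where
  "exponents M = {p \<in> borel_measurable M. \<forall>x\<in>space M. 1 \<le> p x}"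

text \<open>The middle inequality below is automatic unless the measure is null; on a null measure space
  it fails, since there the essential infimum is \<open>\<infinity>\<close> and the essential supremum is \<open>0\<close>.\<close>

definition bounded_exponents :: "'a measure \<Rightarrow> ('a \<Rightarrow> ennreal) set" where
  "bounded_exponents M =
     {p \<in> exponents M. 1 < essinf M p \<and> essinf M p \<le> esssup M p \<and> esssup M p < \<infinity>}"

definition inf_set :: "'a measure \<Rightarrow> ('a \<Rightarrow> ennreal) \<Rightarrow> 'a set" where
  "inf_set M p = {x \<in> space M. p x = \<infinity>}"

text \<open>If \<open>inf_set M p\<close> is null, the second summand is the essential supremum over a null measure in
  \<open>ennreal\<close>, that is \<open>0\<close>.\<close>

definition modular :: "'a measure \<Rightarrow> ('a \<Rightarrow> ennreal) \<Rightarrow> ('a \<Rightarrow> real) \<Rightarrow> ennreal" where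
  "modular M p f =
     (\<integral>\<^sup>+ x \<in> space M - inf_set M p. ennreal (\<bar>f x\<bar> powr enn2real (p x)) \<partial>M)
     + esssup (restrict_space M (inf_set M p)) (\<lambda>x. ennreal \<bar>f x\<bar>)"

definition Lvar :: "'a measure \<Rightarrow> ('a \<Rightarrow> ennreal) \<Rightarrow> ('a \<Rightarrow> real) set" where
  "Lvar M p = {f \<in> borel_measurable M. \<exists>c>0. modular M p (\<lambda>x. f x / c) < \<infinity>}"

definition Lvar_norm :: "'a measure \<Rightarrow> ('a \<Rightarrow> ennreal) \<Rightarrow> ('a \<Rightarrow> real) \<Rightarrow> real" where
  "Lvar_norm M p f = Inf {c. c > 0 \<and> modular M p (\<lambda>x. f x / c) \<le> 1}"

text \<open>\<open>Lvar\<close> consists of functions rather than of classes of almost everywhere equal functions.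
  A linear operator between the spaces of classes is represented by a map on functions that respects
  almost everywhere equality and is linear up to almost everywhere equality; each operator between
  the spaces of classes arises in this way by a choice of representatives.\<close>

definition bounded_operator ::
  "'b measure \<Rightarrow> ('b \<Rightarrow> ennreal) \<Rightarrow> 'a measure \<Rightarrow> ('a \<Rightarrow> ennreal) \<Rightarrow>
   (('b \<Rightarrow> real) \<Rightarrow> 'a \<Rightarrow> real) \<Rightarrow> bool" where
  "bounded_operator M q N p T \<longleftrightarrow>
     (\<forall>f\<in>Lvar M q. T f \<in> Lvar N p) \<and>
     (\<forall>f\<in>Lvar M q. \<forall>g\<in>Lvar M q.
        (AE x in M. f x = g x) \<longrightarrow> (AE x in N. T f x = T g x)) \<and>
     (\<forall>f\<in>Lvar M q. \<forall>g\<in>Lvar M q. AE x in N. T (\<lambda>y. f y + g y) x = T f x + T g x) \<and>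
     (\<forall>c. \<forall>f\<in>Lvar M q. AE x in N. T (\<lambda>y. c * f y) x = c * T f x) \<and>
     (\<exists>C. \<forall>f\<in>Lvar M q. Lvar_norm N p (T f) \<le> C * Lvar_norm M q f)"

definition operator_norm ::
  "'b measure \<Rightarrow> ('b \<Rightarrow> ennreal) \<Rightarrow> 'a measure \<Rightarrow> ('a \<Rightarrow> ennreal) \<Rightarrow>
   (('b \<Rightarrow> real) \<Rightarrow> 'a \<Rightarrow> real) \<Rightarrow> real" where
  "operator_norm M q N p T =
     Inf {C. C \<ge> 0 \<and> (\<forall>f\<in>Lvar M q. Lvar_norm N p (T f) \<le> C * Lvar_norm M q f)}"

text \<open>The pointwise \<open>\<ell>\<^sup>r\<close> norm of \<open>f 1, \<dots>, f n\<close>, used only for \<open>n \<ge> 1\<close>.\<close>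

definition ell_norm :: "ennreal \<Rightarrow> nat \<Rightarrow> (nat \<Rightarrow> 'a \<Rightarrow> real) \<Rightarrow> 'a \<Rightarrow> real" where
  "ell_norm r n f x =
     (if r = \<infinity> then Max ((\<lambda>k. \<bar>f k x\<bar>) ` {1..n})
      else (\<Sum>k=1..n. \<bar>f k x\<bar> powr enn2real r) powr (1 / enn2real r))"

text \<open>The infimum is taken in \<open>ennreal\<close>, so it is \<open>\<infinity>\<close> if no constant is admissible.\<close>

definition kconst ::
  "'b measure \<Rightarrow> ('b \<Rightarrow> ennreal) \<Rightarrow> 'a measure \<Rightarrow> ('a \<Rightarrow> ennreal) \<Rightarrow> ennreal \<Rightarrow> ennreal" where
  "kconst M q N p r = Inf (ennreal ` {C::real. C \<ge> 1 \<and>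
     (\<forall>T n f. bounded_operator M q N p T \<longrightarrow> n \<ge> 1 \<longrightarrow> (\<forall>k\<in>{1..n}. f k \<in> Lvar M q) \<longrightarrow>
        Lvar_norm N p (ell_norm r n (\<lambda>k. T (f k)))
          \<le> C * operator_norm M q N p T * Lvar_norm M q (ell_norm r n f))})"

definition Iset :: "ennreal \<Rightarrow> ennreal \<Rightarrow> ennreal set" where
  "Iset p q =
     (if p < q \<and> q < 2 then {q<..2}
      else if 2 < p \<and> p < q then {2..<p}
      else {min 2 q..max 2 p})"

end

theory Submission
  imports Defs
begin

text \<open>Upper bounds. If \<open>q\<^sub>+ < r \<le> 2\<close> (or \<open>r = 2\<close>), a linear operator is applied to random combinations
  \<open>\<Sum>\<^sub>k \<theta>\<^sub>k f\<^sub>k\<close>, where the \<open>\<theta>\<^sub>k\<close> behave like independent \<open>r\<close>-stable (or Gaussian) variables: the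
  \<open>s\<close>-th moment of such a combination is comparable to the \<open>\<ell>\<^sup>r\<close> norm, uniformly in \<open>1 \<le> s \<le> t\<close> for
  every \<open>t < r\<close>, so that the variable exponent does no harm. The range \<open>2 \<le> r < p\<^sub>-\<close> is dual, and
  \<open>q\<^sub>+ \<le> r \<le> p\<^sub>-\<close> follows from the \<open>r\<close>-concavity of the source and the \<open>r\<close>-convexity of the target. On
  \<open>L\<^sup>1\<close> it suffices to look at indicator functions.

  Lower bounds. On a set where \<open>q > q\<^sub>1\<close> the step functions over a partition into sets of equal
  measure are complemented by averaging and can be treated like a finite-dimensional \<open>\<ell>\<close>-space with
  exponent \<open>q\<^sub>1\<close>; similarly with exponent \<open>p\<^sub>1\<close> on a set where \<open>p < p\<^sub>1\<close>. Here \<open>q\<^sub>1 < q\<^sub>+\<close> and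
  \<open>p\<^sub>1 > p\<^sub>-\<close> are arbitrarily close, so that only finite matrices are needed. Matrices of signs rule out
  \<open>r < min(2, q\<^sub>+)\<close> and, transposed, \<open>r > max(2, p\<^sub>-)\<close>. The end points \<open>r = q\<^sub>+\<close> and \<open>r = p\<^sub>-\<close> fail only
  logarithmically: the matrix consists of truncated \<open>r\<close>-stable variables, for which
  \<open>\<Sum>\<^sub>k |\<theta>\<^sub>k|\<^sup>r\<close> is of order \<open>m log m\<close> instead of \<open>m\<close>.\<close>

section \<open>Finite sums and averages\<close>

text \<open>All random systems live on finite sets with the uniform distribution, so a linear
  operator passes through the randomisation by finitely many almost everywhere identities, and no
  measurability in the random parameter has to be discussed. Below t the crude bound |x|^s <= 1 +
  |x|^t takes over; its additive 1 is harmless because norms are compared through modulars at level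
  one. The end points are the delicate part. An r-stable variable just fails to have an r-th moment,
  and that of the truncated variable is a harmonic number, so the gain is only logarithmic. On the
  other hand q_+ and p_- need not be attained on a set of positive measure, and working with q1 <
  q_+ or p1 > p_- costs the factor m^(1/q1 - 1/q_+) or m^(1/p_- - 1/p1), a power of m. Hence the
  size m is fixed first, large enough for the logarithm to beat all constants, and q1 or p1 is
  chosen afterwards, depending on m.\<close>

lemma convex_on_powr_nonneg:
  assumes "(p::real) \<ge> 1" shows "convex_on {0..} (\<lambda>x. x powr p)"
proof (rule convex_onI)
  fix t x y :: real
  assume t: "0 < t" "t < 1" and xy: "x \<in> {0..}" "y \<in> {0..}"
  \<comment> \<open>If one of the two points is 0, convexity reduces to this inequality for the
    weight of the other point.\<close>
  have le: "s powr p \<le> s" if "0 < s" "s < 1" for s :: real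
    using powr_mono'[of 1 p s] that assms by simp
  show "((1 - t) *\<^sub>R x + t *\<^sub>R y) powr p \<le> (1 - t) * x powr p + t * y powr p"
  proof (cases "x = 0 \<or> y = 0")
    case True
    then show ?thesis
      using t xy le[of t] le[of "1 - t"] assms by (auto simp: powr_mult mult_right_mono)
  next
    case False
    then show ?thesis
      using convex_onD[OF powr_convex[OF assms], of t x y] t xy by simp
  qed
qed simp

lemma powr_weighted_sum_le:
  assumes "finite S" "\<And>i. i \<in> S \<Longrightarrow> w i \<ge> 0" "sum w S = 1"
    "\<And>i. i \<in> S \<Longrightarrow> x i \<ge> 0" "(p::real) \<ge> 1"
  shows "(\<Sum>i\<in>S. w i * x i) powr p \<le> (\<Sum>i\<in>S. w i * x i powr p)"
proof -
  have "S \<noteq> {}" using assms(3) by auto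
  from convex_on_sum[OF assms(1) this convex_on_powr_nonneg[OF assms(5)] assms(3), of x] assms(2,4)
  show ?thesis by simp
qed

text \<open>After division by x + y both terms lie in [0,1], where u <= u^\<alpha>.\<close>

lemma powr_add_le:
  assumes "0 < \<alpha>" "(\<alpha>::real) \<le> 1" "x \<ge> 0" "y \<ge> 0"
  shows "(x + y) powr \<alpha> \<le> x powr \<alpha> + y powr \<alpha>"
proof (cases "x + y = 0")
  case False
  then have s: "x + y > 0" using assms by simp
  have *: "u \<le> u powr \<alpha>" if "0 \<le> u" "u \<le> 1" for u :: real
    using powr_mono'[of \<alpha> 1 u] that assms by (cases "u = 0") auto
  have "1 = x / (x + y) + y / (x + y)" using s by (simp add: add_divide_distrib[symmetric])
  also have "\<dots> \<le> (x / (x + y)) powr \<alpha> + (y / (x + y)) powr \<alpha>"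
    using assms s by (intro add_mono *) auto
  also have "\<dots> = (x powr \<alpha> + y powr \<alpha>) / (x + y) powr \<alpha>"
    using assms s by (simp add: powr_divide add_divide_distrib)
  finally show ?thesis using s by (simp add: field_simps)
qed (use assms in auto)

lemma powr_sum_le:
  assumes "0 < \<alpha>" "(\<alpha>::real) \<le> 1" "finite S" "\<And>i. i \<in> S \<Longrightarrow> x i \<ge> 0"
  shows "(\<Sum>i\<in>S. x i) powr \<alpha> \<le> (\<Sum>i\<in>S. x i powr \<alpha>)"
  using assms(3,4)
proof (induction S rule: finite_induct)
  case (insert i S)
  have "(\<Sum>i\<in>insert i S. x i) powr \<alpha> \<le> x i powr \<alpha> + (\<Sum>i\<in>S. x i) powr \<alpha>"
    using insert assms powr_add_le[of \<alpha> "x i" "\<Sum>i\<in>S. x i"] by (simp add: sum_nonneg)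
  also have "\<dots> \<le> x i powr \<alpha> + (\<Sum>i\<in>S. x i powr \<alpha>)" using insert by simp
  finally show ?case using insert by simp
qed simp

text \<open>Stands in for Holder's inequality where the exponent varies from point to point: the
  constant 1 is the same for all s and t.\<close>

lemma powr_le_one_plus_powr:
  assumes "0 \<le> (x::real)" "0 \<le> s" "s \<le> t"
  shows "x powr s \<le> 1 + x powr t"
proof (cases "x \<le> 1")
  case True
  then have "x powr s \<le> 1" using assms powr_mono2[of s x 1] by simp
  then show ?thesis by (simp add: add_increasing2)
next
  case False
  then show ?thesis using assms powr_mono[of s t x] by linarith
qed

section \<open>Averages over the uniform distribution on a finite set\<close>

definition avg :: "'i set \<Rightarrow> ('i \<Rightarrow> real) \<Rightarrow> real" where
  "avg \<Omega> F = (\<Sum>\<omega>\<in>\<Omega>. F \<omega>) / card \<Omega>"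

lemma avg_mono: "(\<And>\<omega>. \<omega> \<in> \<Omega> \<Longrightarrow> F \<omega> \<le> G \<omega>) \<Longrightarrow> avg \<Omega> F \<le> avg \<Omega> G"
  unfolding avg_def by (intro divide_right_mono sum_mono) auto

lemma avg_nonneg: "(\<And>\<omega>. \<omega> \<in> \<Omega> \<Longrightarrow> 0 \<le> F \<omega>) \<Longrightarrow> 0 \<le> avg \<Omega> F"
  unfolding avg_def by (intro divide_nonneg_nonneg sum_nonneg) auto

lemma avg_cong: "(\<And>\<omega>. \<omega> \<in> \<Omega> \<Longrightarrow> F \<omega> = G \<omega>) \<Longrightarrow> avg \<Omega> F = avg \<Omega> G"
  unfolding avg_def by simp

lemma avg_add: "avg \<Omega> (\<lambda>\<omega>. F \<omega> + G \<omega>) = avg \<Omega> F + avg \<Omega> G"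
  unfolding avg_def by (simp add: sum.distrib add_divide_distrib)

lemma avg_diff: "avg \<Omega> (\<lambda>\<omega>. F \<omega> - G \<omega>) = avg \<Omega> F - avg \<Omega> G"
  unfolding avg_def by (simp add: sum_subtractf diff_divide_distrib)

lemma avg_cmult: "avg \<Omega> (\<lambda>\<omega>. c * F \<omega>) = c * avg \<Omega> F"
  unfolding avg_def by (simp add: sum_distrib_left)

lemma avg_const: "finite \<Omega> \<Longrightarrow> \<Omega> \<noteq> {} \<Longrightarrow> avg \<Omega> (\<lambda>\<omega>. c) = c"
  unfolding avg_def by simp

lemma avg_sum: "avg \<Omega> (\<lambda>\<omega>. \<Sum>k\<in>S. F k \<omega>) = (\<Sum>k\<in>S. avg \<Omega> (F k))"
  unfolding avg_def by (subst sum.swap) (simp add: sum_divide_distrib)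

lemma avg_Times: "avg (X \<times> Y) F = avg X (\<lambda>x. avg Y (\<lambda>y. F (x, y)))"
  unfolding avg_def
  by (simp add: sum.cartesian_product card_cartesian_product sum_divide_distrib[symmetric] mult.commute)

lemma powr_avg_le:
  assumes "finite \<Omega>" "\<Omega> \<noteq> {}" "\<And>\<omega>. \<omega> \<in> \<Omega> \<Longrightarrow> 0 \<le> F \<omega>" "(p::real) \<ge> 1"
  shows "avg \<Omega> F powr p \<le> avg \<Omega> (\<lambda>\<omega>. F \<omega> powr p)"
  using powr_weighted_sum_le[of \<Omega> "\<lambda>_. 1 / card \<Omega>" F p] assms
  by (simp add: avg_def sum_divide_distrib)

text \<open>Jensen for the power t / s: the L^s norms of a probability measure increase with
  s.\<close>

lemma avg_powr_le:
  assumes "finite \<Omega>" "\<Omega> \<noteq> {}" "\<And>\<omega>. \<omega> \<in> \<Omega> \<Longrightarrow> 0 \<le> F \<omega>" "0 < s" "s \<le> (t::real)"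
  shows "avg \<Omega> (\<lambda>\<omega>. F \<omega> powr s) \<le> avg \<Omega> (\<lambda>\<omega>. F \<omega> powr t) powr (s / t)"
proof -
  have "avg \<Omega> (\<lambda>\<omega>. F \<omega> powr s) powr (t / s) \<le> avg \<Omega> (\<lambda>\<omega>. (F \<omega> powr s) powr (t / s))"
    using assms by (intro powr_avg_le) auto
  also have "\<dots> = avg \<Omega> (\<lambda>\<omega>. F \<omega> powr t)" using assms by (simp add: powr_powr)
  finally have "(avg \<Omega> (\<lambda>\<omega>. F \<omega> powr s) powr (t / s)) powr (s / t)
      \<le> avg \<Omega> (\<lambda>\<omega>. F \<omega> powr t) powr (s / t)"
    using assms by (intro powr_mono2) auto
  then show ?thesis using assms by (simp add: powr_powr avg_nonneg)
qed

section \<open>Finite l^r norms: Holder and Minkowski\<close>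

definition lnorm :: "real \<Rightarrow> 'i set \<Rightarrow> ('i \<Rightarrow> real) \<Rightarrow> real" where
  "lnorm r S a = (\<Sum>k\<in>S. \<bar>a k\<bar> powr r) powr (1 / r)"

lemma lnorm_nonneg[simp]: "0 \<le> lnorm r S a"
  by (simp add: lnorm_def)

lemma lnorm_powr: "r > 0 \<Longrightarrow> lnorm r S a powr r = (\<Sum>k\<in>S. \<bar>a k\<bar> powr r)"
  by (simp add: lnorm_def powr_powr sum_nonneg)

lemma lnorm_mono:
  assumes "r > 0" "\<And>k. k \<in> S \<Longrightarrow> \<bar>a k\<bar> \<le> \<bar>b k\<bar>"
  shows "lnorm r S a \<le> lnorm r S b"
  unfolding lnorm_def using assms by (intro powr_mono2 sum_mono sum_nonneg) auto

lemma lnorm_cong: "(\<And>k. k \<in> S \<Longrightarrow> \<bar>a k\<bar> = \<bar>b k\<bar>) \<Longrightarrow> lnorm r S a = lnorm r S b"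
  unfolding lnorm_def by simp

lemma lnorm_cmult: "r > 0 \<Longrightarrow> lnorm r S (\<lambda>k. c * a k) = \<bar>c\<bar> * lnorm r S a"
  unfolding lnorm_def
  by (simp add: abs_mult powr_mult sum_distrib_left[symmetric] powr_powr sum_nonneg)

lemma lnorm_eq_0_iff: "finite S \<Longrightarrow> lnorm r S a = 0 \<longleftrightarrow> (\<forall>k\<in>S. a k = 0)"
  unfolding lnorm_def by (simp add: sum_nonneg_eq_0_iff)

lemma abs_le_lnorm:
  assumes "r > 0" "finite S" "k \<in> S" shows "\<bar>a k\<bar> \<le> lnorm r S a"
proof -
  have "\<bar>a k\<bar> = (\<bar>a k\<bar> powr r) powr (1 / r)" using assms by (simp add: powr_powr)
  also have "\<dots> \<le> lnorm r S a" unfolding lnorm_def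
    using assms by (intro powr_mono2 member_le_sum) auto
  finally show ?thesis .
qed

text \<open>Subadditivity of the power s / t <= 1, applied to the t-th powers of the
  entries.\<close>

lemma lnorm_antimono:
  assumes "0 < s" "s \<le> t" "finite S"
  shows "lnorm t S a \<le> lnorm s S a"
proof -
  have "(\<Sum>k\<in>S. \<bar>a k\<bar> powr t) powr (s / t) \<le> (\<Sum>k\<in>S. (\<bar>a k\<bar> powr t) powr (s / t))"
    using assms by (intro powr_sum_le) auto
  also have "\<dots> = (\<Sum>k\<in>S. \<bar>a k\<bar> powr s)" using assms by (simp add: powr_powr)
  finally have "((\<Sum>k\<in>S. \<bar>a k\<bar> powr t) powr (s / t)) powr (1 / s) \<le> lnorm s S a"
    unfolding lnorm_def using assms by (intro powr_mono2) auto
  then show ?thesis using assms by (simp add: lnorm_def powr_powr)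
qed

lemma lnorm_le_sum:
  assumes "1 \<le> r" "finite S" shows "lnorm r S a \<le> (\<Sum>k\<in>S. \<bar>a k\<bar>)"
  using lnorm_antimono[of 1 r S a] assms by (simp add: lnorm_def sum_nonneg)

text \<open>The power mean inequality for the uniform distribution on \<open>S\<close>; returning to
  counting measure produces the power of the cardinality.\<close>

lemma lnorm_le_card:
  assumes "0 < s" "s \<le> t" "finite S" "S \<noteq> {}"
  shows "lnorm s S a \<le> real (card S) powr (1 / s - 1 / t) * lnorm t S a"
proof -
  have c: "real (card S) > 0" using assms by (simp add: card_gt_0_iff)
  have *: "(\<Sum>k\<in>S. \<bar>a k\<bar> powr u) = card S * avg S (\<lambda>k. \<bar>a k\<bar> powr u)" for u
    using c by (simp add: avg_def)
  have "avg S (\<lambda>k. \<bar>a k\<bar> powr s) powr (1 / s) \<le> (avg S (\<lambda>k. \<bar>a k\<bar> powr t) powr (s / t)) powr (1 / s)"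
    using assms by (intro powr_mono2 avg_powr_le avg_nonneg) auto
  also have "\<dots> = avg S (\<lambda>k. \<bar>a k\<bar> powr t) powr (1 / t)" using assms by (simp add: powr_powr)
  finally have "real (card S) powr (1 / s) * avg S (\<lambda>k. \<bar>a k\<bar> powr s) powr (1 / s)
      \<le> (real (card S) powr (1 / s - 1 / t) * real (card S) powr (1 / t)) * avg S (\<lambda>k. \<bar>a k\<bar> powr t) powr (1 / t)"
    using c by (simp add: powr_add[symmetric] mult_left_mono)
  then show ?thesis unfolding lnorm_def * using c by (simp add: powr_mult avg_nonneg mult.assoc)
qed

text \<open>Young's inequality, entry by entry, for the sequences normalised to norm one.\<close>

lemma lnorm_Holder:
  assumes "1 < r" "1 < r'" "1 / r + 1 / r' = 1" "finite S"
  shows "\<bar>\<Sum>k\<in>S. a k * b k\<bar> \<le> lnorm r S a * lnorm r' S b"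
proof (cases "lnorm r S a = 0 \<or> lnorm r' S b = 0")
  case True
  then show ?thesis using assms by (auto simp: lnorm_eq_0_iff)
next
  case False
  define A B where "A = lnorm r S a" and "B = lnorm r' S b"
  have AB: "A > 0" "B > 0" using False by (simp_all add: A_def B_def less_le)
  have "\<bar>\<Sum>k\<in>S. a k * b k\<bar> / (A * B) \<le> (\<Sum>k\<in>S. (\<bar>a k\<bar> / A) * (\<bar>b k\<bar> / B))"
    using AB by (simp add: sum_divide_distrib[symmetric] divide_right_mono sum_abs flip: abs_mult)
  also have "\<dots> \<le> (\<Sum>k\<in>S. (\<bar>a k\<bar> / A) powr r / r + (\<bar>b k\<bar> / B) powr r' / r')"
    using AB assms by (intro sum_mono Youngs_inequality) auto
  also have "\<dots> = (\<Sum>k\<in>S. \<bar>a k\<bar> powr r) / A powr r / r + (\<Sum>k\<in>S. \<bar>b k\<bar> powr r') / B powr r' / r'"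
    using AB by (simp add: powr_divide sum.distrib sum_divide_distrib)
  also have "\<dots> = 1"
    using AB assms by (simp add: A_def B_def flip: lnorm_powr)
  finally show ?thesis using AB by (simp add: A_def B_def)
qed

text \<open>Entrywise, |a + b| / (A + B) is at most a convex combination of |a| / A and |b| / B with
  weights A / (A + B) and B / (A + B); the r-th power is convex and the normalised sequences have
  norm one.\<close>

lemma lnorm_triangle:
  assumes "1 \<le> r" "finite S"
  shows "lnorm r S (\<lambda>k. a k + b k) \<le> lnorm r S a + lnorm r S b"
proof (cases "lnorm r S a = 0 \<or> lnorm r S b = 0")
  case True
  then show ?thesis
  proof
    assume "lnorm r S a = 0"
    then have "lnorm r S (\<lambda>k. a k + b k) = lnorm r S b"
      using assms by (intro lnorm_cong) (simp add: lnorm_eq_0_iff)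
    then show ?thesis by simp
  next
    assume "lnorm r S b = 0"
    then have "lnorm r S (\<lambda>k. a k + b k) = lnorm r S a"
      using assms by (intro lnorm_cong) (simp add: lnorm_eq_0_iff)
    then show ?thesis by simp
  qed
next
  case False
  define A B where "A = lnorm r S a" and "B = lnorm r S b"
  have AB: "A > 0" "B > 0" using False by (simp_all add: A_def B_def less_le)
  have one: "(\<Sum>k\<in>S. (\<bar>c k\<bar> / C) powr r) = 1" if "C = lnorm r S c" "C > 0" for c C
    using that assms by (simp add: powr_divide flip: sum_divide_distrib lnorm_powr)
  have "(\<Sum>k\<in>S. (\<bar>a k + b k\<bar> / (A + B)) powr r)
      \<le> (\<Sum>k\<in>S. A / (A + B) * (\<bar>a k\<bar> / A) powr r + B / (A + B) * (\<bar>b k\<bar> / B) powr r)"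
  proof (rule sum_mono)
    fix k assume "k \<in> S"
    have eq: "1 - B / (A + B) = A / (A + B)" using AB by (simp add: field_simps)
    have "\<bar>a k + b k\<bar> / (A + B) \<le> (\<bar>a k\<bar> + \<bar>b k\<bar>) / (A + B)"
      using AB by (intro divide_right_mono) auto
    also have "\<dots> = (1 - B / (A + B)) * (\<bar>a k\<bar> / A) + B / (A + B) * (\<bar>b k\<bar> / B)"
      unfolding eq using AB by (simp add: add_divide_distrib)
    finally have "(\<bar>a k + b k\<bar> / (A + B)) powr r
        \<le> ((1 - B / (A + B)) * (\<bar>a k\<bar> / A) + B / (A + B) * (\<bar>b k\<bar> / B)) powr r"
      using AB assms by (intro powr_mono2) auto
    also have "\<dots> \<le> (1 - B / (A + B)) * (\<bar>a k\<bar> / A) powr r + B / (A + B) * (\<bar>b k\<bar> / B) powr r"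
      using convex_onD[OF convex_on_powr_nonneg[OF assms(1)], of "B / (A + B)" "\<bar>a k\<bar> / A" "\<bar>b k\<bar> / B"] AB
      by simp
    finally show "(\<bar>a k + b k\<bar> / (A + B)) powr r
        \<le> A / (A + B) * (\<bar>a k\<bar> / A) powr r + B / (A + B) * (\<bar>b k\<bar> / B) powr r"
      unfolding eq .
  qed
  also have "\<dots> = A / (A + B) * (\<Sum>k\<in>S. (\<bar>a k\<bar> / A) powr r) + B / (A + B) * (\<Sum>k\<in>S. (\<bar>b k\<bar> / B) powr r)"
    by (simp only: sum.distrib sum_distrib_left)
  also have "\<dots> = 1"
    using AB by (simp add: one[OF A_def] one[OF B_def] flip: add_divide_distrib)
  finally have "(\<Sum>k\<in>S. \<bar>a k + b k\<bar> powr r) \<le> (A + B) powr r"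
    using AB by (simp add: powr_divide sum_divide_distrib[symmetric])
  then have "lnorm r S (\<lambda>k. a k + b k) \<le> ((A + B) powr r) powr (1 / r)"
    unfolding lnorm_def using assms by (intro powr_mono2) (auto intro: sum_nonneg)
  then show ?thesis using AB assms by (simp add: powr_powr A_def B_def)
qed

lemma lnorm_sum:
  assumes "1 \<le> r" "finite S" "finite J"
  shows "lnorm r S (\<lambda>k. \<Sum>j\<in>J. a j k) \<le> (\<Sum>j\<in>J. lnorm r S (a j))"
  using assms(3)
proof (induction J rule: finite_induct)
  case empty
  then show ?case using assms by (simp add: lnorm_def)
next
  case (insert j J)
  then show ?case
    using lnorm_triangle[OF assms(1,2), of "a j" "\<lambda>k. \<Sum>j\<in>J. a j k"] by simp
qed

section \<open>Random signs and stable systems on finite sets\<close>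

text \<open>A sign vector is encoded by the set where it is -1. Under the uniform distribution on
  \<open>Pow S\<close> the maps \<open>eps k\<close> with k in \<open>S\<close> are independent
  Rademacher signs.\<close>

definition eps :: "'i \<Rightarrow> 'i set \<Rightarrow> real" where
  "eps k A = (if k \<in> A then -1 else 1)"

lemma abs_eps[simp]: "\<bar>eps k A\<bar> = 1"
  by (simp add: eps_def)

text \<open>Conditioning on all signs but that of \<open>x\<close>: each \<open>A\<close> is paired
  with \<open>insert x A\<close>. Moments of Rademacher sums are computed by induction along this
  identity.\<close>

lemma avg_Pow_insert:
  assumes "finite S" "x \<notin> S"
  shows "avg (Pow (insert x S)) F = avg (Pow S) (\<lambda>A. (F A + F (insert x A)) / 2)"
proof -
  have inj: "inj_on (insert x) (Pow S)"
    using assms by (auto simp: inj_on_def)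
  have "(\<Sum>A\<in>Pow (insert x S). F A) = (\<Sum>A\<in>Pow S. F A) + (\<Sum>A\<in>insert x ` Pow S. F A)"
    unfolding Pow_insert using assms by (intro sum.union_disjoint) auto
  also have "(\<Sum>A\<in>insert x ` Pow S. F A) = (\<Sum>A\<in>Pow S. F (insert x A))"
    by (subst sum.reindex[OF inj]) simp
  finally show ?thesis
    using assms by (simp add: avg_def card_Pow sum.distrib sum_divide_distrib[symmetric] field_simps)
qed

lemma avg_Pow_insert_linear:
  assumes "finite S" "x \<notin> S"
  shows "avg (Pow (insert x S)) (\<lambda>A. G (\<Sum>k\<in>insert x S. a k * eps k A))
    = avg (Pow S) (\<lambda>A. (G ((\<Sum>k\<in>S. a k * eps k A) + a x) + G ((\<Sum>k\<in>S. a k * eps k A) - a x)) / 2)"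
  unfolding avg_Pow_insert[OF assms]
proof (rule avg_cong)
  fix A assume "A \<in> Pow S"
  then have "x \<notin> A" using assms by auto
  moreover have "(\<Sum>k\<in>S. a k * eps k (insert x A)) = (\<Sum>k\<in>S. a k * eps k A)"
    using assms by (intro sum.cong) (auto simp: eps_def)
  ultimately show "(G (\<Sum>k\<in>insert x S. a k * eps k A) + G (\<Sum>k\<in>insert x S. a k * eps k (insert x A))) / 2 =
      (G ((\<Sum>k\<in>S. a k * eps k A) + a x) + G ((\<Sum>k\<in>S. a k * eps k A) - a x)) / 2"
    using assms by (simp add: eps_def[of x] add.commute)
qed

lemma rademacher_moment2:
  assumes "finite S"
  shows "avg (Pow S) (\<lambda>A. (\<Sum>k\<in>S. a k * eps k A)\<^sup>2) = (\<Sum>k\<in>S. (a k)\<^sup>2)"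
  using assms
proof (induction S rule: finite_induct)
  case (insert x S)
  have "((s + a x)\<^sup>2 + (s - a x)\<^sup>2) / 2 = s\<^sup>2 + (a x)\<^sup>2" for s :: real
    by (simp add: power2_eq_square field_simps)
  then have "avg (Pow (insert x S)) (\<lambda>A. (\<Sum>k\<in>insert x S. a k * eps k A)\<^sup>2)
      = avg (Pow S) (\<lambda>A. (\<Sum>k\<in>S. a k * eps k A)\<^sup>2) + avg (Pow S) (\<lambda>A. (a x)\<^sup>2)"
    by (simp only: avg_Pow_insert_linear[OF insert(1,2), of "\<lambda>s. s\<^sup>2" a] avg_add)
  then show ?case using insert by (subst (asm) avg_const) auto
qed (simp add: avg_def)

text \<open>The constant 3 is the Gaussian fourth moment. In the induction the mixed term 6 a^2
  \<Sum> a_k^2 already fits 3 times a square; a^4 is enlarged to 3 a^4 to complete it.\<close>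

lemma rademacher_moment4:
  assumes "finite S"
  shows "avg (Pow S) (\<lambda>A. (\<Sum>k\<in>S. a k * eps k A) ^ 4) \<le> 3 * (\<Sum>k\<in>S. (a k)\<^sup>2)\<^sup>2"
  using assms
proof (induction S rule: finite_induct)
  case (insert x S)
  have "((s + a x) ^ 4 + (s - a x) ^ 4) / 2 = s ^ 4 + 6 * (a x)\<^sup>2 * s\<^sup>2 + (a x) ^ 4" for s :: real
    by (simp add: power2_eq_square power4_eq_xxxx algebra_simps)
  then have "avg (Pow (insert x S)) (\<lambda>A. (\<Sum>k\<in>insert x S. a k * eps k A) ^ 4)
     = avg (Pow S) (\<lambda>A. (\<Sum>k\<in>S. a k * eps k A) ^ 4) + 6 * (a x)\<^sup>2 * (\<Sum>k\<in>S. (a k)\<^sup>2)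
       + avg (Pow S) (\<lambda>A. (a x) ^ 4)"
    by (simp only: avg_Pow_insert_linear[OF insert(1,2), of "\<lambda>s. s ^ 4" a] avg_add avg_cmult
      rademacher_moment2[OF insert(1), of a])
  also have "avg (Pow S) (\<lambda>A. (a x) ^ 4) = (a x) ^ 4" using insert by (intro avg_const) auto
  also have "avg (Pow S) (\<lambda>A. (\<Sum>k\<in>S. a k * eps k A) ^ 4) + 6 * (a x)\<^sup>2 * (\<Sum>k\<in>S. (a k)\<^sup>2) + (a x) ^ 4
     \<le> 3 * (\<Sum>k\<in>S. (a k)\<^sup>2)\<^sup>2 + 6 * (a x)\<^sup>2 * (\<Sum>k\<in>S. (a k)\<^sup>2) + 3 * (a x) ^ 4"
    using insert.IH zero_le_power2[of "(a x)\<^sup>2"] by (simp add: power4_eq_xxxx power2_eq_square mult.assoc)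
  also have "\<dots> = 3 * (\<Sum>k\<in>insert x S. (a k)\<^sup>2)\<^sup>2"
    using insert by (simp add: power2_eq_square power4_eq_xxxx algebra_simps)
  finally show ?case .
qed (simp add: avg_def)

text \<open>A sub-Gaussian bound with x^2 in place of the sharp x^2 / 2. For |x| <= 1 the quantity 1
  + x^2 separates the two sides; for |x| > 1 each exponential alone is at most exp (x^2).\<close>

lemma cosh_le_exp_square: "(exp x + exp (- x)) / 2 \<le> exp (x\<^sup>2)" for x :: real
proof (cases "\<bar>x\<bar> \<le> 1")
  case True
  have "exp \<bar>x\<bar> \<le> 1 + \<bar>x\<bar> + x\<^sup>2" using exp_bound[of "\<bar>x\<bar>"] True by simp
  moreover have "exp (- \<bar>x\<bar>) \<le> 1 - \<bar>x\<bar> + x\<^sup>2"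
  proof -
    have "(1 - y + y\<^sup>2) * (1 + y) - 1 = y ^ 3" for y :: real
      by (simp add: algebra_simps power2_eq_square power3_eq_cube)
    from this[of "\<bar>x\<bar>"] have "0 \<le> (1 - \<bar>x\<bar> + x\<^sup>2) * (1 + \<bar>x\<bar>) - 1" by simp
    moreover have "(1 - \<bar>x\<bar> + x\<^sup>2) * (1 + \<bar>x\<bar>) \<le> (1 - \<bar>x\<bar> + x\<^sup>2) * exp \<bar>x\<bar>"
      using True by (intro mult_left_mono) auto
    ultimately show ?thesis by (simp add: exp_minus field_simps)
  qed
  ultimately have "(exp \<bar>x\<bar> + exp (- \<bar>x\<bar>)) / 2 \<le> 1 + x\<^sup>2" by simp
  also have "\<dots> \<le> exp (x\<^sup>2)" by simp
  finally show ?thesis by (cases "x \<ge> 0") (auto simp: add.commute)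
next
  case False
  then have "\<bar>x\<bar> * 1 \<le> \<bar>x\<bar> * \<bar>x\<bar>" by (intro mult_left_mono) auto
  then have "\<bar>x\<bar> \<le> x\<^sup>2" by (simp add: power2_eq_square)
  then have "exp x \<le> exp (x\<^sup>2)" "exp (- x) \<le> exp (x\<^sup>2)" by auto
  moreover have "(u + v) / 2 \<le> w" if "u \<le> w" "v \<le> w" for u v w :: real using that by simp
  ultimately show ?thesis by blast
qed

lemma rademacher_exp:
  assumes "finite S"
  shows "avg (Pow S) (\<lambda>A. exp (\<Sum>k\<in>S. a k * eps k A)) \<le> exp (\<Sum>k\<in>S. (a k)\<^sup>2)"
  using assms
proof (induction S rule: finite_induct)
  case (insert x S)
  have "(exp (s + a x) + exp (s - a x)) / 2 = (exp (a x) + exp (- a x)) / 2 * exp s" for s :: real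
    by (simp add: exp_add exp_diff exp_minus field_simps)
  then have "avg (Pow (insert x S)) (\<lambda>A. exp (\<Sum>k\<in>insert x S. a k * eps k A))
     = (exp (a x) + exp (- a x)) / 2 * avg (Pow S) (\<lambda>A. exp (\<Sum>k\<in>S. a k * eps k A))"
    using insert avg_Pow_insert_linear[OF insert(1,2), of "\<lambda>s. exp s" a]
    by (simp only: avg_cmult)
  also have "\<dots> \<le> exp ((a x)\<^sup>2) * exp (\<Sum>k\<in>S. (a k)\<^sup>2)"
    using insert.IH by (intro mult_mono cosh_le_exp_square avg_nonneg) (auto intro: add_nonneg_nonneg)
  also have "\<dots> = exp (\<Sum>k\<in>insert x S. (a k)\<^sup>2)" using insert by (simp add: exp_add)
  finally show ?case .
qed (simp add: avg_def)

section \<open>Khinchine's inequalities\<close>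

lemma lnorm_2: "lnorm 2 S a = sqrt (\<Sum>k\<in>S. (a k)\<^sup>2)"
  by (simp add: lnorm_def powr_half_sqrt sum_nonneg powr_numeral)

text \<open>Both sides are homogeneous of degree t in the coefficients, so a bound on unit vectors
  extends to all vectors.\<close>

lemma moment_bound_homogeneous:
  assumes "finite S" "r > 0" "t > 0"
    "\<And>a. lnorm r S a = 1 \<Longrightarrow> avg \<Omega> (\<lambda>\<omega>. \<bar>\<Sum>k\<in>S. a k * \<theta> k \<omega>\<bar> powr t) \<le> C"
  shows "avg \<Omega> (\<lambda>\<omega>. \<bar>\<Sum>k\<in>S. a k * \<theta> k \<omega>\<bar> powr t) \<le> C * lnorm r S a powr t"
proof (cases "lnorm r S a = 0")
  case True
  then show ?thesis using assms by (simp add: lnorm_eq_0_iff avg_def) (simp add: True)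
next
  case False
  define L where "L = lnorm r S a"
  have L: "L > 0" using False by (simp add: L_def less_le)
  have 1: "lnorm r S (\<lambda>k. inverse L * a k) = 1"
    using L assms by (subst lnorm_cmult) (auto simp: L_def)
  have "\<bar>\<Sum>k\<in>S. a k * \<theta> k \<omega>\<bar> powr t = L powr t * \<bar>\<Sum>k\<in>S. (inverse L * a k) * \<theta> k \<omega>\<bar> powr t" for \<omega>
  proof -
    have "(\<Sum>k\<in>S. a k * \<theta> k \<omega>) = L * (\<Sum>k\<in>S. (inverse L * a k) * \<theta> k \<omega>)"
      using L by (simp add: sum_distrib_left flip: mult.assoc)
    then show ?thesis using L by (simp add: abs_mult powr_mult)
  qed
  then show ?thesis
    using mult_left_mono[OF assms(4)[OF 1], of "L powr t"]
    by (simp only: avg_cmult) (simp add: L_def mult.commute)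
qed

text \<open>Exponential moments dominate power moments: |x|^t <= (1 + N!) (exp x + exp (- x)) for N
  >= t, and for a unit vector both exponential moments are at most e.\<close>

lemma khinchine_upper:
  assumes "t > 0"
  obtains C where "C \<ge> 1"
    "\<And>S :: 'i set. \<And>a. finite S \<Longrightarrow>
       avg (Pow S) (\<lambda>A. \<bar>\<Sum>k\<in>S. a k * eps k A\<bar> powr t) \<le> C * lnorm 2 S a powr t"
proof
  define N where "N = nat \<lceil>t\<rceil>"
  have N: "t \<le> real N" using assms by (simp add: N_def)
  define C where "C = (1 + fact N) * 2 * exp (1::real)"
  have "1 * 1 \<le> (1 + fact N) * (2 * exp (1::real))"
    using exp_ge_add_one_self[of 1] by (intro mult_mono) (auto simp: fact_ge_zero simp del: exp_ge_add_one_self)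
  then show "C \<ge> 1" unfolding C_def by (simp only: mult_1 mult.assoc)
  fix S :: "'i set" and a :: "'i \<Rightarrow> real" assume S: "finite S"
  have pt: "\<bar>x\<bar> powr t \<le> (1 + fact N) * (exp x + exp (- x))" for x :: real
  proof -
    have "\<bar>x\<bar> powr t \<le> 1 + \<bar>x\<bar> powr N"
      using assms N by (intro powr_le_one_plus_powr) auto
    also have "\<bar>x\<bar> powr N = \<bar>x\<bar> ^ N" using N assms by (subst powr_realpow') auto
    also have "\<bar>x\<bar> ^ N \<le> fact N * exp \<bar>x\<bar>"
    proof -
      have "\<bar>x\<bar> ^ N /\<^sub>R fact N \<le> (\<Sum>n. \<bar>x\<bar> ^ n /\<^sub>R fact n)"
        using sum_le_suminf[OF summable_exp_generic[of "\<bar>x\<bar>"], of "{N}"] by simp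
      then show ?thesis by (simp add: exp_def field_simps)
    qed
    also have "1 + fact N * exp \<bar>x\<bar> \<le> (1 + fact N) * exp \<bar>x\<bar>" by (simp add: algebra_simps)
    also have "\<dots> \<le> (1 + fact N) * (exp x + exp (- x))"
      by (intro mult_left_mono) (auto simp: abs_if add_increasing)
    finally show ?thesis by simp
  qed
  show "avg (Pow S) (\<lambda>A. \<bar>\<Sum>k\<in>S. a k * eps k A\<bar> powr t) \<le> C * lnorm 2 S a powr t"
  proof (rule moment_bound_homogeneous)
    fix a :: "'i \<Rightarrow> real" assume "lnorm 2 S a = 1"
    then have 1: "(\<Sum>k\<in>S. (a k)\<^sup>2) = 1" by (simp add: lnorm_2)
    have "avg (Pow S) (\<lambda>A. \<bar>\<Sum>k\<in>S. a k * eps k A\<bar> powr t)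
        \<le> (1 + fact N) * (avg (Pow S) (\<lambda>A. exp (\<Sum>k\<in>S. a k * eps k A)) + avg (Pow S) (\<lambda>A. exp (\<Sum>k\<in>S. (- a k) * eps k A)))"
      unfolding avg_add[symmetric] avg_cmult[symmetric]
      using pt by (intro avg_mono) (simp add: sum_negf)
    also have "\<dots> \<le> (1 + fact N) * (exp 1 + exp 1)"
      using rademacher_exp[OF S, of a] rademacher_exp[OF S, of "\<lambda>k. - a k"] 1
      by (intro mult_left_mono add_mono) auto
    finally show "avg (Pow S) (\<lambda>A. \<bar>\<Sum>k\<in>S. a k * eps k A\<bar> powr t) \<le> C"
      by (simp add: C_def algebra_simps)
  qed (use S assms in auto)
qed

text \<open>For y >= 0 the polynomial y^2 - (4/27) y^4 lies below y and touches it at y = 3/2, which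
  reduces the first moment to the second and the fourth. With second moment 1 and fourth moment at
  most 3 there remains 1 - 3 (4/27) = 5/9.\<close>

lemma khinchine_lower:
  assumes "finite S"
  shows "5 / 9 * lnorm 2 S a \<le> avg (Pow S) (\<lambda>A. \<bar>\<Sum>k\<in>S. a k * eps k A\<bar>)"
proof (cases "lnorm 2 S a = 0")
  case False
  define L where "L = lnorm 2 S a"
  have L: "L > 0" using False by (simp add: L_def less_le)
  have L2: "L\<^sup>2 = (\<Sum>k\<in>S. (a k)\<^sup>2)" by (simp add: L_def lnorm_2 sum_nonneg)
  have pt: "L * (s / L)\<^sup>2 - L * (4 / 27) * (s / L) ^ 4 \<le> \<bar>s\<bar>" for s
  proof -
    define y where "y = \<bar>s\<bar> / L"
    have y: "y \<ge> 0" using L by (simp add: y_def)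
    have "0 \<le> (y - 3/2)\<^sup>2 * (y + 3) * (4 / 27) * y" using y by simp
    also have "\<dots> = y - y\<^sup>2 + 4 / 27 * y ^ 4"
      by (simp add: power2_eq_square power4_eq_xxxx algebra_simps)
    finally have "L * (y\<^sup>2 - 4 / 27 * y ^ 4) \<le> L * y" using L by (intro mult_left_mono) auto
    moreover have "y\<^sup>2 = (s / L)\<^sup>2" "y ^ 4 = (s / L) ^ 4" using L by (simp_all add: y_def power_divide)
    ultimately show ?thesis using L by (simp add: y_def algebra_simps)
  qed
  have "avg (Pow S) (\<lambda>A. L * ((\<Sum>k\<in>S. a k * eps k A) / L)\<^sup>2)
      - avg (Pow S) (\<lambda>A. L * (4 / 27) * ((\<Sum>k\<in>S. a k * eps k A) / L) ^ 4)
      \<le> avg (Pow S) (\<lambda>A. \<bar>\<Sum>k\<in>S. a k * eps k A\<bar>)"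
    unfolding avg_diff[symmetric] by (intro avg_mono pt)
  moreover have "avg (Pow S) (\<lambda>A. L * ((\<Sum>k\<in>S. a k * eps k A) / L)\<^sup>2) = L"
  proof -
    have "avg (Pow S) (\<lambda>A. L * ((\<Sum>k\<in>S. a k * eps k A) / L)\<^sup>2) =
       avg (Pow S) (\<lambda>A. (1 / L) * (\<Sum>k\<in>S. a k * eps k A)\<^sup>2)"
      using L by (intro avg_cong) (simp add: power2_eq_square)
    then show ?thesis using L by (simp only: avg_cmult rademacher_moment2[OF assms] L2[symmetric])
       (simp add: power2_eq_square)
  qed
  moreover have "avg (Pow S) (\<lambda>A. L * (4 / 27) * ((\<Sum>k\<in>S. a k * eps k A) / L) ^ 4) \<le> 4 / 9 * L"
  proof -
    have "avg (Pow S) (\<lambda>A. L * (4 / 27) * ((\<Sum>k\<in>S. a k * eps k A) / L) ^ 4) =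
       avg (Pow S) (\<lambda>A. (4 / 27 / L ^ 3) * (\<Sum>k\<in>S. a k * eps k A) ^ 4)"
      using L by (intro avg_cong) (simp add: power4_eq_xxxx power3_eq_cube)
    also have "\<dots> \<le> (4 / 27 / L ^ 3) * (3 * (L\<^sup>2)\<^sup>2)"
      unfolding avg_cmult L2 using L by (intro mult_left_mono rademacher_moment4[OF assms]) auto
    also have "\<dots> = 4 / 9 * L" using L by (simp add: power2_eq_square power3_eq_cube)
    finally show ?thesis .
  qed
  ultimately show ?thesis by (simp add: L_def)
qed (simp add: avg_nonneg)

section \<open>Truncated moments of discrete Pareto variables\<close>

lemma powr_sum_harmonic_le:
  assumes "0 \<le> \<tau>" "\<tau> < (1::real)"
  shows "(\<Sum>j=1..n. real j powr (- \<tau>)) \<le> real n powr (1 - \<tau>) / (1 - \<tau>)"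
proof (induction n)
  case (Suc n)
  define x where "x = real (Suc n)"
  have x: "x > 0" by (simp add: x_def)
  \<comment> \<open>Weighted AM-GM, that is, concavity of the power 1 - \<tau>. It bounds
    x^(-\<tau>) by a difference of two values of y^(1 - \<tau>) / (1 - \<tau>), as in a comparison
    with the integral.\<close>
  have "(1 - 1 / x) powr (1 - \<tau>) \<le> (1 - \<tau>) * (1 - 1 / x) + \<tau>"
  proof (cases "n = 0")
    case False
    then show ?thesis
      using Youngs_inequality_0[of "1 - \<tau>" \<tau> "1 - 1 / x" 1] assms by (simp add: x_def)
  qed (use assms in \<open>simp add: x_def\<close>)
  then have "x powr (1 - \<tau>) * (1 - 1 / x) powr (1 - \<tau>) \<le> x powr (1 - \<tau>) * (1 - (1 - \<tau>) / x)"
    using x by (intro mult_left_mono) (auto simp: field_simps)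
  moreover have "x powr (1 - \<tau>) * (1 - 1 / x) powr (1 - \<tau>) = real n powr (1 - \<tau>)"
  proof -
    have "x * (1 - 1 / x) = real n" using x by (simp add: right_diff_distrib) (simp add: x_def)
    moreover have "0 \<le> 1 - 1 / x" by (simp add: x_def)
    ultimately show ?thesis using x by (metis powr_mult less_imp_le)
  qed
  moreover have "x powr (1 - \<tau>) / x = x powr (- \<tau>)"
    using x by (simp add: powr_diff powr_minus field_simps)
  moreover have "x powr (1 - \<tau>) * (1 - (1 - \<tau>) / x) = x powr (1 - \<tau>) - (1 - \<tau>) * (x powr (1 - \<tau>) / x)"
    by (simp add: algebra_simps)
  ultimately have "(1 - \<tau>) * x powr (- \<tau>) \<le> x powr (1 - \<tau>) - real n powr (1 - \<tau>)"
    by simp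
  then have "x powr (- \<tau>) \<le> (x powr (1 - \<tau>) - real n powr (1 - \<tau>)) / (1 - \<tau>)"
    using assms by (simp add: field_simps)
  then show ?case using Suc by (simp add: x_def diff_divide_distrib)
qed simp

text \<open>Comparison with the tail integral: from the second term on, each summand is at most a
  difference of values of x^(1 - \<gamma>) / (\<gamma> - 1), and the first term k^(-\<gamma>) is at
  most k^(1 - \<gamma>).\<close>

lemma powr_tail_sum_le:
  assumes "\<gamma> > (1::real)" "1 \<le> k"
  shows "(\<Sum>j=k..n. real j powr (- \<gamma>)) \<le> \<gamma> / (\<gamma> - 1) * real k powr (1 - \<gamma>)"
proof -
  have k: "real k > 0" using assms by simp
  have step: "real j powr (- \<gamma>) + real j powr (1 - \<gamma>) / (\<gamma> - 1) \<le> real (j - 1) powr (1 - \<gamma>) / (\<gamma> - 1)"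
    if "j \<ge> 2" for j :: nat
  proof -
    define x v where "x = real j" and "v = 1 - 1 / x"
    have x: "x \<ge> 2" using that by (simp add: x_def)
    have v: "0 < v" "v < 1" using x by (auto simp: v_def field_simps)
    have "1 + (\<gamma> - 1) / x = 1 + (\<gamma> - 1) * (1 - v)" by (simp add: v_def)
    also have "\<dots> \<le> 1 + (\<gamma> - 1) * - ln v"
      using ln_le_minus_one[OF v(1)] assms by (intro add_left_mono mult_left_mono) auto
    also have "\<dots> \<le> exp ((\<gamma> - 1) * - ln v)" by (rule exp_ge_add_one_self)
    also have "\<dots> = v powr (1 - \<gamma>)" using v by (simp add: powr_def algebra_simps)
    finally have "x powr (1 - \<gamma>) * (1 + (\<gamma> - 1) / x) \<le> x powr (1 - \<gamma>) * v powr (1 - \<gamma>)"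
      by (intro mult_left_mono) auto
    also have "\<dots> = (x * v) powr (1 - \<gamma>)" using x v by (simp add: powr_mult)
    also have "x * v = real (j - 1)" using that x by (simp add: v_def field_simps x_def)
    finally have "x powr (1 - \<gamma>) + (\<gamma> - 1) * (x powr (1 - \<gamma>) / x) \<le> real (j - 1) powr (1 - \<gamma>)"
      by (simp add: algebra_simps)
    moreover have "x powr (1 - \<gamma>) / x = x powr (- \<gamma>)"
      using x by (simp add: powr_diff powr_minus field_simps)
    ultimately have "x powr (1 - \<gamma>) + (\<gamma> - 1) * x powr (- \<gamma>) \<le> real (j - 1) powr (1 - \<gamma>)"
      by simp
    moreover have "u + v / d \<le> w / d" if "v + d * u \<le> w" "d > 0" for u v w d :: real
      using mult_left_mono[OF that(1), of d] that(2) by (simp add: field_simps)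
    ultimately show ?thesis using assms by (simp add: x_def)
  qed
  \<comment> \<open>The remaining tail is carried along on the left, so that the induction on n
    telescopes.\<close>
  have "(\<Sum>j=k..n. real j powr (- \<gamma>)) + real n powr (1 - \<gamma>) / (\<gamma> - 1)
      \<le> real k powr (- \<gamma>) + real k powr (1 - \<gamma>) / (\<gamma> - 1)" if "k \<le> n"
    using that
  proof (induction n rule: dec_induct)
    case (step n)
    then show ?case using step.IH assms(2) \<open>\<And>j. 2 \<le> j \<Longrightarrow> _\<close>[of "Suc n"] by simp
  qed simp
  moreover have "real k powr (- \<gamma>) \<le> real k powr (1 - \<gamma>)"
    using assms by (intro powr_mono) auto
  moreover have "real n powr (1 - \<gamma>) / (\<gamma> - 1) \<ge> 0" using assms by simp
  moreover have "\<gamma> / (\<gamma> - 1) * real k powr (1 - \<gamma>) = real k powr (1 - \<gamma>) + real k powr (1 - \<gamma>) / (\<gamma> - 1)"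
    using assms by (simp add: field_simps)
  moreover have "0 \<le> \<gamma> / (\<gamma> - 1) * real k powr (1 - \<gamma>)" using assms by simp
  ultimately show ?thesis by (cases "k \<le> n") fastforce+
qed

text \<open>A discrete Pareto variable: on \<open>{1..m}\<close> with the uniform distribution, \<open>pareto r m\<close> exceeds
  \<open>\<lambda>\<close> with probability about \<open>\<lambda>\<close> to the power \<open>-r\<close>.\<close>

definition pareto :: "real \<Rightarrow> nat \<Rightarrow> nat \<Rightarrow> real" where
  "pareto r m j = (m / j) powr (1 / r)"

lemma pareto_nonneg[simp]: "0 \<le> pareto r m j"
  by (simp add: pareto_def)

lemma pareto_scaled:
  assumes "\<beta> \<ge> 0" "r > 0"
  shows "\<beta> * pareto r m j = (m * \<beta> powr r / j) powr (1 / r)"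
  using assms by (simp add: pareto_def powr_mult powr_divide powr_powr)

lemma pareto_scaled_le_1_iff:
  assumes "\<beta> \<ge> 0" "r > 0" "j \<ge> 1"
  shows "\<beta> * pareto r m j \<le> 1 \<longleftrightarrow> m * \<beta> powr r \<le> j"
proof -
  have "\<beta> * pareto r m j \<le> 1 \<longleftrightarrow> (m * \<beta> powr r / j) powr (1 / r) \<le> 1 powr (1 / r)"
    by (simp add: pareto_scaled assms)
  also have "\<dots> \<longleftrightarrow> m * \<beta> powr r / j \<le> 1"
  proof -
    have "z powr (1 / r) \<le> 1 powr (1 / r) \<longleftrightarrow> z \<le> 1" if "z \<ge> 0" for z
      using that assms powr_mono2[of "1 / r" z 1] powr_less_mono2[where a = "1 / r" and x = 1 and y = z]
      by (cases "z \<le> 1") (auto simp: not_le)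
    then show ?thesis by simp
  qed
  finally show ?thesis using assms by (simp add: field_simps)
qed

text \<open>Only j >= y = m \<beta>^r contributes. Since 2 / r > 1, the tail sum of (y / j)^(2 / r)
  is of order y, and division by m leaves \<beta>^r.\<close>

lemma pareto_small_part:
  assumes "0 < r" "r < 2" "\<beta> \<ge> 0" "m \<ge> 1"
  shows "avg {1..m} (\<lambda>j. if \<beta> * pareto r m j \<le> 1 then (\<beta> * pareto r m j)\<^sup>2 else 0)
    \<le> 2 / (2 - r) * \<beta> powr r"
proof (cases "\<beta> = 0")
  case False
  define y where "y = m * \<beta> powr r"
  have y: "y > 0" using False assms by (simp add: y_def)
  define k where "k = nat \<lceil>y\<rceil>"
  have k: "1 \<le> k" "y \<le> real k" using y by (auto simp: k_def) linarith
  define \<gamma> where "\<gamma> = 2 / r"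
  have g: "\<gamma> > 1" using assms by (simp add: \<gamma>_def)
  have "(\<Sum>j=1..m. if \<beta> * pareto r m j \<le> 1 then (\<beta> * pareto r m j)\<^sup>2 else 0)
     = (\<Sum>j=1..m. if y \<le> j then y powr \<gamma> * real j powr (- \<gamma>) else 0)"
  proof (intro sum.cong refl)
    fix j assume j: "j \<in> {1..m}"
    have "(\<beta> * pareto r m j)\<^sup>2 = (y / j) powr \<gamma>"
      using assms y j by (simp add: pareto_scaled y_def[symmetric] \<gamma>_def power2_eq_square flip: powr_add)
    also have "\<dots> = y powr \<gamma> * real j powr (- \<gamma>)"
      using j y by (simp add: powr_divide powr_minus field_simps)
    finally show "(if \<beta> * pareto r m j \<le> 1 then (\<beta> * pareto r m j)\<^sup>2 else 0) =
        (if y \<le> j then y powr \<gamma> * real j powr (- \<gamma>) else 0)"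
      using assms j by (simp add: pareto_scaled_le_1_iff y_def)
  qed
  also have "\<dots> = (\<Sum>j\<in>{j\<in>{1..m}. y \<le> real j}. y powr \<gamma> * real j powr (- \<gamma>))"
    by (subst sum.inter_filter) auto
  also have "{j\<in>{1..m}. y \<le> real j} = {k..m}"
    using k y by (auto simp: k_def) 
  also have "(\<Sum>j=k..m. y powr \<gamma> * real j powr (- \<gamma>)) \<le> y powr \<gamma> * (\<gamma> / (\<gamma> - 1) * real k powr (1 - \<gamma>))"
    unfolding sum_distrib_left[symmetric] using g k by (intro mult_left_mono powr_tail_sum_le) auto
  also have "\<dots> \<le> y powr \<gamma> * (\<gamma> / (\<gamma> - 1) * y powr (1 - \<gamma>))"
    using g k y by (intro mult_left_mono powr_mono2') auto
  also have "\<dots> = \<gamma> / (\<gamma> - 1) * y" using y by (simp add: powr_diff)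
  also have "\<gamma> / (\<gamma> - 1) = 2 / (2 - r)" using assms by (simp add: \<gamma>_def field_simps)
  finally show ?thesis using assms by (simp add: avg_def y_def field_simps)
qed (use assms in \<open>simp add: avg_def\<close>)

text \<open>Only j < y = m \<beta>^r contributes. Since t / r < 1, the initial sum of (y / j)^(t /
  r) is of order y, and division by m leaves \<beta>^r.\<close>

lemma pareto_large_part:
  assumes "0 < t" "t < r" "\<beta> \<ge> 0" "m \<ge> 1"
  shows "avg {1..m} (\<lambda>j. if \<beta> * pareto r m j \<le> 1 then 0 else (\<beta> * pareto r m j) powr t)
    \<le> r / (r - t) * \<beta> powr r"
proof (cases "\<beta> = 0")
  case False
  define y where "y = m * \<beta> powr r"
  have y: "y > 0" using False assms by (simp add: y_def)
  define k where "k = nat \<lfloor>y\<rfloor>"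
  have k: "real k \<le> y" using y by (auto simp: k_def)
  define \<tau> where "\<tau> = t / r"
  have g: "\<tau> < 1" "0 < \<tau>" using assms by (auto simp: \<tau>_def)
  have "(\<Sum>j=1..m. if \<beta> * pareto r m j \<le> 1 then 0 else (\<beta> * pareto r m j) powr t)
     = (\<Sum>j=1..m. if j < y then y powr \<tau> * real j powr (- \<tau>) else 0)"
  proof (intro sum.cong refl)
    fix j assume j: "j \<in> {1..m}"
    have "(\<beta> * pareto r m j) powr t = (y / j) powr \<tau>"
      using assms y j by (simp add: pareto_scaled y_def[symmetric] \<tau>_def powr_powr)
    also have "\<dots> = y powr \<tau> * real j powr (- \<tau>)"
      using j y by (simp add: powr_divide powr_minus field_simps)
    finally show "(if \<beta> * pareto r m j \<le> 1 then 0 else (\<beta> * pareto r m j) powr t) =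
        (if j < y then y powr \<tau> * real j powr (- \<tau>) else 0)"
      using assms j by (auto simp: pareto_scaled_le_1_iff y_def)
  qed
  also have "\<dots> = (\<Sum>j\<in>{j\<in>{1..m}. real j < y}. y powr \<tau> * real j powr (- \<tau>))"
    by (subst sum.inter_filter) auto
  also have "\<dots> \<le> (\<Sum>j=1..k. y powr \<tau> * real j powr (- \<tau>))"
  proof (intro sum_mono2)
    show "{j \<in> {1..m}. real j < y} \<subseteq> {1..k}"
      by (auto simp: k_def le_nat_iff le_floor_iff)
  qed auto
  also have "\<dots> \<le> y powr \<tau> * (real k powr (1 - \<tau>) / (1 - \<tau>))"
    unfolding sum_distrib_left[symmetric] using g by (intro mult_left_mono powr_sum_harmonic_le) auto
  also have "\<dots> \<le> y powr \<tau> * (y powr (1 - \<tau>) / (1 - \<tau>))"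
    using g k y by (intro mult_left_mono divide_right_mono powr_mono2) auto
  also have "\<dots> = 1 / (1 - \<tau>) * y" using y by (simp add: powr_diff)
  also have "1 / (1 - \<tau>) = r / (r - t)" using assms by (simp add: \<tau>_def field_simps)
  finally show ?thesis using assms by (simp add: avg_def y_def field_simps)
qed (use assms in \<open>simp add: avg_def\<close>)

text \<open>Only the marginal distributions of the Pareto variables matter here.\<close>

lemma stable_upper:
  fixes \<pi> :: "'i \<Rightarrow> 'w \<Rightarrow> nat"
  assumes r: "0 < t" "t < r" "r < 2" and m: "m \<ge> 1" and fin: "finite \<Omega>" "\<Omega> \<noteq> {}" "finite S"
    and uni: "\<And>k F. k \<in> S \<Longrightarrow> avg \<Omega> (\<lambda>\<omega>. F (\<pi> k \<omega>)) = avg {1..m} F"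
  shows "avg (\<Omega> \<times> Pow S) (\<lambda>\<omega>. \<bar>\<Sum>k\<in>S. a k * (eps k (snd \<omega>) * pareto r m (\<pi> k (fst \<omega>)))\<bar> powr t)
     \<le> (1 + 2 / (2 - r) + r / (r - t)) * lnorm r S a powr t"
proof (rule moment_bound_homogeneous)
    fix a assume "lnorm r S a = 1"
    then have 1: "(\<Sum>k\<in>S. \<bar>a k\<bar> powr r) = 1" using lnorm_powr[of r S a] r by simp
    define v where "v k \<omega> = \<bar>a k\<bar> * pareto r m (\<pi> k \<omega>)" for k \<omega>
    have v: "v k \<omega> \<ge> 0" for k \<omega> by (simp add: v_def)
    \<comment> \<open>For fixed \<omega>, averaging over the signs leaves a square function. Its
      small terms stay squared at the cost of an additive 1; for the large ones, subadditivity of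
      the power t / 2 <= 1 restores the t-th powers.\<close>
    have pt: "avg (Pow S) (\<lambda>A. \<bar>\<Sum>k\<in>S. a k * (eps k A * pareto r m (\<pi> k \<omega>))\<bar> powr t)
       \<le> 1 + (\<Sum>k\<in>S. if v k \<omega> \<le> 1 then (v k \<omega>)\<^sup>2 else 0) + (\<Sum>k\<in>S. if v k \<omega> \<le> 1 then 0 else v k \<omega> powr t)" for \<omega>
    proof -
      have eq: "(\<Sum>k\<in>S. a k * (eps k A * pareto r m (\<pi> k \<omega>))) = (\<Sum>k\<in>S. (a k * pareto r m (\<pi> k \<omega>)) * eps k A)" for A
        by (intro sum.cong) auto
      have "avg (Pow S) (\<lambda>A. \<bar>\<Sum>k\<in>S. a k * (eps k A * pareto r m (\<pi> k \<omega>))\<bar> powr t)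
          \<le> avg (Pow S) (\<lambda>A. \<bar>\<Sum>k\<in>S. (a k * pareto r m (\<pi> k \<omega>)) * eps k A\<bar> powr 2) powr (t / 2)"
        unfolding eq using r fin by (intro avg_powr_le) auto
      also have "avg (Pow S) (\<lambda>A. \<bar>\<Sum>k\<in>S. (a k * pareto r m (\<pi> k \<omega>)) * eps k A\<bar> powr 2) = (\<Sum>k\<in>S. (v k \<omega>)\<^sup>2)"
        using rademacher_moment2[OF fin(3), of "\<lambda>k. a k * pareto r m (\<pi> k \<omega>)"]
        by (simp add: powr_numeral v_def power_mult_distrib)
      also have "\<dots> = (\<Sum>k\<in>S. if v k \<omega> \<le> 1 then (v k \<omega>)\<^sup>2 else 0) + (\<Sum>k\<in>S. if v k \<omega> \<le> 1 then 0 else (v k \<omega>)\<^sup>2)"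
        by (simp add: sum.distrib[symmetric] if_distrib cong: if_cong)
      also have "\<dots> powr (t / 2) \<le> (\<Sum>k\<in>S. if v k \<omega> \<le> 1 then (v k \<omega>)\<^sup>2 else 0) powr (t / 2)
           + (\<Sum>k\<in>S. if v k \<omega> \<le> 1 then 0 else (v k \<omega>)\<^sup>2) powr (t / 2)"
        using r by (intro powr_add_le sum_nonneg) auto
      also have "\<dots> \<le> (1 + (\<Sum>k\<in>S. if v k \<omega> \<le> 1 then (v k \<omega>)\<^sup>2 else 0)) + (\<Sum>k\<in>S. if v k \<omega> \<le> 1 then 0 else v k \<omega> powr t)"
      proof (rule add_mono)
        have "0 \<le> (\<Sum>k\<in>S. if v k \<omega> \<le> 1 then (v k \<omega>)\<^sup>2 else 0)" by (intro sum_nonneg) auto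
        from powr_le_one_plus_powr[OF this, of "t/2" 1] this
        show "(\<Sum>k\<in>S. if v k \<omega> \<le> 1 then (v k \<omega>)\<^sup>2 else 0) powr (t / 2) \<le> 1 + (\<Sum>k\<in>S. if v k \<omega> \<le> 1 then (v k \<omega>)\<^sup>2 else 0)"
          using r by simp
        have "(\<Sum>k\<in>S. if v k \<omega> \<le> 1 then 0 else (v k \<omega>)\<^sup>2) powr (t / 2) \<le> (\<Sum>k\<in>S. (if v k \<omega> \<le> 1 then 0 else (v k \<omega>)\<^sup>2) powr (t / 2))"
          using r fin by (intro powr_sum_le) auto
        also have "\<dots> = (\<Sum>k\<in>S. if v k \<omega> \<le> 1 then 0 else v k \<omega> powr t)"
        proof (intro sum.cong refl)
          fix k
          have "((v k \<omega>)\<^sup>2) powr (t / 2) = v k \<omega> powr t"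
            using v[of k \<omega>] by (simp add: powr_powr flip: powr_numeral)
          then show "(if v k \<omega> \<le> 1 then 0 else (v k \<omega>)\<^sup>2) powr (t / 2) = (if v k \<omega> \<le> 1 then 0 else v k \<omega> powr t)"
            by simp
        qed
        finally show "(\<Sum>k\<in>S. if v k \<omega> \<le> 1 then 0 else (v k \<omega>)\<^sup>2) powr (t / 2) \<le> (\<Sum>k\<in>S. if v k \<omega> \<le> 1 then 0 else v k \<omega> powr t)" .
      qed
      finally show ?thesis .
    qed
    \<comment> \<open>Each truncated moment is a multiple of |a_k|^r. As these add up to 1, the two
      factors appear unchanged in the final constant.\<close>
    have small: "avg \<Omega> (\<lambda>\<omega>. if v k \<omega> \<le> 1 then (v k \<omega>)\<^sup>2 else 0) \<le> 2 / (2 - r) * \<bar>a k\<bar> powr r" if "k \<in> S" for k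
      unfolding v_def uni[OF that, of "\<lambda>j. if \<bar>a k\<bar> * pareto r m j \<le> 1 then (\<bar>a k\<bar> * pareto r m j)\<^sup>2 else 0"]
      by (rule pareto_small_part) (use r m in auto)
    have large: "avg \<Omega> (\<lambda>\<omega>. if v k \<omega> \<le> 1 then 0 else v k \<omega> powr t) \<le> r / (r - t) * \<bar>a k\<bar> powr r" if "k \<in> S" for k
      unfolding v_def uni[OF that, of "\<lambda>j. if \<bar>a k\<bar> * pareto r m j \<le> 1 then 0 else (\<bar>a k\<bar> * pareto r m j) powr t"]
      by (rule pareto_large_part) (use r m in auto)
    have "avg (\<Omega> \<times> Pow S) (\<lambda>\<omega>. \<bar>\<Sum>k\<in>S. a k * (eps k (snd \<omega>) * pareto r m (\<pi> k (fst \<omega>)))\<bar> powr t)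
       \<le> avg \<Omega> (\<lambda>\<omega>. 1 + (\<Sum>k\<in>S. if v k \<omega> \<le> 1 then (v k \<omega>)\<^sup>2 else 0) + (\<Sum>k\<in>S. if v k \<omega> \<le> 1 then 0 else v k \<omega> powr t))"
      unfolding avg_Times fst_conv snd_conv by (intro avg_mono pt)
    also have "\<dots> = 1 + (\<Sum>k\<in>S. avg \<Omega> (\<lambda>\<omega>. if v k \<omega> \<le> 1 then (v k \<omega>)\<^sup>2 else 0)) + (\<Sum>k\<in>S. avg \<Omega> (\<lambda>\<omega>. if v k \<omega> \<le> 1 then 0 else v k \<omega> powr t))"
      using fin by (simp add: avg_add avg_const avg_sum)
    also have "\<dots> \<le> 1 + (\<Sum>k\<in>S. 2 / (2 - r) * \<bar>a k\<bar> powr r) + (\<Sum>k\<in>S. r / (r - t) * \<bar>a k\<bar> powr r)"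
      using small large by (intro add_mono sum_mono order_refl) auto
    also have "\<dots> = 1 + 2 / (2 - r) + r / (r - t)" by (simp only: sum_distrib_left[symmetric] 1 mult_1_right)
    finally show "avg (\<Omega> \<times> Pow S) (\<lambda>\<omega>. \<bar>\<Sum>k\<in>S. a k * (eps k (snd \<omega>) * pareto r m (\<pi> k (fst \<omega>)))\<bar> powr t)
       \<le> 1 + 2 / (2 - r) + r / (r - t)" .
qed (use r fin in auto)


section \<open>Independence on finite products and the lower moment bound\<close>

lemma avg_PiE_prod:
  assumes "finite S" "finite X" "X \<noteq> {}"
  shows "avg (PiE S (\<lambda>_. X)) (\<lambda>\<omega>. \<Prod>k\<in>S. g k (\<omega> k)) = (\<Prod>k\<in>S. avg X (g k))"
proof -
  have "(\<Prod>k\<in>S. avg X (g k)) = (\<Prod>k\<in>S. \<Sum>j\<in>X. g k j) / (\<Prod>k\<in>S. real (card X))"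
    by (simp only: avg_def prod_dividef)
  also have "\<dots> = avg (PiE S (\<lambda>_. X)) (\<lambda>\<omega>. \<Prod>k\<in>S. g k (\<omega> k))"
    using assms by (simp add: avg_def card_PiE prod_sum_PiE)
  finally show ?thesis by simp
qed

lemma avg_PiE_marginal:
  assumes "finite S" "finite X" "X \<noteq> {}" "k \<in> S"
  shows "avg (PiE S (\<lambda>_. X)) (\<lambda>\<omega>. F (\<omega> k)) = avg X F"
proof -
  have "(\<Prod>i\<in>S. if i = k then F (\<omega> i) else 1) = F (\<omega> k)" for \<omega> :: "'a \<Rightarrow> 'b"
    using assms by (subst prod.delta) auto
  moreover have "(\<Prod>i\<in>S. avg X (\<lambda>j. if i = k then F j else 1)) = (\<Prod>i\<in>S. if i = k then avg X F else 1)"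
    using assms by (intro prod.cong) (auto simp: avg_const)
  moreover have "(\<Prod>i\<in>S. if i = k then avg X F else 1) = avg X F"
    using assms by (subst prod.delta) auto
  ultimately show ?thesis
    using avg_PiE_prod[OF assms(1-3), of "\<lambda>i j. if i = k then F j else 1"] by simp
qed

text \<open>The indices j <= m \<beta>^r all qualify, and rounding their number down costs 1 /
  m.\<close>

lemma pareto_tail:
  assumes "r > 0" "m \<ge> 1" "0 \<le> \<beta>" "\<beta> \<le> 1"
  shows "\<beta> powr r - 1 / m \<le> avg {1..m} (\<lambda>j. if \<beta> * pareto r m j \<ge> 1 then 1 else 0)"
proof -
  define y where "y = m * \<beta> powr r"
  have y: "0 \<le> y" "y \<le> m"
    using assms powr_mono2[of r \<beta> 1] by (auto simp: y_def mult_left_le)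
  define k where "k = nat \<lfloor>y\<rfloor>"
  have k: "y - 1 \<le> real k" "real k \<le> y" using y by (auto simp: k_def)
  have "real k = (\<Sum>j\<in>{1..k}. 1)" by simp
  also have "\<dots> \<le> (\<Sum>j\<in>{1..k}. if \<beta> * pareto r m j \<ge> 1 then 1 else 0)"
  proof (rule sum_mono)
    fix j assume j: "j \<in> {1..k}"
    then have "real j \<le> y" using k by (auto intro: order_trans)
    then have "1 \<le> y / j" using j by (simp add: field_simps)
    then have "1 powr (1 / r) \<le> (y / j) powr (1 / r)" using assms by (intro powr_mono2) auto
    then have "\<beta> * pareto r m j \<ge> 1" using assms by (simp add: pareto_scaled y_def)
    then show "1 \<le> (if \<beta> * pareto r m j \<ge> 1 then 1 else (0::real))" by simp
  qed
  also have "\<dots> \<le> (\<Sum>j\<in>{1..m}. if \<beta> * pareto r m j \<ge> 1 then 1 else 0)"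
    using k y by (intro sum_mono2) auto
  finally have "(y - 1) / m \<le> avg {1..m} (\<lambda>j. if \<beta> * pareto r m j \<ge> 1 then 1 else 0)"
    unfolding avg_def using k assms by (auto intro!: divide_right_mono)
  then show ?thesis using assms by (simp add: y_def diff_divide_distrib)
qed

text \<open>One large term suffices. The expected number of terms reaching L is at least 1 - card S
  / m >= 1/2, so by independence none does with probability at most exp (-1/2) <= 2/3. On the
  remaining event the l^2 norm is at least L, and Khinchine gives 5/9 L; hence 5/27 = 1/3 times
  5/9.\<close>

lemma stable_lower:
  fixes S :: "'i set"
  assumes r: "r > 0" and S: "finite S" and m: "m \<ge> 1" "m \<ge> 2 * card S"
  shows "5 / 27 * lnorm r S a
    \<le> avg (PiE S (\<lambda>_. {1..m}) \<times> Pow S) (\<lambda>\<omega>. \<bar>\<Sum>k\<in>S. a k * (eps k (snd \<omega>) * pareto r m (fst \<omega> k))\<bar>)"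
proof (cases "lnorm r S a = 0")
  case False
  define L where "L = lnorm r S a"
  have L: "L > 0" using False by (simp add: L_def less_le)
  define P where "P k j = (if \<bar>a k\<bar> / L * pareto r m j \<ge> 1 then 1 else 0 :: real)" for k j
  define \<Omega> where "\<Omega> = PiE S (\<lambda>_. {1..m})"
  have \<Omega>: "finite \<Omega>" "\<Omega> \<noteq> {}" using S m by (auto simp: \<Omega>_def finite_PiE PiE_eq_empty_iff)
  have "S \<noteq> {}" using False by (auto simp: lnorm_def)
  then have card: "card S > 0" using S by (simp add: card_gt_0_iff)
  have 1: "(\<Sum>k\<in>S. (\<bar>a k\<bar> / L) powr r) = 1"
    using L r by (simp add: powr_divide L_def flip: sum_divide_distrib lnorm_powr)
  have aL: "\<bar>a k\<bar> / L \<le> 1" if "k \<in> S" for k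
    using abs_le_lnorm[OF r S that, of a] L by (simp add: L_def)
  have P01: "P k j = 0 \<or> P k j = 1" for k j by (simp add: P_def)
  have tail: "1 / 2 \<le> (\<Sum>k\<in>S. avg {1..m} (P k))"
  proof -
    have "1 - card S / m = (\<Sum>k\<in>S. (\<bar>a k\<bar> / L) powr r - 1 / m)"
      by (simp only: sum_subtractf 1) simp
    also have "\<dots> \<le> (\<Sum>k\<in>S. avg {1..m} (P k))"
      unfolding P_def using r m L aL by (intro sum_mono pareto_tail) auto
    finally have "1 - card S / m \<le> (\<Sum>k\<in>S. avg {1..m} (P k))" .
    moreover have "real (card S) / m \<le> 1 / 2" using m by (simp add: field_simps)
    ultimately show ?thesis by linarith
  qed
  have "(\<Prod>k\<in>S. 1 - avg {1..m} (P k)) \<le> (\<Prod>k\<in>S. exp (- avg {1..m} (P k)))"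
  proof (rule prod_mono)
    fix k assume "k \<in> S"
    have "avg {1..m} (P k) \<le> avg {1..m} (\<lambda>_. 1)" by (intro avg_mono) (simp add: P_def)
    then show "0 \<le> 1 - avg {1..m} (P k) \<and> 1 - avg {1..m} (P k) \<le> exp (- avg {1..m} (P k))"
      using m exp_ge_add_one_self[of "- avg {1..m} (P k)"] by (simp add: avg_const)
  qed
  also have "\<dots> = exp (- (\<Sum>k\<in>S. avg {1..m} (P k)))" using S by (simp add: exp_sum sum_negf[symmetric])
  also have "\<dots> \<le> exp (- (1 / 2))" using tail by simp
  also have "\<dots> \<le> 2 / 3" using exp_ge_add_one_self[of "1/2::real"] by (simp add: exp_minus field_simps)
  finally have prod: "(\<Prod>k\<in>S. 1 - avg {1..m} (P k)) \<le> 2 / 3" .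
  have pt: "5 / 9 * L * (1 - (\<Prod>k\<in>S. 1 - P k (\<omega> k)))
     \<le> avg (Pow S) (\<lambda>A. \<bar>\<Sum>k\<in>S. a k * (eps k A * pareto r m (\<omega> k))\<bar>)" for \<omega>
  proof (cases "\<exists>k\<in>S. P k (\<omega> k) = 1")
    case False
    then have "(\<Prod>k\<in>S. 1 - P k (\<omega> k)) = 1" using P01 by (intro prod.neutral) force
    then show ?thesis by (simp add: avg_nonneg)
  next
    case True
    then obtain k where k: "k \<in> S" "P k (\<omega> k) = 1" by blast
    then have "(\<Prod>k\<in>S. 1 - P k (\<omega> k)) = 0" using S by (intro prod_zero) auto
    then have "5 / 9 * L * (1 - (\<Prod>k\<in>S. 1 - P k (\<omega> k))) = 5 / 9 * L" by simp
    also have "\<dots> \<le> 5 / 9 * \<bar>a k * pareto r m (\<omega> k)\<bar>"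
      using k L by (simp add: P_def abs_mult field_simps split: if_splits)
    also have "\<dots> \<le> 5 / 9 * lnorm 2 S (\<lambda>k. a k * pareto r m (\<omega> k))"
      using k S by (intro mult_left_mono abs_le_lnorm) auto
    also have "\<dots> \<le> avg (Pow S) (\<lambda>A. \<bar>\<Sum>k\<in>S. a k * pareto r m (\<omega> k) * eps k A\<bar>)"
      by (rule khinchine_lower[OF S])
    also have "\<dots> = avg (Pow S) (\<lambda>A. \<bar>\<Sum>k\<in>S. a k * (eps k A * pareto r m (\<omega> k))\<bar>)"
      by (simp add: mult_ac)
    finally show ?thesis .
  qed
  have "5 / 27 * L \<le> 5 / 9 * L * (1 - (\<Prod>k\<in>S. 1 - avg {1..m} (P k)))"
    using L prod by simp
  also have "(\<Prod>k\<in>S. 1 - avg {1..m} (P k)) = (\<Prod>k\<in>S. avg {1..m} (\<lambda>j. 1 - P k j))"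
    using m by (intro prod.cong) (auto simp: avg_diff avg_const)
  also have "\<dots> = avg \<Omega> (\<lambda>\<omega>. \<Prod>k\<in>S. 1 - P k (\<omega> k))"
    unfolding \<Omega>_def using S m by (subst avg_PiE_prod) auto
  also have "5 / 9 * L * (1 - \<dots>) = avg \<Omega> (\<lambda>\<omega>. 5 / 9 * L * (1 - (\<Prod>k\<in>S. 1 - P k (\<omega> k))))"
    by (simp only: avg_cmult avg_diff avg_const[OF \<Omega>])
  also have "\<dots> \<le> avg \<Omega> (\<lambda>\<omega>. avg (Pow S) (\<lambda>A. \<bar>\<Sum>k\<in>S. a k * (eps k A * pareto r m (\<omega> k))\<bar>))"
    by (intro avg_mono pt)
  finally show ?thesis by (simp add: L_def \<Omega>_def avg_Times)
qed (simp add: avg_nonneg)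

text \<open>Common interface for plain signs (r = 2) and symmetrised Pareto variables (r < 2). The
  constants are fixed before \<open>S\<close>, so later bounds do not depend on the number of
  functions. For r = 2 the first component of the sample space is a single dummy point.\<close>

lemma stable_system_exists:
  assumes r: "1 < r" "r \<le> 2" and t: "0 < t" "t < r \<or> r = 2"
  obtains c C where "c > 0" "C \<ge> 1"
    "\<And>S :: 'i set. finite S \<Longrightarrow> \<exists>(\<Omega> :: (('i \<Rightarrow> nat) \<times> 'i set) set) \<theta>. finite \<Omega> \<and> \<Omega> \<noteq> {} \<and>
      (\<forall>a. c * lnorm r S a \<le> avg \<Omega> (\<lambda>\<omega>. \<bar>\<Sum>k\<in>S. a k * \<theta> k \<omega>\<bar>)) \<and>
      (\<forall>a. avg \<Omega> (\<lambda>\<omega>. \<bar>\<Sum>k\<in>S. a k * \<theta> k \<omega>\<bar> powr t) \<le> C * lnorm r S a powr t)"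
proof (cases "r = 2")
  case True
  obtain C where C: "C \<ge> 1" "\<And>S :: 'i set. \<And>a. finite S \<Longrightarrow>
       avg (Pow S) (\<lambda>A. \<bar>\<Sum>k\<in>S. a k * eps k A\<bar> powr t) \<le> C * lnorm 2 S a powr t"
    using khinchine_upper[OF t(1)] by blast
  show thesis
  proof (rule that)
    show "(5 / 9 :: real) > 0" "C \<ge> 1" using C by auto
    fix S :: "'i set" assume S: "finite S"
    have *: "avg ({\<lambda>_. 0 :: nat} \<times> Pow S) (\<lambda>\<omega>. F (snd \<omega>)) = avg (Pow S) F" for F
      unfolding avg_Times by (simp add: avg_const)
    have 1: "5 / 9 * lnorm r S a \<le> avg ({\<lambda>_. 0 :: nat} \<times> Pow S) (\<lambda>\<omega>. \<bar>\<Sum>k\<in>S. a k * eps k (snd \<omega>)\<bar>)" for a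
      unfolding *[of "\<lambda>A. \<bar>\<Sum>k\<in>S. a k * eps k A\<bar>"] True by (rule khinchine_lower[OF S])
    have 2: "avg ({\<lambda>_. 0 :: nat} \<times> Pow S) (\<lambda>\<omega>. \<bar>\<Sum>k\<in>S. a k * eps k (snd \<omega>)\<bar> powr t) \<le> C * lnorm r S a powr t" for a
      unfolding *[of "\<lambda>A. \<bar>\<Sum>k\<in>S. a k * eps k A\<bar> powr t"] True by (rule C(2)[OF S])
    show "\<exists>(\<Omega> :: (('i \<Rightarrow> nat) \<times> 'i set) set) \<theta>. finite \<Omega> \<and> \<Omega> \<noteq> {} \<and>
      (\<forall>a. 5 / 9 * lnorm r S a \<le> avg \<Omega> (\<lambda>\<omega>. \<bar>\<Sum>k\<in>S. a k * \<theta> k \<omega>\<bar>)) \<and>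
      (\<forall>a. avg \<Omega> (\<lambda>\<omega>. \<bar>\<Sum>k\<in>S. a k * \<theta> k \<omega>\<bar> powr t) \<le> C * lnorm r S a powr t)"
    proof (rule exI[of _ "{\<lambda>_. 0} \<times> Pow S"], rule exI[of _ "\<lambda>k \<omega>. eps k (snd \<omega>)"], intro conjI)
      show "finite ({\<lambda>_. 0 :: nat} \<times> Pow S)" "{\<lambda>_. 0 :: nat} \<times> Pow S \<noteq> {}" using S by auto
    qed (use 1 2 in blast)+
  qed
next
  case False
  then have r2: "r < 2" "t < r" using r t by auto
  show thesis
  proof (rule that)
    show "(5 / 27 :: real) > 0" by simp
    show "1 + 2 / (2 - r) + r / (r - t) \<ge> 1" using r2 r by simp
    fix S :: "'i set" assume S: "finite S"
    \<comment> \<open>Large enough for the lower bound, and positive even if \<open>S\<close> is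
      empty.\<close>
    define m where "m = 2 * card S + 1"
    define \<Omega> :: "('i \<Rightarrow> nat) set" where "\<Omega> = PiE S (\<lambda>_. {1..m})"
    have \<Omega>: "finite \<Omega>" "\<Omega> \<noteq> {}" using S by (auto simp: \<Omega>_def m_def finite_PiE PiE_eq_empty_iff)
    have m: "m \<ge> 1" "m \<ge> 2 * card S" by (simp_all add: m_def)
    have 1: "5 / 27 * lnorm r S a \<le> avg (\<Omega> \<times> Pow S) (\<lambda>\<omega>. \<bar>\<Sum>k\<in>S. a k * (eps k (snd \<omega>) * pareto r m (fst \<omega> k))\<bar>)" for a
      unfolding \<Omega>_def by (rule stable_lower) (use r S m in auto)
    have 2: "avg (\<Omega> \<times> Pow S) (\<lambda>\<omega>. \<bar>\<Sum>k\<in>S. a k * (eps k (snd \<omega>) * pareto r m (fst \<omega> k))\<bar> powr t)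
       \<le> (1 + 2 / (2 - r) + r / (r - t)) * lnorm r S a powr t" for a
    proof (rule stable_upper[where \<pi> = "\<lambda>k \<omega>. \<omega> k"])
      show "avg \<Omega> (\<lambda>\<omega>. F (\<omega> k)) = avg {1..m} F" if "k \<in> S" for k and F :: "nat \<Rightarrow> real"
        unfolding \<Omega>_def using S m that by (intro avg_PiE_marginal) auto
    qed (use t r2 \<Omega> S m in auto)
    show "\<exists>(\<Omega> :: (('i \<Rightarrow> nat) \<times> 'i set) set) \<theta>. finite \<Omega> \<and> \<Omega> \<noteq> {} \<and>
      (\<forall>a. 5 / 27 * lnorm r S a \<le> avg \<Omega> (\<lambda>\<omega>. \<bar>\<Sum>k\<in>S. a k * \<theta> k \<omega>\<bar>)) \<and>
      (\<forall>a. avg \<Omega> (\<lambda>\<omega>. \<bar>\<Sum>k\<in>S. a k * \<theta> k \<omega>\<bar> powr t) \<le> (1 + 2 / (2 - r) + r / (r - t)) * lnorm r S a powr t)"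
    proof (rule exI[of _ "\<Omega> \<times> Pow S"], rule exI[of _ "\<lambda>k \<omega>. eps k (snd \<omega>) * pareto r m (fst \<omega> k)"], intro conjI)
      show "finite (\<Omega> \<times> Pow S)" "\<Omega> \<times> Pow S \<noteq> {}" using \<Omega> S by auto
    qed (use 1 2 in blast)+
  qed
qed

text \<open>Here the Pareto variables are cyclic shifts of one another, so that the sum of their
  \<open>r\<close>-th powers is constant.\<close>

lemma cyclic_system_exists:
  assumes "0 < t" "t < r" "r < 2" "m \<ge> 1"
  shows "\<exists>\<theta> :: nat \<Rightarrow> nat \<times> nat set \<Rightarrow> real.
    (\<forall>a. avg ({..<m} \<times> Pow {..<m}) (\<lambda>\<omega>. \<bar>\<Sum>k<m. a k * \<theta> k \<omega>\<bar> powr t)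
      \<le> (1 + 2 / (2 - r) + r / (r - t)) * lnorm r {..<m} a powr t) \<and>
    (\<forall>\<omega>. (\<Sum>k<m. \<bar>\<theta> k \<omega>\<bar> powr r) = m * harm m) \<and>
    (\<forall>k. avg ({..<m} \<times> Pow {..<m}) (\<lambda>\<omega>. \<bar>\<theta> k \<omega>\<bar> powr r) = harm m)"
proof -
  \<comment> \<open>\<open>Suc\<close> moves the residues to {1..m}. The formula is symmetric in k
    and t, so one bijection yields both the uniform marginals (sum over t) and the constant power
    sums (sum over k).\<close>
  define \<pi> where "\<pi> k t = Suc ((t + k) mod m)" for k t :: nat
  define \<theta> where "\<theta> k \<omega> = eps k (snd \<omega>) * pareto r m (\<pi> k (fst \<omega>))" for k and \<omega> :: "nat \<times> nat set"
  have bij: "bij_betw (\<lambda>t. Suc ((t + k) mod m)) {..<m} {1..m}" for k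
  proof (rule bij_betw_imageI)
    show inj: "inj_on (\<lambda>t. Suc ((t + k) mod m)) {..<m}"
    proof (rule linorder_inj_onI)
      fix x y assume xy: "x < y" "x \<in> {..<m}" "y \<in> {..<m}"
      show "Suc ((x + k) mod m) \<noteq> Suc ((y + k) mod m)"
      proof
        assume "Suc ((x + k) mod m) = Suc ((y + k) mod m)"
        then have "m dvd y - x"
          using mod_eq_dvd_iff_nat[of "x + k" "y + k" m] xy by simp
        then show False using xy by (auto dest: dvd_imp_le)
      qed
    qed auto
    show "(\<lambda>t. Suc ((t + k) mod m)) ` {..<m} = {1..m}"
      using assms(4) by (intro card_subset_eq) (auto simp: card_image[OF inj] Suc_le_eq)
  qed
  have sum: "(\<Sum>t<m. F (\<pi> k t)) = (\<Sum>j=1..m. F j)" for F :: "nat \<Rightarrow> real" and k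
    unfolding \<pi>_def using sum.reindex_bij_betw[OF bij, of F k] by simp
  have sum': "(\<Sum>k<m. F (\<pi> k t)) = (\<Sum>j=1..m. F j)" for F :: "nat \<Rightarrow> real" and t
    unfolding \<pi>_def using sum.reindex_bij_betw[OF bij, of F t] by (simp add: add.commute)
  have abs: "\<bar>\<theta> k \<omega>\<bar> = pareto r m (\<pi> k (fst \<omega>))" for k \<omega>
    by (simp add: \<theta>_def abs_mult)
  have harm: "(\<Sum>j=1..m. pareto r m j powr r) = m * harm m"
    using assms by (simp add: pareto_def powr_powr harm_def sum_distrib_left divide_inverse)
  have 1: "avg ({..<m} \<times> Pow {..<m}) (\<lambda>\<omega>. \<bar>\<Sum>k<m. a k * \<theta> k \<omega>\<bar> powr t)
      \<le> (1 + 2 / (2 - r) + r / (r - t)) * lnorm r {..<m} a powr t" for a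
    unfolding \<theta>_def
  proof (rule stable_upper)
    show "avg {..<m} (\<lambda>\<omega>. F (\<pi> k \<omega>)) = avg {1..m} F" for F k
      by (simp add: avg_def sum)
  qed (use assms in \<open>auto simp: lessThan_empty_iff\<close>)
  have 2: "(\<Sum>k<m. \<bar>\<theta> k \<omega>\<bar> powr r) = m * harm m" for \<omega>
    unfolding abs sum'[of "\<lambda>j. pareto r m j powr r"] by (rule harm)
  have 3: "avg ({..<m} \<times> Pow {..<m}) (\<lambda>\<omega>. \<bar>\<theta> k \<omega>\<bar> powr r) = harm m" for k
  proof -
    have "avg ({..<m} \<times> Pow {..<m}) (\<lambda>\<omega>. \<bar>\<theta> k \<omega>\<bar> powr r) = avg {..<m} (\<lambda>t. pareto r m (\<pi> k t) powr r)"
      unfolding abs avg_Times fst_conv by (subst avg_const) auto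
    also have "\<dots> = harm m"
      unfolding avg_def sum[of "\<lambda>j. pareto r m j powr r"] harm using assms by simp
    finally show ?thesis .
  qed
  show ?thesis by (intro exI[of _ \<theta>] conjI allI 1 2 3)
qed

section \<open>Partitions of nonatomic measure spaces\<close>

text \<open>Of two complementary pieces of positive measure, one carries at most half of the
  total.\<close>

lemma nonatomic_split:
  assumes "nonatomic M" "D \<in> fmeasurable M" "measure M D > 0"
  obtains B where "B \<in> fmeasurable M" "B \<subseteq> D" "measure M B > 0" "measure M B \<le> measure M D / 2"
proof -
  have D: "D \<in> sets M" "emeasure M D < \<infinity>" using assms(2) by (auto simp: fmeasurable_def)
  have "emeasure M D > 0" using assms(3) D by (simp add: measure_def enn2real_positive_iff)
  moreover have "\<not> is_atom M D" using assms(1) by (auto simp: nonatomic_def)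
  ultimately obtain B where B: "B \<in> sets M" "B \<subseteq> D" "emeasure M B \<noteq> 0" "emeasure M (D - B) \<noteq> 0"
    using D by (auto simp: is_atom_def)
  have fm: "E \<in> fmeasurable M" if "E \<in> sets M" "E \<subseteq> D" for E
    using fmeasurableI2[OF assms(2) that(2,1)] .
  have pos: "measure M E > 0" if "E \<in> sets M" "E \<subseteq> D" "emeasure M E \<noteq> 0" for E
    using emeasure_eq_measure2[OF fm[OF that(1,2)]] that(3) by (cases "measure M E = 0") (auto simp: less_le)
  have B2: "B \<in> fmeasurable M" "D - B \<in> fmeasurable M" using B D by (auto intro: fm)
  have "measure M (D - B) = measure M D - measure M B"
    using measurable_measure_Diff[OF assms(2) B(1,2)] .
  then consider "measure M B \<le> measure M D / 2" | "measure M (D - B) \<le> measure M D / 2"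
    by linarith
  then show thesis
  proof cases
    case 1
    then show ?thesis using that[of B] B B2 pos by blast
  next
    case 2
    then show ?thesis using that[of "D - B"] B B2 pos[of "D - B"] D by blast
  qed
qed

lemma nonatomic_small_subset:
  assumes "nonatomic M" "D \<in> fmeasurable M" "measure M D > 0" "e > 0"
  obtains B where "B \<in> fmeasurable M" "B \<subseteq> D" "measure M B > 0" "measure M B < e"
proof -
  have "\<exists>B. B \<in> fmeasurable M \<and> B \<subseteq> D \<and> measure M B > 0 \<and> measure M B \<le> measure M D / 2 ^ n" for n
  proof (induction n)
    case (Suc n)
    then obtain B where B: "B \<in> fmeasurable M" "B \<subseteq> D" "measure M B > 0" "measure M B \<le> measure M D / 2 ^ n"
      by blast
    obtain E where "E \<in> fmeasurable M" "E \<subseteq> B" "measure M E > 0" "measure M E \<le> measure M B / 2"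
      using nonatomic_split[OF assms(1) B(1,3)] .
    then show ?case using B by (intro exI[of _ E]) auto
  qed (use assms in auto)
  note ex = this
  obtain n where n: "measure M D / 2 ^ n < e"
  proof -
    obtain n where "measure M D / e < 2 ^ n" using real_arch_pow[of 2 "measure M D / e"] by auto
    then show thesis using that[of n] assms(4) by (simp add: field_simps)
  qed
  obtain B where "B \<in> fmeasurable M" "B \<subseteq> D" "measure M B > 0" "measure M B \<le> measure M D / 2 ^ n"
    using ex[of n] by blast
  then show thesis using that[of B] n by simp
qed

text \<open>Sierpinski's theorem, by exhaustion: each step adds a set at least half as large as the
  largest admissible one.\<close>

lemma nonatomic_subset_of_measure:
  assumes na: "nonatomic M" and D: "D \<in> fmeasurable M" and t: "0 \<le> t" "t \<le> measure M D"
  obtains A where "A \<in> fmeasurable M" "A \<subseteq> D" "measure M A = t"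
proof -
  define adm where "adm A C \<longleftrightarrow> C \<in> sets M \<and> C \<subseteq> D - A \<and> measure M A + measure M C \<le> t" for A C
  define good where "good A \<longleftrightarrow> A \<in> sets M \<and> A \<subseteq> D \<and> measure M A \<le> t" for A
  have fm: "E \<in> fmeasurable M" if "E \<in> sets M" "E \<subseteq> D" for E
    using fmeasurableI2[OF D that(2,1)] .
  have un: "measure M (A \<union> C) = measure M A + measure M C" if "good A" "adm A C" for A C
  proof -
    have "A \<inter> C = {}" "A \<in> fmeasurable M" "C \<in> fmeasurable M"
      using that by (auto simp: good_def adm_def intro!: fm)
    then show ?thesis by (simp add: measure_Un3)
  qed
  have step: "\<exists>C. adm A C \<and> (\<forall>C'. adm A C' \<longrightarrow> measure M C' \<le> 2 * measure M C)" if "good A" for A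
  proof -
    define s where "s = (SUP C\<in>Collect (adm A). measure M C)"
    have e: "adm A {}" using that by (auto simp: adm_def good_def)
    have bdd: "bdd_above (measure M ` Collect (adm A))"
    proof (rule bdd_aboveI2)
      fix C assume "C \<in> Collect (adm A)"
      then have "measure M A + measure M C \<le> t" by (simp add: adm_def)
      then show "measure M C \<le> t" using measure_nonneg[of M A] by linarith
    qed
    have up: "measure M C \<le> s" if "adm A C" for C
      unfolding s_def using bdd that by (intro cSUP_upper) auto
    show ?thesis
    proof (cases "s > 0")
      case True
      then have "s / 2 < (SUP C\<in>Collect (adm A). measure M C)" by (simp flip: s_def)
      moreover have "Collect (adm A) \<noteq> {}" using e by auto
      ultimately have "\<exists>C\<in>Collect (adm A). s / 2 < measure M C"
        using less_cSUP_iff[OF _ bdd] by blast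
      then obtain C where "adm A C" "s / 2 < measure M C" by blast
      moreover have "measure M C' \<le> 2 * measure M C" if "adm A C'" for C'
        using up[OF that] \<open>s / 2 < measure M C\<close> by linarith
      ultimately show ?thesis by blast
    next
      case False
      have "measure M C' \<le> 2 * measure M {}" if "adm A C'" for C'
        using up[OF that] False by simp
      then show ?thesis using e by blast
    qed
  qed
  obtain A where A: "A 0 = {}" "\<And>n. good (A n)" and
    A': "\<And>n. \<exists>C. adm (A n) C \<and> (\<forall>C'. adm (A n) C' \<longrightarrow> measure M C' \<le> 2 * measure M C) \<and> A (Suc n) = A n \<union> C"
  proof -
    have "\<exists>A. \<forall>n. (good (A n) \<and> (n = 0 \<longrightarrow> A n = {})) \<and>
       (\<exists>C. adm (A n) C \<and> (\<forall>C'. adm (A n) C' \<longrightarrow> measure M C' \<le> 2 * measure M C) \<and> A (Suc n) = A n \<union> C)"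
    proof (rule dependent_nat_choice)
      show "\<exists>x. good x \<and> (0 = (0::nat) \<longrightarrow> x = {})" using t by (auto simp: good_def)
      fix x and n :: nat assume x: "good x \<and> (n = 0 \<longrightarrow> x = {})"
      then obtain C where C: "adm x C" "\<forall>C'. adm x C' \<longrightarrow> measure M C' \<le> 2 * measure M C"
        using step by blast
      have "good (x \<union> C)" using x C un[of x C] by (auto simp: good_def adm_def)
      then show "\<exists>y. (good y \<and> (Suc n = 0 \<longrightarrow> y = {})) \<and>
        (\<exists>C. adm x C \<and> (\<forall>C'. adm x C' \<longrightarrow> measure M C' \<le> 2 * measure M C) \<and> y = x \<union> C)"
        using C by blast
    qed
    then obtain A where "\<forall>n. (good (A n) \<and> (n = 0 \<longrightarrow> A n = {})) \<and>
       (\<exists>C. adm (A n) C \<and> (\<forall>C'. adm (A n) C' \<longrightarrow> measure M C' \<le> 2 * measure M C) \<and> A (Suc n) = A n \<union> C)" ..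
    then show thesis by (intro that[of A]) simp_all
  qed
  define U where "U = (\<Union>n. A n)"
  have inc: "incseq A" using A' by (intro incseq_SucI) blast
  have U: "U \<in> sets M" "U \<subseteq> D" using A(2) by (auto simp: U_def good_def)
  then have Uf: "U \<in> fmeasurable M" by (rule fm)
  have "(\<lambda>n. measure M (A n)) \<longlonglongrightarrow> measure M U"
    unfolding U_def using A(2) inc Uf
    by (intro Lim_measure_incseq) (auto simp: good_def U_def fmeasurable_def)
  then have Ut: "measure M U \<le> t" using A(2) by (intro LIMSEQ_le_const2) (auto simp: good_def)
  have le: "measure M (A n) \<le> measure M U" for n
    using A(2)[of n] Uf by (intro measure_mono_fmeasurable) (auto simp: U_def good_def)
  \<comment> \<open>Otherwise a small set \<open>B\<close> outside \<open>U\<close> is admissible at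
    every stage; each stage then adds at least half of its measure, and the measures of the
    \<open>A n\<close> would be unbounded.\<close>
  have "measure M U = t"
  proof (rule ccontr)
    assume "measure M U \<noteq> t"
    then have lt: "measure M U < t" using Ut by simp
    have "measure M (D - U) = measure M D - measure M U"
      using measurable_measure_Diff[OF D U] .
    then have "measure M (D - U) > 0" using lt t by simp
    moreover have "D - U \<in> fmeasurable M" using D U by (auto intro: fm)
    ultimately obtain B where B: "B \<in> fmeasurable M" "B \<subseteq> D - U" "measure M B > 0" "measure M B < t - measure M U"
      using nonatomic_small_subset[OF na, of "D - U" "t - measure M U"] lt by auto
    have adm: "adm (A n) B" for n
      using B le[of n] by (auto simp: adm_def U_def)
    have "real n * (measure M B / 2) \<le> measure M (A n)" for n
    proof (induction n)
      case (Suc n)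
      obtain C where C: "adm (A n) C" "\<forall>C'. adm (A n) C' \<longrightarrow> measure M C' \<le> 2 * measure M C" "A (Suc n) = A n \<union> C"
        using A' by blast
      have "measure M B \<le> 2 * measure M C" using C adm by blast
      then show ?case using Suc un[OF A(2) C(1)] C(3) by (simp add: algebra_simps)
    qed simp
    then have "real n * (measure M B / 2) \<le> t" for n using le[of n] Ut by (meson order_trans)
    moreover obtain n where "t < real n * (measure M B / 2)"
      using reals_Archimedean3[of "measure M B / 2"] B by auto
    ultimately show False by (meson not_le)
  qed
  then show thesis using that Uf U by blast
qed

text \<open>The partition is given by an index function whose fibres are the cells, so that a step
  function is simply \<open>v (idx x)\<close>. The induction cuts off one cell of the common measure
  at a time.\<close>

lemma nonatomic_partition:
  assumes na: "nonatomic M" and I: "finite I" "I \<noteq> {}" and D: "D \<in> fmeasurable M"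
  shows "\<exists>idx. (\<forall>x\<in>D. idx x \<in> I) \<and>
    (\<forall>i\<in>I. {x\<in>D. idx x = i} \<in> fmeasurable M \<and> measure M {x\<in>D. idx x = i} = measure M D / card I)"
  using I D
proof (induction I arbitrary: D rule: finite_ne_induct)
  case (singleton i)
  then show ?case by (intro exI[of _ "\<lambda>_. i"]) auto
next
  case (insert i I)
  define d where "d = measure M D / card (insert i I)"
  have c: "card (insert i I) = card I + 1" "card I > 0" using insert by (auto simp: card_gt_0_iff)
  have "0 \<le> d" "d \<le> measure M D" by (auto simp: d_def c(1) field_simps mult_left_le)
  then obtain A where A: "A \<in> fmeasurable M" "A \<subseteq> D" "measure M A = d"
    using nonatomic_subset_of_measure[OF na insert.prems] by blast
  have DA: "D - A \<in> fmeasurable M" using insert.prems A by auto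
  have "measure M (D - A) = measure M D - d"
    using measurable_measure_Diff[OF insert.prems, of A] A by auto
  also have "\<dots> = d * card I" using c by (simp add: d_def field_simps)
  finally have mDA: "measure M (D - A) / card I = d" using c by simp
  obtain idx where idx: "\<forall>x\<in>D - A. idx x \<in> I"
    "\<forall>j\<in>I. {x\<in>D - A. idx x = j} \<in> fmeasurable M \<and> measure M {x\<in>D - A. idx x = j} = d"
    using insert.IH[OF DA] unfolding mDA by blast
  define idx' where "idx' x = (if x \<in> A then i else idx x)" for x
  have "{x\<in>D. idx' x = i} = A" using insert A idx by (auto simp: idx'_def)
  moreover have "{x\<in>D. idx' x = j} = {x\<in>D - A. idx x = j}" if "j \<in> I" for j
    using insert A that by (auto simp: idx'_def)
  moreover have "\<forall>x\<in>D. idx' x \<in> insert i I" using idx by (auto simp: idx'_def)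
  ultimately show ?case
    using A idx unfolding d_def[symmetric] by (intro exI[of _ idx']) auto
qed

section \<open>Variable Lebesgue spaces\<close>

lemma exponents_measurable[measurable_dest]: "p \<in> exponents M \<Longrightarrow> p \<in> borel_measurable M"
  by (simp add: exponents_def)

lemma exponents_ge_1: "p \<in> exponents M \<Longrightarrow> x \<in> space M \<Longrightarrow> 1 \<le> p x"
  by (simp add: exponents_def)

lemma inf_set_sets:
  assumes "p \<in> exponents M" shows "inf_set M p \<in> sets M"
proof -
  have [measurable]: "p \<in> borel_measurable M" using assms by (simp add: exponents_def)
  show ?thesis unfolding inf_set_def by measurable
qed

lemma Lvar_measurable[measurable_dest]: "f \<in> Lvar M p \<Longrightarrow> f \<in> borel_measurable M"
  by (simp add: Lvar_def)

lemma modular_mono: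
  assumes p: "p \<in> exponents M"
    and f: "f \<in> borel_measurable M" and le: "AE x in M. \<bar>f x\<bar> \<le> \<bar>g x\<bar>"
  shows "modular M p f \<le> modular M p g"
  unfolding modular_def
proof (rule add_mono)
  show "(\<integral>\<^sup>+ x \<in> space M - inf_set M p. ennreal (\<bar>f x\<bar> powr enn2real (p x)) \<partial>M)
      \<le> (\<integral>\<^sup>+ x \<in> space M - inf_set M p. ennreal (\<bar>g x\<bar> powr enn2real (p x)) \<partial>M)"
    using le by (intro nn_integral_mono_AE) (auto elim!: eventually_mono split: split_indicator
      intro!: powr_mono2 ennreal_leI)
  show "esssup (restrict_space M (inf_set M p)) (\<lambda>x. ennreal \<bar>f x\<bar>) \<le> esssup (restrict_space M (inf_set M p)) (\<lambda>x. ennreal \<bar>g x\<bar>)"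
  proof (rule esssup_AE_mono)
    show "(\<lambda>x. ennreal \<bar>f x\<bar>) \<in> borel_measurable (restrict_space M (inf_set M p))"
      using f by (intro measurable_restrict_space1) simp
    have "inf_set M p \<inter> space M \<in> sets M" using inf_set_sets[OF p] by auto
    then show "AE x in restrict_space M (inf_set M p). ennreal \<bar>f x\<bar> \<le> ennreal \<bar>g x\<bar>"
      using le by (subst AE_restrict_space_iff) (auto elim!: eventually_mono intro: ennreal_leI)
  qed
qed

lemma modular_zero: 
  assumes p: "p \<in> exponents M" shows "modular M p (\<lambda>x. 0) = 0"
proof -
  have "(\<integral>\<^sup>+ x \<in> space M - inf_set M p. ennreal (\<bar>0\<bar> powr enn2real (p x)) \<partial>M) = 0"
    by simp
  moreover have "esssup (restrict_space M (inf_set M p)) (\<lambda>x. ennreal \<bar>0\<bar>) \<le> 0"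
    by (intro esssup_I) auto
  ultimately show ?thesis by (simp add: modular_def)
qed

text \<open>Convexity takes the place of the homogeneity that the modular lacks; scaling and the
  triangle inequality are derived from it. Off \<open>inf_set\<close> the exponent is at least 1,
  which makes the powers convex.\<close>

lemma modular_convex:
  assumes p: "p \<in> exponents M" and t: "0 \<le> t" "t \<le> 1"
    and f: "f \<in> borel_measurable M" and g: "g \<in> borel_measurable M"
  shows "modular M p (\<lambda>x. t * f x + (1 - t) * g x) \<le> ennreal t * modular M p f + ennreal (1 - t) * modular M p g"
proof -
  have [measurable]: "p \<in> borel_measurable M" "f \<in> borel_measurable M" "g \<in> borel_measurable M"
    "inf_set M p \<in> sets M"
    using p f g inf_set_sets[OF p] by (auto simp: exponents_def)
  have 1: "(\<integral>\<^sup>+ x \<in> space M - inf_set M p. ennreal (\<bar>t * f x + (1 - t) * g x\<bar> powr enn2real (p x)) \<partial>M)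
    \<le> ennreal t * (\<integral>\<^sup>+ x \<in> space M - inf_set M p. ennreal (\<bar>f x\<bar> powr enn2real (p x)) \<partial>M)
      + ennreal (1 - t) * (\<integral>\<^sup>+ x \<in> space M - inf_set M p. ennreal (\<bar>g x\<bar> powr enn2real (p x)) \<partial>M)"
  proof -
    have "(\<integral>\<^sup>+ x \<in> space M - inf_set M p. ennreal (\<bar>t * f x + (1 - t) * g x\<bar> powr enn2real (p x)) \<partial>M)
       \<le> (\<integral>\<^sup>+ x. ennreal t * (ennreal (\<bar>f x\<bar> powr enn2real (p x)) * indicator (space M - inf_set M p) x)
           + ennreal (1 - t) * (ennreal (\<bar>g x\<bar> powr enn2real (p x)) * indicator (space M - inf_set M p) x) \<partial>M)"
    proof (rule nn_integral_mono)
      fix x assume x: "x \<in> space M"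
      show "ennreal (\<bar>t * f x + (1 - t) * g x\<bar> powr enn2real (p x)) * indicator (space M - inf_set M p) x \<le>
        ennreal t * (ennreal (\<bar>f x\<bar> powr enn2real (p x)) * indicator (space M - inf_set M p) x) +
        ennreal (1 - t) * (ennreal (\<bar>g x\<bar> powr enn2real (p x)) * indicator (space M - inf_set M p) x)"
      proof (cases "x \<in> inf_set M p")
        case False
        then have "p x \<noteq> \<infinity>" using x by (auto simp: inf_set_def)
        then have P: "enn2real (p x) \<ge> 1"
          using exponents_ge_1[OF p x] by (cases "p x") (auto simp: ennreal_1[symmetric] simp del: ennreal_1)
        have "\<bar>t * f x + (1 - t) * g x\<bar> powr enn2real (p x) \<le> ((1 - (1 - t)) * \<bar>f x\<bar> + (1 - t) * \<bar>g x\<bar>) powr enn2real (p x)"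
          using t by (intro powr_mono2 order_trans[OF abs_triangle_ineq]) (auto simp: abs_mult)
        also have "\<dots> \<le> t * \<bar>f x\<bar> powr enn2real (p x) + (1 - t) * \<bar>g x\<bar> powr enn2real (p x)"
          using convex_onD[OF convex_on_powr_nonneg[OF P], of "1 - t" "\<bar>f x\<bar>" "\<bar>g x\<bar>"] t by simp
        finally have "ennreal (\<bar>t * f x + (1 - t) * g x\<bar> powr enn2real (p x))
           \<le> ennreal (t * \<bar>f x\<bar> powr enn2real (p x) + (1 - t) * \<bar>g x\<bar> powr enn2real (p x))"
          by (rule ennreal_leI)
        then show ?thesis using False x t by (simp add: ennreal_mult'' ennreal_plus)
      qed simp
    qed
    also have "\<dots> = ennreal t * (\<integral>\<^sup>+ x \<in> space M - inf_set M p. ennreal (\<bar>f x\<bar> powr enn2real (p x)) \<partial>M)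
      + ennreal (1 - t) * (\<integral>\<^sup>+ x \<in> space M - inf_set M p. ennreal (\<bar>g x\<bar> powr enn2real (p x)) \<partial>M)"
      by (subst nn_integral_add) (auto simp: nn_integral_cmult)
    finally show ?thesis .
  qed
  define N where "N = restrict_space M (inf_set M p)"
  have [measurable]: "f \<in> borel_measurable N" "g \<in> borel_measurable N"
    unfolding N_def by (auto intro: measurable_restrict_space1)
  have 2: "esssup N (\<lambda>x. ennreal \<bar>t * f x + (1 - t) * g x\<bar>)
     \<le> ennreal t * esssup N (\<lambda>x. ennreal \<bar>f x\<bar>) + ennreal (1 - t) * esssup N (\<lambda>x. ennreal \<bar>g x\<bar>)"
  proof (rule esssup_I)
    show "AE x in N. ennreal \<bar>t * f x + (1 - t) * g x\<bar>
       \<le> ennreal t * esssup N (\<lambda>x. ennreal \<bar>f x\<bar>) + ennreal (1 - t) * esssup N (\<lambda>x. ennreal \<bar>g x\<bar>)"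
      using esssup_AE[of "\<lambda>x. ennreal \<bar>f x\<bar>" N] esssup_AE[of "\<lambda>x. ennreal \<bar>g x\<bar>" N]
    proof eventually_elim
      case (elim x)
      have "ennreal \<bar>t * f x + (1 - t) * g x\<bar> \<le> ennreal (t * \<bar>f x\<bar> + (1 - t) * \<bar>g x\<bar>)"
        using t by (intro ennreal_leI order_trans[OF abs_triangle_ineq]) (auto simp: abs_mult)
      also have "\<dots> = ennreal t * ennreal \<bar>f x\<bar> + ennreal (1 - t) * ennreal \<bar>g x\<bar>"
        using t by (simp add: ennreal_mult'' ennreal_plus)
      also have "\<dots> \<le> ennreal t * esssup N (\<lambda>x. ennreal \<bar>f x\<bar>) + ennreal (1 - t) * esssup N (\<lambda>x. ennreal \<bar>g x\<bar>)"
        using elim by (intro add_mono mult_left_mono) auto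
      finally show ?case .
    qed
  qed measurable
  show ?thesis
    unfolding modular_def N_def[symmetric] using add_mono[OF 1 2] by (simp add: algebra_simps distrib_left)
qed

lemma modular_scale_le:
  assumes p: "p \<in> exponents M" and f: "f \<in> borel_measurable M" and K: "K \<ge> 1"
  shows "modular M p (\<lambda>x. f x / K) \<le> ennreal (1 / K) * modular M p f"
  using modular_convex[OF p, of "1 / K" f "\<lambda>_. 0"] f K by (simp add: modular_zero[OF p])

lemma Lvar_norm_le:
  assumes "c > 0" "modular M p (\<lambda>x. f x / c) \<le> 1"
  shows "Lvar_norm M p f \<le> c"
  unfolding Lvar_norm_def using assms by (intro cInf_lower bdd_belowI[of _ 0]) auto

lemma Lvar_I:
  assumes "f \<in> borel_measurable M" "c > 0" "modular M p (\<lambda>x. f x / c) \<le> 1"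
  shows "f \<in> Lvar M p"
  unfolding Lvar_def using assms by (auto intro!: exI[of _ c] intro: le_less_trans)

text \<open>Makes the real infimum in the norm meaningful. Membership in \<open>Lvar\<close> only
  provides a finite modular; dividing once more by K = 1 + modular brings it below 1 by
  convexity.\<close>

lemma Lvar_norm_set_nonempty:
  assumes p: "p \<in> exponents M" and f: "f \<in> Lvar M p"
  obtains c where "c > 0" "modular M p (\<lambda>x. f x / c) \<le> 1"
proof -
  obtain c where c: "c > 0" "modular M p (\<lambda>x. f x / c) < \<infinity>" using f by (auto simp: Lvar_def)
  define K where "K = 1 + enn2real (modular M p (\<lambda>x. f x / c))"
  have K: "K \<ge> 1" by (simp add: K_def)
  have "modular M p (\<lambda>x. f x / c / K) \<le> ennreal (1 / K) * modular M p (\<lambda>x. f x / c)"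
    using f K by (intro modular_scale_le[OF p]) (auto simp: Lvar_def)
  also have "\<dots> = ennreal (1 / K) * ennreal (enn2real (modular M p (\<lambda>x. f x / c)))"
    using c by simp
  also have "\<dots> = ennreal (enn2real (modular M p (\<lambda>x. f x / c)) / K)"
    using K by (subst ennreal_mult[symmetric]) auto
  also have "\<dots> \<le> 1"
  proof -
    have "enn2real (modular M p (\<lambda>x. f x / c)) / K \<le> 1"
      using K by (simp add: divide_le_eq) (simp add: K_def)
    then show ?thesis by simp
  qed
  finally show thesis using that[of "c * K"] c K by (simp add: field_simps)
qed

lemma Lvar_norm_nonneg:
  assumes "p \<in> exponents M" "f \<in> Lvar M p" shows "0 \<le> Lvar_norm M p f"
  unfolding Lvar_norm_def
  by (rule cInf_greatest) (use Lvar_norm_set_nonempty[OF assms] in auto)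

text \<open>With a strict inequality it need not be known whether the infimum is attained; later
  estimates therefore run over all c above the norm.\<close>

lemma modular_le_1:
  assumes p: "p \<in> exponents M" and f: "f \<in> Lvar M p" and c: "Lvar_norm M p f < c"
  shows "modular M p (\<lambda>x. f x / c) \<le> 1"
proof -
  have "{c. c > 0 \<and> modular M p (\<lambda>x. f x / c) \<le> 1} \<noteq> {}"
    using Lvar_norm_set_nonempty[OF p f] by auto
  from cInf_lessD[OF this c[unfolded Lvar_norm_def]]
  obtain d where d: "d > 0" "modular M p (\<lambda>x. f x / d) \<le> 1" "d < c" by auto
  have "modular M p (\<lambda>x. f x / c) \<le> modular M p (\<lambda>x. f x / d)"
    using d f by (intro modular_mono[OF p] AE_I2) (auto simp: abs_divide Lvar_def intro!: divide_left_mono)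
  with d show ?thesis by simp
qed

lemma Lvar_norm_leI:
  assumes "\<And>c. c > b \<Longrightarrow> c > 0 \<Longrightarrow> modular M p (\<lambda>x. f x / c) \<le> 1" "b \<ge> 0"
  shows "Lvar_norm M p f \<le> b"
proof (rule dense_ge)
  fix c assume "b < c"
  then show "Lvar_norm M p f \<le> c" using assms by (intro Lvar_norm_le) auto
qed

lemma Lvar_mono:
  assumes p: "p \<in> exponents M" and g: "g \<in> Lvar M p"
    and f: "f \<in> borel_measurable M" and le: "AE x in M. \<bar>f x\<bar> \<le> \<bar>g x\<bar>"
  shows "f \<in> Lvar M p" and "Lvar_norm M p f \<le> Lvar_norm M p g"
proof -
  have *: "modular M p (\<lambda>x. f x / c) \<le> 1" if "c > Lvar_norm M p g" "c > 0" for c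
  proof -
    have "modular M p (\<lambda>x. f x / c) \<le> modular M p (\<lambda>x. g x / c)"
      using le that f by (intro modular_mono[OF p]) (auto elim!: eventually_mono simp: abs_divide divide_right_mono)
    also have "\<dots> \<le> 1" using modular_le_1[OF p g] that by blast
    finally show ?thesis .
  qed
  show "Lvar_norm M p f \<le> Lvar_norm M p g"
    by (intro Lvar_norm_leI * Lvar_norm_nonneg[OF p g])
  show "f \<in> Lvar M p"
    using *[of "Lvar_norm M p g + 1"] Lvar_norm_nonneg[OF p g] f by (intro Lvar_I) auto
qed

lemma Lvar_add:
  assumes p: "p \<in> exponents M" and f: "f \<in> Lvar M p" and g: "g \<in> Lvar M p"
  shows "(\<lambda>x. f x + g x) \<in> Lvar M p"
    and "Lvar_norm M p (\<lambda>x. f x + g x) \<le> Lvar_norm M p f + Lvar_norm M p g"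
proof -
  have *: "modular M p (\<lambda>x. (f x + g x) / c) \<le> 1" if "c > Lvar_norm M p f + Lvar_norm M p g" for c
  proof -
    \<comment> \<open>The excess of c is shared equally, so that (f + g) / c is a convex combination
      of f / a and g / b, whose modulars are at most 1.\<close>
    define e where "e = (c - Lvar_norm M p f - Lvar_norm M p g) / 2"
    define a b where "a = Lvar_norm M p f + e" and "b = Lvar_norm M p g + e"
    have e: "e > 0" using that by (simp add: e_def)
    have ab: "a > 0" "b > 0" "c = a + b"
      using e Lvar_norm_nonneg[OF p f] Lvar_norm_nonneg[OF p g] by (auto simp: a_def b_def e_def field_simps)
    have eq: "(f x + g x) / c = a / c * (f x / a) + (1 - a / c) * (g x / b)" for x
    proof -
      have "1 - a / c = b / c" using ab by (simp add: field_simps)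
      then show ?thesis using ab by (simp add: add_divide_distrib)
    qed
    have "modular M p (\<lambda>x. (f x + g x) / c) \<le> ennreal (a / c) * modular M p (\<lambda>x. f x / a) + ennreal (1 - a / c) * modular M p (\<lambda>x. g x / b)"
      unfolding eq using ab f g by (intro modular_convex[OF p]) (auto simp: Lvar_def)
    also have "\<dots> \<le> ennreal (a / c) * 1 + ennreal (1 - a / c) * 1"
      using e by (intro add_mono mult_left_mono modular_le_1[OF p f] modular_le_1[OF p g]) (auto simp: a_def b_def)
    also have "\<dots> = ennreal (a / c + (1 - a / c))" using ab by (subst ennreal_plus) auto
    also have "\<dots> = 1" by simp
    finally show ?thesis .
  qed
  have nn: "0 \<le> Lvar_norm M p f + Lvar_norm M p g"
    using Lvar_norm_nonneg[OF p f] Lvar_norm_nonneg[OF p g] by simp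
  show "Lvar_norm M p (\<lambda>x. f x + g x) \<le> Lvar_norm M p f + Lvar_norm M p g"
    by (intro Lvar_norm_leI * nn)
  show "(\<lambda>x. f x + g x) \<in> Lvar M p"
    using *[of "Lvar_norm M p f + Lvar_norm M p g + 1"] nn f g by (intro Lvar_I) (auto simp: Lvar_def)
qed

lemma Lvar_zero:
  assumes p: "p \<in> exponents M"
  shows "(\<lambda>x. 0) \<in> Lvar M p" and "Lvar_norm M p (\<lambda>x. 0) = 0"
proof -
  show 1: "(\<lambda>x. 0) \<in> Lvar M p" by (rule Lvar_I[of _ _ 1]) (auto simp: modular_zero[OF p])
  have "Lvar_norm M p (\<lambda>x. 0) \<le> 0" by (rule Lvar_norm_leI) (auto simp: modular_zero[OF p])
  then show "Lvar_norm M p (\<lambda>x. 0) = 0" using Lvar_norm_nonneg[OF p 1] by simp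
qed

lemma Lvar_cmult:
  assumes p: "p \<in> exponents M" and f: "f \<in> Lvar M p"
  shows "(\<lambda>x. a * f x) \<in> Lvar M p" and "Lvar_norm M p (\<lambda>x. a * f x) \<le> \<bar>a\<bar> * Lvar_norm M p f"
proof -
  have "(\<lambda>x. a * f x) \<in> Lvar M p \<and> Lvar_norm M p (\<lambda>x. a * f x) \<le> \<bar>a\<bar> * Lvar_norm M p f"
  proof (cases "a = 0")
    case True
    then show ?thesis using Lvar_zero[OF p] by simp
  next
    case False
    have *: "modular M p (\<lambda>x. a * f x / c) \<le> 1" if "c > \<bar>a\<bar> * Lvar_norm M p f" "c > 0" for c
    proof -
      have "modular M p (\<lambda>x. a * f x / c) \<le> modular M p (\<lambda>x. f x / (c / \<bar>a\<bar>))"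
        using False f by (intro modular_mono[OF p]) (auto simp: abs_mult abs_divide Lvar_def field_simps)
      also have "\<dots> \<le> 1"
        using that False by (intro modular_le_1[OF p f]) (simp add: field_simps)
      finally show ?thesis .
    qed
    have nn: "0 \<le> \<bar>a\<bar> * Lvar_norm M p f" using Lvar_norm_nonneg[OF p f] by simp
    show ?thesis
    proof
      show "(\<lambda>x. a * f x) \<in> Lvar M p"
        using *[of "\<bar>a\<bar> * Lvar_norm M p f + 1"] nn Lvar_measurable[OF f]
        by (intro Lvar_I[of _ _ "\<bar>a\<bar> * Lvar_norm M p f + 1"]) auto
    qed (intro Lvar_norm_leI * nn)
  qed
  then show "(\<lambda>x. a * f x) \<in> Lvar M p" and "Lvar_norm M p (\<lambda>x. a * f x) \<le> \<bar>a\<bar> * Lvar_norm M p f"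
    by auto
qed

lemma Lvar_sum:
  assumes p: "p \<in> exponents M" and "finite S" "\<And>k. k \<in> S \<Longrightarrow> f k \<in> Lvar M p"
  shows "(\<lambda>x. \<Sum>k\<in>S. f k x) \<in> Lvar M p" and "Lvar_norm M p (\<lambda>x. \<Sum>k\<in>S. f k x) \<le> (\<Sum>k\<in>S. Lvar_norm M p (f k))"
proof -
  have "(\<lambda>x. \<Sum>k\<in>S. f k x) \<in> Lvar M p \<and> Lvar_norm M p (\<lambda>x. \<Sum>k\<in>S. f k x) \<le> (\<Sum>k\<in>S. Lvar_norm M p (f k))"
    using assms(2,3)
  proof (induction S rule: finite_induct)
    case empty
    then show ?case using Lvar_zero[OF p] by simp
  next
    case (insert k S)
    then show ?case using Lvar_add[OF p, of "f k" "\<lambda>x. \<Sum>k\<in>S. f k x"] by fastforce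
  qed
  then show "(\<lambda>x. \<Sum>k\<in>S. f k x) \<in> Lvar M p" and "Lvar_norm M p (\<lambda>x. \<Sum>k\<in>S. f k x) \<le> (\<Sum>k\<in>S. Lvar_norm M p (f k))"
    by auto
qed

lemma Lvar_abs:
  assumes p: "p \<in> exponents M" and f: "f \<in> Lvar M p"
  shows "(\<lambda>x. \<bar>f x\<bar>) \<in> Lvar M p" and "Lvar_norm M p (\<lambda>x. \<bar>f x\<bar>) \<le> Lvar_norm M p f"
  by (rule Lvar_mono[OF p f]; use f in \<open>auto simp: Lvar_def\<close>)+

lemma modular_eq_nn_integral:
  assumes p: "p \<in> exponents M" and fin: "AE x in M. p x < \<infinity>" and f: "f \<in> borel_measurable M"
  shows "modular M p f = (\<integral>\<^sup>+ x. ennreal (\<bar>f x\<bar> powr enn2real (p x)) \<partial>M)"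
proof -
  have "esssup (restrict_space M (inf_set M p)) (\<lambda>x. ennreal \<bar>f x\<bar>) \<le> 0"
  proof (rule esssup_I)
    show "(\<lambda>x. ennreal \<bar>f x\<bar>) \<in> borel_measurable (restrict_space M (inf_set M p))"
      using f by (intro measurable_restrict_space1) simp
    have "inf_set M p \<inter> space M \<in> sets M" using inf_set_sets[OF p] by auto
    then show "AE x in restrict_space M (inf_set M p). ennreal \<bar>f x\<bar> \<le> 0"
      using fin by (subst AE_restrict_space_iff) (auto elim!: eventually_mono simp: inf_set_def)
  qed
  moreover have "(\<integral>\<^sup>+ x \<in> space M - inf_set M p. ennreal (\<bar>f x\<bar> powr enn2real (p x)) \<partial>M)
     = (\<integral>\<^sup>+ x. ennreal (\<bar>f x\<bar> powr enn2real (p x)) \<partial>M)"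
  proof (rule nn_integral_cong_AE)
    show "AE x in M. ennreal (\<bar>f x\<bar> powr enn2real (p x)) * indicator (space M - inf_set M p) x
        = ennreal (\<bar>f x\<bar> powr enn2real (p x))"
      using fin AE_space by eventually_elim (auto simp: inf_set_def)
  qed
  ultimately show ?thesis by (simp add: modular_def)
qed

section \<open>Operators between variable Lebesgue spaces\<close>

lemma bounded_operator_norm:
  assumes q: "q \<in> exponents M" and T: "bounded_operator M q N p T"
  shows "0 \<le> operator_norm M q N p T"
    and "f \<in> Lvar M q \<Longrightarrow> Lvar_norm N p (T f) \<le> operator_norm M q N p T * Lvar_norm M q f"
proof -
  define X where "X = {C. C \<ge> 0 \<and> (\<forall>f\<in>Lvar M q. Lvar_norm N p (T f) \<le> C * Lvar_norm M q f)}"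
  obtain C where C: "\<forall>f\<in>Lvar M q. Lvar_norm N p (T f) \<le> C * Lvar_norm M q f"
    using T by (auto simp: bounded_operator_def)
  \<comment> \<open>The constant in \<open>bounded_operator\<close> may be negative, while
    \<open>operator_norm\<close> admits only nonnegative ones.\<close>
  have "max C 0 \<in> X"
    using C Lvar_norm_nonneg[OF q] mult_right_mono[of C "max C 0"] by (fastforce simp: X_def)
  then have ne: "X \<noteq> {}" by auto
  have eq: "operator_norm M q N p T = Inf X" by (simp add: operator_norm_def X_def)
  show "0 \<le> operator_norm M q N p T"
    unfolding eq by (rule cInf_greatest[OF ne]) (simp add: X_def)
  assume f: "f \<in> Lvar M q"
  show "Lvar_norm N p (T f) \<le> operator_norm M q N p T * Lvar_norm M q f"
  proof (cases "Lvar_norm M q f = 0")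
    case True
    then show ?thesis using C f by auto
  next
    case False
    then have pos: "Lvar_norm M q f > 0" using Lvar_norm_nonneg[OF q f] by simp
    have "Lvar_norm N p (T f) / Lvar_norm M q f \<le> Inf X"
      using pos f by (intro cInf_greatest[OF ne]) (auto simp: X_def field_simps)
    then show ?thesis using pos by (simp add: eq field_simps)
  qed
qed

lemma operator_norm_le:
  assumes "K \<ge> 0" "\<And>f. f \<in> Lvar M q \<Longrightarrow> Lvar_norm N p (T f) \<le> K * Lvar_norm M q f"
  shows "operator_norm M q N p T \<le> K"
  unfolding operator_norm_def using assms by (intro cInf_lower bdd_belowI[of _ 0]) auto

lemma bounded_operator_cmult:
  "bounded_operator M q N p T \<Longrightarrow> f \<in> Lvar M q \<Longrightarrow> AE x in N. T (\<lambda>y. c * f y) x = c * T f x"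
  by (simp add: bounded_operator_def)

lemma bounded_operator_add:
  "bounded_operator M q N p T \<Longrightarrow> f \<in> Lvar M q \<Longrightarrow> g \<in> Lvar M q \<Longrightarrow>
    AE x in N. T (\<lambda>y. f y + g y) x = T f x + T g x"
  by (simp add: bounded_operator_def)

lemma bounded_operator_sum:
  assumes q: "q \<in> exponents M" and T: "bounded_operator M q N p T"
    and S: "finite S" "\<And>k. k \<in> S \<Longrightarrow> f k \<in> Lvar M q"
  shows "AE x in N. T (\<lambda>y. \<Sum>k\<in>S. a k * f k y) x = (\<Sum>k\<in>S. a k * T (f k) x)"
  using S
proof (induction S rule: finite_induct)
  case empty
  show ?case using bounded_operator_cmult[OF T Lvar_zero(1)[OF q], of 0] by simp
next
  case (insert k S)
  have 1: "(\<lambda>y. \<Sum>k\<in>S. a k * f k y) \<in> Lvar M q" "(\<lambda>y. a k * f k y) \<in> Lvar M q"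
    using insert by (auto intro!: Lvar_sum(1)[OF q] Lvar_cmult(1)[OF q])
  have 2: "AE x in N. T (\<lambda>y. a k * f k y + (\<Sum>k\<in>S. a k * f k y)) x = T (\<lambda>y. a k * f k y) x + T (\<lambda>y. \<Sum>k\<in>S. a k * f k y) x"
    by (rule bounded_operator_add[OF T 1(2,1)])
  have 3: "AE x in N. T (\<lambda>y. a k * f k y) x = a k * T (f k) x"
    by (rule bounded_operator_cmult[OF T]) (use insert in auto)
  have 4: "AE x in N. T (\<lambda>y. \<Sum>k\<in>S. a k * f k y) x = (\<Sum>k\<in>S. a k * T (f k) x)"
    using insert by auto
  show ?case using 2 3 4 by eventually_elim (use insert in simp)
qed

lemma bounded_operator_Lvar: "bounded_operator M q N p T \<Longrightarrow> f \<in> Lvar M q \<Longrightarrow> T f \<in> Lvar N p"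
  by (simp add: bounded_operator_def)

section \<open>Upper bounds\<close>

text \<open>The supremum is reached along a countable sequence, and countably many almost everywhere
  bounds hold simultaneously.\<close>

lemma essinf_AE: "AE x in M. essinf M f \<le> f x"
proof -
  have "{z. AE x in M. z \<le> f x} \<noteq> {}" by (auto intro!: exI[of _ 0])
  from ennreal_Sup_countable_SUP[OF this] obtain z :: "nat \<Rightarrow> ennreal" where
    z: "range z \<subseteq> {z. AE x in M. z \<le> f x}" "essinf M f = (SUP i. z i)"
    by (auto simp: essinf_def)
  have "AE x in M. \<forall>i. z i \<le> f x"
    unfolding AE_all_countable using z(1) by auto
  then show ?thesis unfolding z(2) by eventually_elim (auto intro: SUP_least)
qed

lemma bounded_exponentsE:
  assumes "p \<in> bounded_exponents M"
  obtains P1 P2 where "p \<in> exponents M" "essinf M p = ennreal P1" "esssup M p = ennreal P2" "1 < P1" "P1 \<le> P2"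
    "AE x in M. ennreal P1 \<le> p x \<and> p x \<le> ennreal P2"
proof -
  have p: "p \<in> exponents M" "1 < essinf M p" "essinf M p \<le> esssup M p" "esssup M p < \<infinity>"
    using assms by (auto simp: bounded_exponents_def)
  define P1 P2 where "P1 = enn2real (essinf M p)" and "P2 = enn2real (esssup M p)"
  have "essinf M p < \<infinity>" using p(3,4) by order
  then have eq: "essinf M p = ennreal P1" "esssup M p = ennreal P2"
    using p(4) by (simp_all add: P1_def P2_def)
  have "1 < P1" using p(2) by (simp add: eq ennreal_1[symmetric] ennreal_less_iff del: ennreal_1)
  moreover have "P1 \<le> P2" using p(3) unfolding eq by (simp add: P2_def)
  moreover have "AE x in M. ennreal P1 \<le> p x \<and> p x \<le> ennreal P2"
    using essinf_AE[of M p] esssup_AE[of p M] unfolding eq by eventually_elim simp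
  ultimately show thesis using that p eq by blast
qed

lemma enn2real_bounds:
  assumes "ennreal P1 \<le> y" "y \<le> ennreal P2" "0 \<le> P1" "0 \<le> P2"
  shows "P1 \<le> enn2real y" "enn2real y \<le> P2" "y = ennreal (enn2real y)"
proof -
  have "y < \<infinity>" using assms(2) by (rule le_less_trans) simp
  then show eq: "y = ennreal (enn2real y)" by simp
  show "P1 \<le> enn2real y" "enn2real y \<le> P2"
    using assms eq by (metis ennreal_le_iff enn2real_nonneg)+
qed

text \<open>On unit vectors |x|^t <= 1 + |x|^t0, so the moment of order t0 controls every lower one
  with the constant 1 + C, whatever t is.\<close>

lemma moment_lower_exponent:
  assumes "finite S" "finite \<Omega>" "\<Omega> \<noteq> {}" "r > 0" "0 < t" "t \<le> t0"
    "\<And>a. avg \<Omega> (\<lambda>\<omega>. \<bar>\<Sum>k\<in>S. a k * \<theta> k \<omega>\<bar> powr t0) \<le> C * lnorm r S a powr t0"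
  shows "avg \<Omega> (\<lambda>\<omega>. \<bar>\<Sum>k\<in>S. a k * \<theta> k \<omega>\<bar> powr t) \<le> (1 + C) * lnorm r S a powr t"
proof (rule moment_bound_homogeneous)
  fix a :: "'a \<Rightarrow> real" assume 1: "lnorm r S a = 1"
  have "avg \<Omega> (\<lambda>\<omega>. \<bar>\<Sum>k\<in>S. a k * \<theta> k \<omega>\<bar> powr t) \<le> avg \<Omega> (\<lambda>\<omega>. 1 + \<bar>\<Sum>k\<in>S. a k * \<theta> k \<omega>\<bar> powr t0)"
    using assms by (intro avg_mono powr_le_one_plus_powr) auto
  also have "\<dots> \<le> 1 + C" using assms(7)[of a] 1 assms by (simp add: avg_add avg_const)
  finally show "avg \<Omega> (\<lambda>\<omega>. \<bar>\<Sum>k\<in>S. a k * \<theta> k \<omega>\<bar> powr t) \<le> 1 + C" .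
qed (use assms in auto)

text \<open>The moment bound, integrated with its own exponent at each point. \<open>P\<close> is
  left general because it will be both the exponent of the source and the conjugate exponent of the
  target.\<close>

lemma sum_modular_le:
  fixes P :: "'a \<Rightarrow> real" and C :: real
  assumes fin: "finite S" "finite \<Omega>" "\<Omega> \<noteq> {}" and r: "r > 0" and C: "C \<ge> 0"
    and sys: "\<And>a. avg \<Omega> (\<lambda>\<omega>. \<bar>\<Sum>k\<in>S. a k * \<theta> k \<omega>\<bar> powr t0) \<le> C * lnorm r S a powr t0"
    and P: "P \<in> borel_measurable M" "AE x in M. 0 < P x \<and> P x \<le> t0"
    and f: "\<And>k. k \<in> S \<Longrightarrow> f k \<in> borel_measurable M"
  shows "(\<Sum>\<omega>\<in>\<Omega>. \<integral>\<^sup>+ x. ennreal (\<bar>\<Sum>k\<in>S. f k x * \<theta> k \<omega>\<bar> powr P x) \<partial>M)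
    \<le> ennreal (card \<Omega> * (1 + C)) * (\<integral>\<^sup>+ x. ennreal (lnorm r S (\<lambda>k. f k x) powr P x) \<partial>M)"
proof -
  note [measurable] = P(1) f
  have [measurable]: "(\<lambda>x. lnorm r S (\<lambda>k. f k x)) \<in> borel_measurable M"
    unfolding lnorm_def by measurable
  have c: "real (card \<Omega>) > 0" using fin by (simp add: card_gt_0_iff)
  have "(\<Sum>\<omega>\<in>\<Omega>. \<integral>\<^sup>+ x. ennreal (\<bar>\<Sum>k\<in>S. f k x * \<theta> k \<omega>\<bar> powr P x) \<partial>M)
     = (\<integral>\<^sup>+ x. (\<Sum>\<omega>\<in>\<Omega>. ennreal (\<bar>\<Sum>k\<in>S. f k x * \<theta> k \<omega>\<bar> powr P x)) \<partial>M)"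
    by (subst nn_integral_sum) auto
  also have "\<dots> \<le> (\<integral>\<^sup>+ x. ennreal (card \<Omega> * (1 + C)) * ennreal (lnorm r S (\<lambda>k. f k x) powr P x) \<partial>M)"
  proof (rule nn_integral_mono_AE)
    show "AE x in M. (\<Sum>\<omega>\<in>\<Omega>. ennreal (\<bar>\<Sum>k\<in>S. f k x * \<theta> k \<omega>\<bar> powr P x))
       \<le> ennreal (card \<Omega> * (1 + C)) * ennreal (lnorm r S (\<lambda>k. f k x) powr P x)"
      using P(2)
    proof eventually_elim
      case (elim x)
      have "avg \<Omega> (\<lambda>\<omega>. \<bar>\<Sum>k\<in>S. f k x * \<theta> k \<omega>\<bar> powr P x) \<le> (1 + C) * lnorm r S (\<lambda>k. f k x) powr P x"
        by (rule moment_lower_exponent[OF fin r _ _ sys]) (use elim in auto)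
      then have "(\<Sum>\<omega>\<in>\<Omega>. \<bar>\<Sum>k\<in>S. f k x * \<theta> k \<omega>\<bar> powr P x) \<le> card \<Omega> * (1 + C) * lnorm r S (\<lambda>k. f k x) powr P x"
        unfolding avg_def pos_divide_le_eq[OF c] by (simp only: mult_ac)
      then have "ennreal (\<Sum>\<omega>\<in>\<Omega>. \<bar>\<Sum>k\<in>S. f k x * \<theta> k \<omega>\<bar> powr P x) \<le> ennreal (card \<Omega> * (1 + C) * lnorm r S (\<lambda>k. f k x) powr P x)"
        by (rule ennreal_leI)
      then show ?case using c C by (simp add: sum_ennreal ennreal_mult'')
    qed
  qed
  also have "\<dots> = ennreal (card \<Omega> * (1 + C)) * (\<integral>\<^sup>+ x. ennreal (lnorm r S (\<lambda>k. f k x) powr P x) \<partial>M)"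
    by (rule nn_integral_cmult) measurable
  finally show ?thesis .
qed

text \<open>By convexity the norm grows at most linearly with the modular. This permits adding up
  norms over the sample space when only the sum of the modulars is under control.\<close>

lemma Lvar_norm_le_one_plus_modular:
  assumes p: "p \<in> exponents M" and f: "f \<in> borel_measurable M" and c: "c > 0" and R: "R \<ge> 0"
    and le: "modular M p (\<lambda>x. f x / c) \<le> ennreal R"
  shows "f \<in> Lvar M p" "Lvar_norm M p f \<le> c * (1 + R)"
proof -
  have "modular M p (\<lambda>x. f x / c / (1 + R)) \<le> ennreal (1 / (1 + R)) * modular M p (\<lambda>x. f x / c)"
    using modular_scale_le[OF p, of "\<lambda>x. f x / c" "1 + R"] f R by simp
  also have "\<dots> \<le> ennreal (1 / (1 + R)) * ennreal R" using le by (intro mult_left_mono) auto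
  also have "\<dots> = ennreal (R / (1 + R))" using R by (simp flip: ennreal_mult'')
  also have "\<dots> \<le> 1" using R by simp
  finally have *: "modular M p (\<lambda>x. f x / (c * (1 + R))) \<le> 1" by (simp add: field_simps)
  have "c * (1 + R) > 0" using c R by simp
  then show "f \<in> Lvar M p" "Lvar_norm M p f \<le> c * (1 + R)"
    using * f by (auto intro: Lvar_I Lvar_norm_le)
qed

lemma le_mult_of_greater:
  assumes "\<And>c. c > b \<Longrightarrow> x \<le> K * c" "K \<ge> 0"
  shows "x \<le> K * (b::real)"
proof (rule field_le_epsilon)
  fix e :: real assume "e > 0"
  then have "x \<le> K * (b + e / (K + 1))" using assms by (intro assms(1)) auto
  also have "\<dots> = K * b + e * (K / (K + 1))" by (simp add: distrib_left)
  also have "\<dots> \<le> K * b + e * 1"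
    using \<open>e > 0\<close> assms(2) by (intro add_left_mono mult_left_mono) auto
  finally show "x \<le> K * b + e" by simp
qed

lemma lnorm_Lvar:
  assumes p: "p \<in> exponents M" and r: "r \<ge> 1" and S: "finite S" and f: "\<And>k. k \<in> S \<Longrightarrow> f k \<in> Lvar M p"
  shows "(\<lambda>x. lnorm r S (\<lambda>k. f k x)) \<in> Lvar M p"
proof (rule Lvar_mono(1)[OF p])
  show "(\<lambda>x. \<Sum>k\<in>S. \<bar>f k x\<bar>) \<in> Lvar M p" by (intro Lvar_sum(1)[OF p S] Lvar_abs(1)[OF p] f)
  have [measurable]: "f k \<in> borel_measurable M" if "k \<in> S" for k using f[OF that] by (rule Lvar_measurable)
  show "(\<lambda>x. lnorm r S (\<lambda>k. f k x)) \<in> borel_measurable M" unfolding lnorm_def by measurable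
  show "AE x in M. \<bar>lnorm r S (\<lambda>k. f k x)\<bar> \<le> \<bar>\<Sum>k\<in>S. \<bar>f k x\<bar>\<bar>"
    using lnorm_le_sum[OF r S] by (intro AE_I2) (simp add: sum_nonneg)
qed

text \<open>The inequality behind \<open>kconst\<close> for finite r and one fixed constant, freed
  from the condition that the constant is at least 1 and from the infimum.\<close>

definition vv_bound :: "'b measure \<Rightarrow> ('b \<Rightarrow> ennreal) \<Rightarrow> 'a measure \<Rightarrow> ('a \<Rightarrow> ennreal) \<Rightarrow> real \<Rightarrow> real \<Rightarrow> bool" where
  "vv_bound M q N p r K \<longleftrightarrow>
    (\<forall>T (n :: nat) f. bounded_operator M q N p T \<longrightarrow> n \<ge> 1 \<longrightarrow> (\<forall>k\<in>{1..n}. f k \<in> Lvar M q) \<longrightarrow>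
      Lvar_norm N p (\<lambda>x. lnorm r {1..n} (\<lambda>k. T (f k) x))
        \<le> K * operator_norm M q N p T * Lvar_norm M q (\<lambda>x. lnorm r {1..n} (\<lambda>k. f k x)))"

lemma ell_norm_eq_lnorm: "0 \<le> r \<Longrightarrow> ell_norm (ennreal r) n f = (\<lambda>x. lnorm r {1..n} (\<lambda>k. f k x))"
  by (simp add: ell_norm_def lnorm_def fun_eq_iff)

lemma kconst_finite_if:
  assumes q: "q \<in> exponents M" and r: "1 \<le> r" and K: "vv_bound M q N p r K"
  shows "kconst M q N p (ennreal r) < \<infinity>"
proof -
  have "ennreal (max 1 K) \<in> ennreal ` {C::real. C \<ge> 1 \<and>
     (\<forall>T (n :: nat) f. bounded_operator M q N p T \<longrightarrow> n \<ge> 1 \<longrightarrow> (\<forall>k\<in>{1..n}. f k \<in> Lvar M q) \<longrightarrow>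
        Lvar_norm N p (ell_norm (ennreal r) n (\<lambda>k. T (f k)))
          \<le> C * operator_norm M q N p T * Lvar_norm M q (ell_norm (ennreal r) n f))}"
  proof (intro imageI CollectI conjI allI impI)
    fix T :: "('a \<Rightarrow> real) \<Rightarrow> 'b \<Rightarrow> real" and n and f :: "nat \<Rightarrow> 'a \<Rightarrow> real"
    assume T: "bounded_operator M q N p T" and n: "1 \<le> n" and f: "\<forall>k\<in>{1..n}. f k \<in> Lvar M q"
    have nn: "0 \<le> operator_norm M q N p T * Lvar_norm M q (\<lambda>x. lnorm r {1..n} (\<lambda>k. f k x))"
      using bounded_operator_norm(1)[OF q T] f r
      by (intro mult_nonneg_nonneg Lvar_norm_nonneg[OF q] lnorm_Lvar[OF q]) auto
    have "Lvar_norm N p (\<lambda>x. lnorm r {1..n} (\<lambda>k. T (f k) x))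
        \<le> K * (operator_norm M q N p T * Lvar_norm M q (\<lambda>x. lnorm r {1..n} (\<lambda>k. f k x)))"
      using K T n f by (simp add: vv_bound_def mult.assoc)
    also have "\<dots> \<le> max 1 K * (operator_norm M q N p T * Lvar_norm M q (\<lambda>x. lnorm r {1..n} (\<lambda>k. f k x)))"
      using nn by (intro mult_right_mono) auto
    finally show "Lvar_norm N p (ell_norm (ennreal r) n (\<lambda>k. T (f k)))
        \<le> max 1 K * operator_norm M q N p T * Lvar_norm M q (ell_norm (ennreal r) n f)"
      using r by (simp add: ell_norm_eq_lnorm mult.assoc)
  qed simp
  then have "kconst M q N p (ennreal r) \<le> ennreal (max 1 K)"
    unfolding kconst_def by (rule Inf_lower)
  also have "\<dots> < \<infinity>" by simp
  finally show ?thesis .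
qed

text \<open>Randomisation in the source: the operator is applied to the random functions
  \<open>\<Sum>\<^sub>k \<theta>\<^sub>k f\<^sub>k\<close> for a stable system \<open>\<theta>\<close>.\<close>

lemma vv_bound_source:
  assumes p: "p \<in> exponents N" and q: "q \<in> exponents M" and Q: "1 \<le> Q" "AE x in M. q x \<le> ennreal Q"
    and r: "1 < r" "r \<le> 2" "Q < r \<or> r = 2"
  shows "\<exists>K. vv_bound M q N p r K"
proof -
  have "0 < Q" using Q by simp
  from stable_system_exists[where 'i = nat, OF r(1,2) this r(3)] obtain c C where c: "c > 0" and C: "C \<ge> 1"
    and sys: "\<And>S :: nat set. finite S \<Longrightarrow> \<exists>(\<Omega> :: ((nat \<Rightarrow> nat) \<times> nat set) set) \<theta>. finite \<Omega> \<and> \<Omega> \<noteq> {} \<and>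
      (\<forall>a. c * lnorm r S a \<le> avg \<Omega> (\<lambda>\<omega>. \<bar>\<Sum>k\<in>S. a k * \<theta> k \<omega>\<bar>)) \<and>
      (\<forall>a. avg \<Omega> (\<lambda>\<omega>. \<bar>\<Sum>k\<in>S. a k * \<theta> k \<omega>\<bar> powr Q) \<le> C * lnorm r S a powr Q)"
    by blast
  have "vv_bound M q N p r ((2 + C) / c)"
    unfolding vv_bound_def
  proof (intro allI impI)
    fix T n and f :: "nat \<Rightarrow> 'b \<Rightarrow> real"
    assume T: "bounded_operator M q N p T" and n: "1 \<le> n" and f: "\<forall>k\<in>{1..n}. f k \<in> Lvar M q"
    define S where "S = {1..n}"
    have S: "finite S" and f: "\<And>k. k \<in> S \<Longrightarrow> f k \<in> Lvar M q" using f by (auto simp: S_def)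
    obtain \<Omega> :: "((nat \<Rightarrow> nat) \<times> nat set) set" and \<theta> where \<Omega>: "finite \<Omega>" "\<Omega> \<noteq> {}"
      and lower: "\<And>a. c * lnorm r S a \<le> avg \<Omega> (\<lambda>\<omega>. \<bar>\<Sum>k\<in>S. a k * \<theta> k \<omega>\<bar>)"
      and upper: "\<And>a. avg \<Omega> (\<lambda>\<omega>. \<bar>\<Sum>k\<in>S. a k * \<theta> k \<omega>\<bar> powr Q) \<le> C * lnorm r S a powr Q"
      using sys[OF S] by blast
    have card: "real (card \<Omega>) > 0" using \<Omega> by (simp add: card_gt_0_iff)
    define F where "F x = lnorm r S (\<lambda>k. f k x)" for x
    define g where "g \<omega> x = (\<Sum>k\<in>S. \<theta> k \<omega> * f k x)" for \<omega> x
    have F: "F \<in> Lvar M q" unfolding F_def using r by (intro lnorm_Lvar[OF q _ S f]) auto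
    have g: "g \<omega> \<in> Lvar M q" for \<omega>
      unfolding g_def by (intro Lvar_sum(1)[OF q S] Lvar_cmult(1)[OF q] f)
    have q_fin: "AE x in M. q x < \<infinity>"
      using Q(2) by eventually_elim (auto intro: le_less_trans)
    have q_real: "AE x in M. 0 < enn2real (q x) \<and> enn2real (q x) \<le> Q"
      using Q(2) AE_space
    proof eventually_elim
      case (elim x)
      then show ?case using enn2real_bounds(1,2)[of 1 "q x" Q] exponents_ge_1[OF q] Q(1) by simp
    qed
    \<comment> \<open>Each norm is at most l times one plus the modular at scale l, and these
      modulars average to at most 1 + C; this is the origin of 2 + C.\<close>
    have norms: "(\<Sum>\<omega>\<in>\<Omega>. Lvar_norm M q (g \<omega>)) \<le> l * (card \<Omega> * (2 + C))" if l: "l > Lvar_norm M q F" for l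
    proof -
      have l0: "l > 0" using l Lvar_norm_nonneg[OF q F] by simp
      have [measurable]: "q \<in> borel_measurable M" using q by (simp add: exponents_def)
      have [measurable]: "f k \<in> borel_measurable M" if "k \<in> S" for k using f[OF that] by (rule Lvar_measurable)
      have [measurable]: "g \<omega> \<in> borel_measurable M" for \<omega> using g by (rule Lvar_measurable)
      define R where "R \<omega> = modular M q (\<lambda>x. g \<omega> x / l)" for \<omega>
      have R: "R \<omega> = (\<integral>\<^sup>+ x. ennreal (\<bar>\<Sum>k\<in>S. (f k x / l) * \<theta> k \<omega>\<bar> powr enn2real (q x)) \<partial>M)" for \<omega>
        unfolding R_def using modular_eq_nn_integral[OF q q_fin, of "\<lambda>x. g \<omega> x / l"]
        by (simp add: g_def sum_divide_distrib mult.commute)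
      have Fl: "lnorm r S (\<lambda>k. f k x / l) = \<bar>F x / l\<bar>" for x
        using lnorm_cmult[of r S "1 / l" "\<lambda>k. f k x"] r l0 by (simp add: F_def abs_divide)
      have "(\<Sum>\<omega>\<in>\<Omega>. R \<omega>) \<le> ennreal (card \<Omega> * (1 + C)) * (\<integral>\<^sup>+ x. ennreal (lnorm r S (\<lambda>k. f k x / l) powr enn2real (q x)) \<partial>M)"
        unfolding R using q_real C r S \<Omega>
        by (intro sum_modular_le[of S \<Omega> r C \<theta> Q] upper) auto
      also have "(\<integral>\<^sup>+ x. ennreal (lnorm r S (\<lambda>k. f k x / l) powr enn2real (q x)) \<partial>M) = modular M q (\<lambda>x. F x / l)"
        unfolding Fl using F by (subst modular_eq_nn_integral[OF q q_fin]) (auto simp: Lvar_def)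
      also have "ennreal (card \<Omega> * (1 + C)) * modular M q (\<lambda>x. F x / l) \<le> ennreal (card \<Omega> * (1 + C)) * 1"
        using modular_le_1[OF q F l] by (intro mult_left_mono) auto
      finally have sumR: "(\<Sum>\<omega>\<in>\<Omega>. R \<omega>) \<le> ennreal (card \<Omega> * (1 + C))" by simp
      then have "(\<Sum>\<omega>\<in>\<Omega>. R \<omega>) < \<infinity>" by (rule le_less_trans) simp
      then have fin: "R \<omega> < \<infinity>" if "\<omega> \<in> \<Omega>" for \<omega> using that \<Omega> by (auto simp: less_top)
      have "(\<Sum>\<omega>\<in>\<Omega>. Lvar_norm M q (g \<omega>)) \<le> (\<Sum>\<omega>\<in>\<Omega>. l * (1 + enn2real (R \<omega>)))"
      proof (rule sum_mono)
        fix \<omega> assume "\<omega> \<in> \<Omega>"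
        then show "Lvar_norm M q (g \<omega>) \<le> l * (1 + enn2real (R \<omega>))"
          using fin l0 by (intro Lvar_norm_le_one_plus_modular[OF q]) (auto simp: R_def)
      qed
      also have "\<dots> = l * (card \<Omega> + enn2real (\<Sum>\<omega>\<in>\<Omega>. R \<omega>))"
        using fin by (subst enn2real_sum) (auto simp: sum_distrib_left[symmetric] sum.distrib)
      also have "\<dots> \<le> l * (card \<Omega> + card \<Omega> * (1 + C))"
        using l0 C enn2real_mono[OF sumR] by (intro mult_left_mono add_left_mono) auto
      finally show ?thesis by (simp add: algebra_simps)
    qed
    define G where "G x = lnorm r S (\<lambda>k. T (f k) x)" for x
    \<comment> \<open>Finiteness of \<Omega> allows a single exceptional null set for all
      \<omega>.\<close>
    have Tg: "AE x in N. \<forall>\<omega>\<in>\<Omega>. T (g \<omega>) x = (\<Sum>k\<in>S. \<theta> k \<omega> * T (f k) x)"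
      unfolding g_def by (subst AE_ball_countable) (use \<Omega> in \<open>auto intro!: bounded_operator_sum[OF q T S f] countable_finite\<close>)
    define H where "H x = (\<Sum>\<omega>\<in>\<Omega>. \<bar>T (g \<omega>) x\<bar>)" for x
    have H: "H \<in> Lvar N p" "Lvar_norm N p H \<le> (\<Sum>\<omega>\<in>\<Omega>. Lvar_norm N p (T (g \<omega>)))"
    proof -
      have *: "(\<lambda>x. \<bar>T (g \<omega>) x\<bar>) \<in> Lvar N p" "Lvar_norm N p (\<lambda>x. \<bar>T (g \<omega>) x\<bar>) \<le> Lvar_norm N p (T (g \<omega>))" for \<omega>
        using Lvar_abs[OF p bounded_operator_Lvar[OF T g]] by auto
      show "H \<in> Lvar N p" unfolding H_def by (intro Lvar_sum(1)[OF p \<Omega>(1)] *)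
      show "Lvar_norm N p H \<le> (\<Sum>\<omega>\<in>\<Omega>. Lvar_norm N p (T (g \<omega>)))"
        unfolding H_def using Lvar_sum(2)[OF p \<Omega>(1), of "\<lambda>\<omega> x. \<bar>T (g \<omega>) x\<bar>"] * 
        by (meson order_trans sum_mono)
    qed
    \<comment> \<open>The lower moment bound, applied at each point to the numbers
      \<open>T (f k) x\<close>: the l^r norm is dominated by the average of |T (g \<omega>)|,
      divided by c.\<close>
    have "AE x in N. \<bar>G x\<bar> \<le> \<bar>1 / (c * card \<Omega>) * H x\<bar>"
      using Tg
    proof eventually_elim
      case (elim x)
      have "c * G x \<le> avg \<Omega> (\<lambda>\<omega>. \<bar>\<Sum>k\<in>S. T (f k) x * \<theta> k \<omega>\<bar>)" unfolding G_def by (rule lower)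
      also have "\<dots> = avg \<Omega> (\<lambda>\<omega>. \<bar>T (g \<omega>) x\<bar>)"
        using elim by (intro avg_cong) (simp add: mult.commute)
      also have "\<dots> = H x / card \<Omega>" by (simp add: avg_def H_def)
      finally have "G x \<le> 1 / (c * card \<Omega>) * H x" using c card by (simp add: field_simps)
      moreover have "0 \<le> G x" by (simp add: G_def)
      ultimately show ?case by (metis abs_ge_self abs_of_nonneg order_trans)
    qed
    moreover have "G \<in> borel_measurable N"
      unfolding G_def using r by (intro Lvar_measurable[where p=p] lnorm_Lvar[OF p _ S] bounded_operator_Lvar[OF T] f) auto
    ultimately have "Lvar_norm N p G \<le> Lvar_norm N p (\<lambda>x. 1 / (c * card \<Omega>) * H x)"
      using Lvar_mono(2)[OF p Lvar_cmult(1)[OF p H(1)]] by blast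
    also have "\<dots> \<le> 1 / (c * card \<Omega>) * Lvar_norm N p H"
      using Lvar_cmult(2)[OF p H(1), of "1 / (c * card \<Omega>)"] c by simp
    also have "\<dots> \<le> 1 / (c * card \<Omega>) * (\<Sum>\<omega>\<in>\<Omega>. operator_norm M q N p T * Lvar_norm M q (g \<omega>))"
      using c by (intro mult_left_mono order_trans[OF H(2)] sum_mono bounded_operator_norm(2)[OF q T] g) auto
    also have "\<dots> = operator_norm M q N p T / (c * card \<Omega>) * (\<Sum>\<omega>\<in>\<Omega>. Lvar_norm M q (g \<omega>))"
      by (simp add: sum_distrib_left)
    finally have le: "Lvar_norm N p G \<le> operator_norm M q N p T / (c * card \<Omega>) * (\<Sum>\<omega>\<in>\<Omega>. Lvar_norm M q (g \<omega>))" .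
    have nn: "0 \<le> operator_norm M q N p T" by (rule bounded_operator_norm(1)[OF q T])
    have "Lvar_norm N p G \<le> (2 + C) / c * operator_norm M q N p T * Lvar_norm M q F"
    proof (rule le_mult_of_greater)
      fix l assume "l > Lvar_norm M q F"
      from norms[OF this] have "operator_norm M q N p T / (c * card \<Omega>) * (\<Sum>\<omega>\<in>\<Omega>. Lvar_norm M q (g \<omega>))
          \<le> operator_norm M q N p T / (c * card \<Omega>) * (l * (card \<Omega> * (2 + C)))"
        using nn c by (intro mult_left_mono) auto
      also have "\<dots> = (2 + C) / c * operator_norm M q N p T * l" using card by simp
      finally show "Lvar_norm N p G \<le> (2 + C) / c * operator_norm M q N p T * l" using le by simp
    qed (use nn c C in auto)
    then show "Lvar_norm N p (\<lambda>x. lnorm r {1..n} (\<lambda>k. T (f k) x))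
        \<le> (2 + C) / c * operator_norm M q N p T * Lvar_norm M q (\<lambda>x. lnorm r {1..n} (\<lambda>k. f k x))"
      unfolding G_def[abs_def] F_def[abs_def] S_def .
  qed
  then show ?thesis by blast
qed

section \<open>Concavity and convexity constants of variable Lebesgue spaces\<close>

lemma AE_enn2real_bounds:
  assumes "q \<in> exponents M" "AE x in M. q x \<le> ennreal Q" "0 \<le> Q"
  shows "AE x in M. 1 \<le> enn2real (q x) \<and> enn2real (q x) \<le> Q"
  using assms(2) AE_space
proof eventually_elim
  case (elim x)
  then show ?case using enn2real_bounds(1,2)[of 1 "q x" Q] exponents_ge_1[OF assms(1)] assms(3) by simp
qed

lemma AE_finite_exponent:
  "AE x in M. q x \<le> ennreal Q \<Longrightarrow> AE x in M. q x < \<infinity>"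
  by (erule eventually_mono) (auto intro: le_less_trans)

text \<open>The doubling property of a bounded exponent: changing the scale by a factor K >= 1
  multiplies the modular by at most K^Q.\<close>

lemma modular_finite:
  assumes p: "p \<in> exponents M" and Q: "0 \<le> Q" "AE x in M. p x \<le> ennreal Q" and f: "f \<in> Lvar M p" and c: "c > 0"
  shows "modular M p (\<lambda>x. f x / c) < \<infinity>"
proof -
  obtain d where d: "d > 0" "modular M p (\<lambda>x. f x / d) \<le> 1" using Lvar_norm_set_nonempty[OF p f] .
  have [measurable]: "f \<in> borel_measurable M" "p \<in> borel_measurable M"
    using f p by (auto simp: Lvar_def exponents_def)
  note eq = modular_eq_nn_integral[OF p AE_finite_exponent[OF Q(2)]]
  define K where "K = max 1 (d / c)"
  have K: "K \<ge> 1" "d / c \<le> K" by (auto simp: K_def)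
  have "modular M p (\<lambda>x. f x / c) \<le> (\<integral>\<^sup>+ x. ennreal (K powr Q) * ennreal (\<bar>f x / d\<bar> powr enn2real (p x)) \<partial>M)"
  proof (subst eq, measurable, rule nn_integral_mono_AE)
    show "AE x in M. ennreal (\<bar>f x / c\<bar> powr enn2real (p x)) \<le> ennreal (K powr Q) * ennreal (\<bar>f x / d\<bar> powr enn2real (p x))"
      using AE_enn2real_bounds[OF p Q(2,1)]
    proof eventually_elim
      case (elim x)
      have "\<bar>f x / c\<bar> = d / c * \<bar>f x / d\<bar>" using c d by (simp add: abs_divide)
      also have "\<dots> \<le> K * \<bar>f x / d\<bar>" using K by (intro mult_right_mono) auto
      finally have "\<bar>f x / c\<bar> powr enn2real (p x) \<le> (K * \<bar>f x / d\<bar>) powr enn2real (p x)"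
        by (intro powr_mono2) auto
      also have "\<dots> = K powr enn2real (p x) * \<bar>f x / d\<bar> powr enn2real (p x)" using K by (subst powr_mult) auto
      also have "\<dots> \<le> K powr Q * \<bar>f x / d\<bar> powr enn2real (p x)"
        using elim K by (intro mult_right_mono powr_mono) auto
      finally show ?case by (subst ennreal_mult'[symmetric]) (auto intro: ennreal_leI)
    qed
  qed
  also have "\<dots> = ennreal (K powr Q) * modular M p (\<lambda>x. f x / d)"
    by (subst eq) (auto intro!: nn_integral_cmult)
  also have "\<dots> \<le> ennreal (K powr Q) * 1" using d by (intro mult_left_mono) auto
  also have "\<dots> < \<infinity>" by simp
  finally show ?thesis .
qed

text \<open>r-concavity with constant 1. The modulars of f_k / (n_k l) exceed 1 when n_k l is
  positive and below the norm of f_k. Weighted by n_k^r and summed, they total at least L = \<Sum>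
  n_k^r, while Holder at each point bounds the total by L^(1 - 1/r) times a modular that is at most
  1. This is impossible for L > 1.\<close>

lemma lnorm_Lvar_norm_le:
  assumes q: "q \<in> exponents M" and r: "1 \<le> r" "AE x in M. q x \<le> ennreal r"
    and S: "finite S" and f: "\<And>k. k \<in> S \<Longrightarrow> f k \<in> Lvar M q"
  shows "lnorm r S (\<lambda>k. Lvar_norm M q (f k)) \<le> Lvar_norm M q (\<lambda>x. lnorm r S (\<lambda>k. f k x))"
proof (rule dense_ge)
  have r0: "0 \<le> r" using r(1) by simp
  define F where "F x = lnorm r S (\<lambda>k. f k x)" for x
  have F: "F \<in> Lvar M q" unfolding F_def[abs_def] by (rule lnorm_Lvar[OF q r(1) S f])
  note [measurable] = Lvar_measurable[OF F] 
  have [measurable]: "q \<in> borel_measurable M" using q by (simp add: exponents_def)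
  have [measurable]: "f k \<in> borel_measurable M" if "k \<in> S" for k using f[OF that] by (rule Lvar_measurable)
  note eq = modular_eq_nn_integral[OF q AE_finite_exponent[OF r(2)]]
  fix l assume "Lvar_norm M q (\<lambda>x. lnorm r S (\<lambda>k. f k x)) < l"
  then have l: "Lvar_norm M q F < l" by (simp add: F_def[abs_def])
  then have l0: "l > 0" using Lvar_norm_nonneg[OF q F] by simp
  define a where "a k = Lvar_norm M q (f k) / l" for k
  have a: "0 \<le> a k" if "k \<in> S" for k using Lvar_norm_nonneg[OF q f[OF that]] l0 by (simp add: a_def)
  have "lnorm r S a \<le> 1"
  proof (rule field_le_mult_one_interval)
    fix s :: real assume s: "0 < s" "s < 1"
    \<comment> \<open>The factor s < 1 puts \<open>n k * l\<close> strictly below a positive norm of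
      \<open>f k\<close>, so that the modular at this level really exceeds 1.\<close>
    define n where "n k = s * a k" for k
    have n: "0 \<le> n k" if "k \<in> S" for k using a[OF that] s by (simp add: n_def)
    define L where "L = (\<Sum>k\<in>S. n k powr r)"
    have L0: "L \<ge> 0" by (simp add: L_def sum_nonneg)
    have "L \<le> 1"
    proof (rule ccontr)
      assume "\<not> L \<le> 1"
      then have L1: "L > 1" by simp
      have each: "ennreal (n k powr r) \<le> (\<integral>\<^sup>+ x. ennreal (n k powr (r - enn2real (q x)) * \<bar>f k x / l\<bar> powr enn2real (q x)) \<partial>M)"
        if k: "k \<in> S" for k
      proof (cases "n k = 0")
        case False
        then have nk: "n k > 0" using n[OF k] by simp
        then have ak: "a k > 0" using s by (simp add: n_def zero_less_mult_iff)
        have "n k * l < Lvar_norm M q (f k)"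
          using s ak l0 mult_strict_right_mono[of s 1 "Lvar_norm M q (f k)"] by (simp add: n_def a_def zero_less_divide_iff)
        then have "\<not> modular M q (\<lambda>x. f k x / (n k * l)) \<le> 1"
          using Lvar_norm_le[of "n k * l" M q "f k"] nk l0 by auto
        then have "ennreal (n k powr r) * 1 \<le> ennreal (n k powr r) * modular M q (\<lambda>x. f k x / (n k * l))"
          by (intro mult_left_mono) auto
        also have "\<dots> = (\<integral>\<^sup>+ x. ennreal (n k powr r) * ennreal (\<bar>f k x / (n k * l)\<bar> powr enn2real (q x)) \<partial>M)"
          using k by (subst eq) (auto intro!: nn_integral_cmult[symmetric])
        also have "\<dots> = (\<integral>\<^sup>+ x. ennreal (n k powr (r - enn2real (q x)) * \<bar>f k x / l\<bar> powr enn2real (q x)) \<partial>M)"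
        proof (intro nn_integral_cong)
          fix x
          have e: "\<bar>f k x / (n k * l)\<bar> = \<bar>f k x / l\<bar> / n k" using nk by (simp add: abs_divide abs_mult)
          have gen: "n k powr r * (z / n k) powr t = n k powr (r - t) * z powr t" if "z \<ge> 0" for z t
            using nk that by (simp add: powr_divide powr_diff)
          have "n k powr r * \<bar>f k x / (n k * l)\<bar> powr enn2real (q x) = n k powr (r - enn2real (q x)) * \<bar>f k x / l\<bar> powr enn2real (q x)"
            by (simp only: e gen[OF abs_ge_zero])
          then show "ennreal (n k powr r) * ennreal (\<bar>f k x / (n k * l)\<bar> powr enn2real (q x)) =
              ennreal (n k powr (r - enn2real (q x)) * \<bar>f k x / l\<bar> powr enn2real (q x))"
            by (simp flip: ennreal_mult')
        qed
        finally show ?thesis by simp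
      qed (use r in simp)
      have "ennreal L = (\<Sum>k\<in>S. ennreal (n k powr r))" by (simp add: L_def sum_ennreal)
      also have "\<dots> \<le> (\<Sum>k\<in>S. \<integral>\<^sup>+ x. ennreal (n k powr (r - enn2real (q x)) * \<bar>f k x / l\<bar> powr enn2real (q x)) \<partial>M)"
        by (intro sum_mono each)
      also have "\<dots> = (\<integral>\<^sup>+ x. (\<Sum>k\<in>S. ennreal (n k powr (r - enn2real (q x)) * \<bar>f k x / l\<bar> powr enn2real (q x))) \<partial>M)"
        by (subst nn_integral_sum) auto
      also have "\<dots> \<le> (\<integral>\<^sup>+ x. ennreal (L powr (1 - 1 / r)) * ennreal (\<bar>F x / l\<bar> powr enn2real (q x)) \<partial>M)"
      proof (rule nn_integral_mono_AE)
        show "AE x in M. (\<Sum>k\<in>S. ennreal (n k powr (r - enn2real (q x)) * \<bar>f k x / l\<bar> powr enn2real (q x)))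
            \<le> ennreal (L powr (1 - 1 / r)) * ennreal (\<bar>F x / l\<bar> powr enn2real (q x))"
          using AE_enn2real_bounds[OF q r(2) r0]
        proof eventually_elim
          case (elim x)
          define t where "t = enn2real (q x)"
          have t: "1 \<le> t" "t \<le> r" using elim by (auto simp: t_def)
          have Fl: "\<bar>F x / l\<bar> = lnorm r S (\<lambda>k. f k x / l)"
            using lnorm_cmult[of r S "1 / l" "\<lambda>k. f k x"] r l0 by (simp add: F_def abs_divide)
          have "(\<Sum>k\<in>S. n k powr (r - t) * \<bar>f k x / l\<bar> powr t) \<le> L powr (1 - 1 / r) * \<bar>F x / l\<bar> powr t"
          \<comment> \<open>At t = r the Holder exponent r / (r - t) degenerates.\<close>
          proof (cases "t = r")
            case True
            \<comment> \<open>Only an inequality, because \<open>0 powr 0\<close> is 0.\<close>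
            have "(\<Sum>k\<in>S. n k powr (r - t) * \<bar>f k x / l\<bar> powr t) \<le> (\<Sum>k\<in>S. 1 * \<bar>f k x / l\<bar> powr t)"
              using True by (intro sum_mono mult_right_mono) (auto simp: powr_def)
            also have "\<dots> = 1 * \<bar>F x / l\<bar> powr t" unfolding Fl using True r(1) by (simp add: lnorm_powr)
            also have "\<dots> \<le> L powr (1 - 1 / r) * \<bar>F x / l\<bar> powr t"
              using L1 r(1) by (intro mult_right_mono ge_one_powr_ge_zero) auto
            finally show ?thesis .
          next
            case False
            then have tr: "t < r" using t by simp
            have "(\<Sum>k\<in>S. n k powr (r - t) * \<bar>f k x / l\<bar> powr t) \<le> lnorm (r / (r - t)) S (\<lambda>k. n k powr (r - t)) * lnorm (r / t) S (\<lambda>k. \<bar>f k x / l\<bar> powr t)"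
            proof (rule order_trans[OF abs_ge_self lnorm_Holder])
              show "1 < r / (r - t)" "1 < r / t" using t tr by (simp_all add: less_divide_eq)
              show "1 / (r / (r - t)) + 1 / (r / t) = 1" using t tr by (simp flip: add_divide_distrib)
            qed (rule S)
            also have "lnorm (r / (r - t)) S (\<lambda>k. n k powr (r - t)) = L powr ((r - t) / r)"
              using tr by (simp add: lnorm_def L_def powr_powr)
            also have "lnorm (r / t) S (\<lambda>k. \<bar>f k x / l\<bar> powr t) = \<bar>F x / l\<bar> powr t"
              unfolding Fl using t tr by (simp add: lnorm_def powr_powr)
            \<comment> \<open>Here t >= 1 and L > 1 give one power of L that serves at all
              points.\<close>
            also have "L powr ((r - t) / r) * \<bar>F x / l\<bar> powr t \<le> L powr (1 - 1 / r) * \<bar>F x / l\<bar> powr t"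
            proof (intro mult_right_mono powr_mono)
              show "(r - t) / r \<le> 1 - 1 / r" using t tr by (simp add: diff_divide_distrib divide_right_mono)
            qed (use L1 in auto)
            finally show ?thesis .
          qed
          then have "ennreal (\<Sum>k\<in>S. n k powr (r - t) * \<bar>f k x / l\<bar> powr t) \<le> ennreal (L powr (1 - 1 / r) * \<bar>F x / l\<bar> powr t)"
            by (rule ennreal_leI)
          then show ?case unfolding t_def[symmetric] by (simp add: sum_ennreal flip: ennreal_mult')
        qed
      qed
      also have "\<dots> = ennreal (L powr (1 - 1 / r)) * modular M q (\<lambda>x. F x / l)"
        by (subst eq) (auto intro!: nn_integral_cmult)
      also have "\<dots> \<le> ennreal (L powr (1 - 1 / r)) * 1"
        using modular_le_1[OF q F l] by (intro mult_left_mono) auto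
      finally have "L \<le> L powr (1 - 1 / r)" by (simp add: ennreal_le_iff)
      moreover have "L powr (1 - 1 / r) < L powr 1" using L1 r by (intro powr_less_mono) auto
      ultimately show False using L1 by simp
    qed
    then have "L powr (1 / r) \<le> 1 powr (1 / r)" using L0 r by (intro powr_mono2) auto
    moreover have "lnorm r S n = L powr (1 / r)"
      using n by (simp add: lnorm_def L_def)
    moreover have "lnorm r S n = s * lnorm r S a"
      unfolding n_def using s r by (subst lnorm_cmult) auto
    ultimately show "s * lnorm r S a \<le> 1" by simp
  qed
  moreover have "lnorm r S (\<lambda>k. Lvar_norm M q (f k)) = l * lnorm r S a"
    using lnorm_cmult[of r S l a] l0 r by (simp add: a_def)
  ultimately show "lnorm r S (\<lambda>k. Lvar_norm M q (f k)) \<le> l"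
    using l0 by (simp add: mult_left_le)
qed

text \<open>r-convexity with constant 1: (G / L)^r is the mean of |g_k / m_k|^r with weights (m_k /
  L)^r of total mass 1, and Jensen applies to the power t / r >= 1 at each point. Adding e makes m_k
  positive and larger than the norm; it is removed by the triangle inequality.\<close>

lemma Lvar_norm_lnorm_le:
  assumes p: "p \<in> exponents M" and r: "1 \<le> r" "AE x in M. ennreal r \<le> p x" and fin: "AE x in M. p x < \<infinity>"
    and S: "finite S" and g: "\<And>k. k \<in> S \<Longrightarrow> g k \<in> Lvar M p"
  shows "Lvar_norm M p (\<lambda>x. lnorm r S (\<lambda>k. g k x)) \<le> lnorm r S (\<lambda>k. Lvar_norm M p (g k))"
proof (cases "S = {}")
  case True
  then show ?thesis using Lvar_zero(2)[OF p] by (simp add: lnorm_def)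
next
  case False
  define G where "G x = lnorm r S (\<lambda>k. g k x)" for x
  have G: "G \<in> Lvar M p" unfolding G_def[abs_def] by (rule lnorm_Lvar[OF p r(1) S g])
  note [measurable] = Lvar_measurable[OF G] 
  have [measurable]: "p \<in> borel_measurable M" using p by (simp add: exponents_def)
  have [measurable]: "g k \<in> borel_measurable M" if "k \<in> S" for k using g[OF that] by (rule Lvar_measurable)
  note eq = modular_eq_nn_integral[OF p fin]
  have nn: "0 \<le> Lvar_norm M p (g k)" if "k \<in> S" for k by (rule Lvar_norm_nonneg[OF p g[OF that]])
  have *: "Lvar_norm M p G \<le> lnorm r S (\<lambda>k. Lvar_norm M p (g k) + e)" if e: "e > 0" for e
  proof -
    define m where "m k = Lvar_norm M p (g k) + e" for k
    have m: "m k > 0" "Lvar_norm M p (g k) < m k" if "k \<in> S" for k using nn[OF that] e by (auto simp: m_def)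
    define L where "L = lnorm r S m"
    have "L \<noteq> 0" using False S m by (auto simp: L_def lnorm_eq_0_iff)
    then have L: "L > 0" by (simp add: L_def less_le)
    have one: "(\<Sum>k\<in>S. (m k / L) powr r) = 1"
    proof -
      have "(\<Sum>k\<in>S. (m k / L) powr r) = (\<Sum>k\<in>S. \<bar>m k\<bar> powr r) / L powr r"
        unfolding sum_divide_distrib
      proof (intro sum.cong refl)
        fix k assume "k \<in> S"
        then show "(m k / L) powr r = \<bar>m k\<bar> powr r / L powr r"
          using m(1)[of k] L by (simp add: powr_divide)
      qed
      also have "\<dots> = L powr r / L powr r" using r(1) by (simp add: L_def lnorm_powr)
      finally show ?thesis using L by simp
    qed
    have "modular M p (\<lambda>x. G x / L) \<le> (\<integral>\<^sup>+ x. (\<Sum>k\<in>S. ennreal ((m k / L) powr r) * ennreal (\<bar>g k x / m k\<bar> powr enn2real (p x))) \<partial>M)"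
    proof (subst eq, measurable, rule nn_integral_mono_AE)
      show "AE x in M. ennreal (\<bar>G x / L\<bar> powr enn2real (p x))
         \<le> (\<Sum>k\<in>S. ennreal ((m k / L) powr r) * ennreal (\<bar>g k x / m k\<bar> powr enn2real (p x)))"
        using r(2) fin
      proof eventually_elim
        case (elim x)
        define t where "t = enn2real (p x)"
        have "p x = ennreal t" using elim by (simp add: t_def)
        then have "ennreal r \<le> ennreal t" using elim by simp
        then have t: "r \<le> t" by (rule ennreal_le_iff[THEN iffD1, rotated]) (simp add: t_def)
        have gm: "(\<bar>g k x\<bar> / L) powr r = (m k / L) powr r * \<bar>g k x / m k\<bar> powr r" if "k \<in> S" for k
          using m[OF that] L by (simp add: abs_divide flip: powr_mult)
        have "\<bar>G x / L\<bar> powr t = ((G x / L) powr r) powr (t / r)"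
          using t r L by (simp add: powr_powr G_def)
        also have "(G x / L) powr r = (\<Sum>k\<in>S. (\<bar>g k x\<bar> / L) powr r)"
          using L r by (simp add: G_def powr_divide lnorm_powr sum_divide_distrib)
        also have "\<dots> = (\<Sum>k\<in>S. (m k / L) powr r * \<bar>g k x / m k\<bar> powr r)" by (intro sum.cong refl gm)
        also have "\<dots> powr (t / r) \<le> (\<Sum>k\<in>S. (m k / L) powr r * (\<bar>g k x / m k\<bar> powr r) powr (t / r))"
          using S one t r by (intro powr_weighted_sum_le) auto
        also have "\<dots> = (\<Sum>k\<in>S. (m k / L) powr r * \<bar>g k x / m k\<bar> powr t)"
          using r by (simp add: powr_powr)
        finally have "ennreal (\<bar>G x / L\<bar> powr t) \<le> ennreal (\<Sum>k\<in>S. (m k / L) powr r * \<bar>g k x / m k\<bar> powr t)"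
          by (rule ennreal_leI)
        then show ?case unfolding t_def[symmetric] by (simp add: sum_ennreal flip: ennreal_mult')
      qed
    qed
    also have "\<dots> = (\<Sum>k\<in>S. ennreal ((m k / L) powr r) * modular M p (\<lambda>x. g k x / m k))"
      by (subst nn_integral_sum) (auto intro!: sum.cong simp: eq nn_integral_cmult)
    also have "\<dots> \<le> (\<Sum>k\<in>S. ennreal ((m k / L) powr r) * 1)"
      using m by (intro sum_mono mult_left_mono modular_le_1[OF p g]) auto
    also have "\<dots> = ennreal (\<Sum>k\<in>S. (m k / L) powr r)" by (simp add: sum_ennreal)
    also have "\<dots> = 1" by (simp add: one)
    finally show ?thesis unfolding m_def[symmetric] L_def[symmetric] by (intro Lvar_norm_le L)
  qed
  have "Lvar_norm M p G \<le> lnorm r S (\<lambda>k. Lvar_norm M p (g k))"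
  proof (rule field_le_epsilon)
    fix e :: real assume e: "e > 0"
    define L1 where "L1 = lnorm r S (\<lambda>_. 1)"
    have L1: "L1 \<ge> 0" by (simp add: L1_def)
    define d where "d = e / (L1 + 1)"
    have d: "d > 0" using e L1 by (simp add: d_def)
    have "Lvar_norm M p G \<le> lnorm r S (\<lambda>k. Lvar_norm M p (g k) + d * 1)" using *[OF d] by simp
    also have "\<dots> \<le> lnorm r S (\<lambda>k. Lvar_norm M p (g k)) + lnorm r S (\<lambda>k. d * 1)" by (rule lnorm_triangle[OF r(1) S])
    also have "lnorm r S (\<lambda>k. d * 1) = e * (L1 / (L1 + 1))"
    proof -
      have "lnorm r S (\<lambda>k. d * 1) = \<bar>d\<bar> * L1" unfolding L1_def using r(1) by (intro lnorm_cmult) simp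
      also have "\<dots> = d * L1" using d by simp
      finally show ?thesis by (simp add: d_def)
    qed
    also have "\<dots> \<le> e * 1" using e L1 by (intro mult_left_mono) auto
    finally show "Lvar_norm M p G \<le> lnorm r S (\<lambda>k. Lvar_norm M p (g k)) + e" by simp
  qed
  then show ?thesis unfolding G_def[abs_def] .
qed

lemma vv_bound_between:
  assumes p: "p \<in> exponents N" and q: "q \<in> exponents M" and r: "1 \<le> r"
    and "AE x in M. q x \<le> ennreal r" "AE x in N. ennreal r \<le> p x" "AE x in N. p x < \<infinity>"
  shows "vv_bound M q N p r 1"
  unfolding vv_bound_def
proof (intro allI impI)
  fix T and n :: nat and f
  assume T: "bounded_operator M q N p T" and n: "1 \<le> n" and f': "\<forall>k\<in>{1..n}. f k \<in> Lvar M q"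
  then have f: "\<And>k. k \<in> {1..n} \<Longrightarrow> f k \<in> Lvar M q" by blast
  have nn: "0 \<le> operator_norm M q N p T" by (rule bounded_operator_norm(1)[OF q T])
  have "Lvar_norm N p (\<lambda>x. lnorm r {1..n} (\<lambda>k. T (f k) x)) \<le> lnorm r {1..n} (\<lambda>k. Lvar_norm N p (T (f k)))"
    using bounded_operator_Lvar[OF T f] assms by (intro Lvar_norm_lnorm_le) auto
  also have "\<dots> \<le> lnorm r {1..n} (\<lambda>k. operator_norm M q N p T * Lvar_norm M q (f k))"
  proof (rule lnorm_mono)
    fix k assume k: "k \<in> {1..n}"
    show "\<bar>Lvar_norm N p (T (f k))\<bar> \<le> \<bar>operator_norm M q N p T * Lvar_norm M q (f k)\<bar>"
      using bounded_operator_norm(2)[OF q T f[OF k]] Lvar_norm_nonneg[OF p bounded_operator_Lvar[OF T f[OF k]]]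
      by linarith
  qed (use r in simp)
  also have "\<dots> = operator_norm M q N p T * lnorm r {1..n} (\<lambda>k. Lvar_norm M q (f k))"
    using r nn by (subst lnorm_cmult) auto
  also have "\<dots> \<le> operator_norm M q N p T * Lvar_norm M q (\<lambda>x. lnorm r {1..n} (\<lambda>k. f k x))"
    using nn assms f by (intro mult_left_mono lnorm_Lvar_norm_le) auto
  finally show "Lvar_norm N p (\<lambda>x. lnorm r {1..n} (\<lambda>k. T (f k) x)) \<le> 1 * operator_norm M q N p T * Lvar_norm M q (\<lambda>x. lnorm r {1..n} (\<lambda>k. f k x))"
    by simp
qed

section \<open>Reduction to simple functions\<close>

lemma modular_infinity_le_1_iff:
  assumes "f \<in> borel_measurable M"
  shows "modular M (\<lambda>_. \<infinity>) f \<le> 1 \<longleftrightarrow> (AE x in M. \<bar>f x\<bar> \<le> 1)"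
proof -
  have i: "inf_set M (\<lambda>_. \<infinity>) = space M" by (auto simp: inf_set_def)
  define N where "N = restrict_space M (space M)"
  have [measurable]: "f \<in> borel_measurable N" unfolding N_def using assms by (rule measurable_restrict_space1)
  have "modular M (\<lambda>_. \<infinity>) f = esssup N (\<lambda>x. ennreal \<bar>f x\<bar>)"
    unfolding modular_def i N_def by simp
  moreover have "esssup N (\<lambda>x. ennreal \<bar>f x\<bar>) \<le> 1 \<longleftrightarrow> (AE x in N. ennreal \<bar>f x\<bar> \<le> 1)"
  proof
    assume le: "esssup N (\<lambda>x. ennreal \<bar>f x\<bar>) \<le> 1"
    show "AE x in N. ennreal \<bar>f x\<bar> \<le> 1"
      using esssup_AE[of "\<lambda>x. ennreal \<bar>f x\<bar>" N] by (rule eventually_mono) (rule order_trans[OF _ le])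
  qed (intro esssup_I, measurable)
  moreover have "(AE x in N. ennreal \<bar>f x\<bar> \<le> 1) \<longleftrightarrow> (AE x in M. \<bar>f x\<bar> \<le> 1)"
    unfolding N_def by (subst AE_restrict_space_iff) (auto intro!: AE_cong)
  ultimately show ?thesis by simp
qed

text \<open>Besides density it demands pointwise domination, so that the l^r norm of the
  approximants does not exceed that of the given functions on the source side.\<close>

definition simple_approximable :: "'a measure \<Rightarrow> ('a \<Rightarrow> ennreal) \<Rightarrow> bool" where
  "simple_approximable M q \<longleftrightarrow> (\<forall>f\<in>Lvar M q. \<forall>e>0. \<exists>s\<in>borel_measurable M.
     finite (s ` space M) \<and> (\<forall>x. \<bar>s x\<bar> \<le> \<bar>f x\<bar>) \<and> Lvar_norm M q (\<lambda>x. f x - s x) \<le> e)"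

text \<open>Rounding |t| down to a multiple of 1 / m and discarding values of size m or more gives
  finite range, domination and error at most 1 / m in one formula. It converges uniformly on
  essentially bounded functions once m is large, and pointwise in general.\<close>

definition trunc :: "nat \<Rightarrow> real \<Rightarrow> real" where
  "trunc m t = (if \<bar>t\<bar> < m then sgn t * (\<lfloor>\<bar>t\<bar> * m\<rfloor> / m) else 0)"

lemma trunc_measurable[measurable]: "trunc m \<in> borel_measurable borel"
  unfolding trunc_def[abs_def] by measurable

lemma abs_trunc_le: "\<bar>trunc m t\<bar> \<le> \<bar>t\<bar>"
proof (cases "\<bar>t\<bar> < m")
  case True
  then have m: "real m > 0" by linarith
  have "0 \<le> \<lfloor>\<bar>t\<bar> * m\<rfloor>" by simp
  then have "\<bar>trunc m t\<bar> \<le> \<lfloor>\<bar>t\<bar> * m\<rfloor> / m"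
    using True by (simp add: trunc_def abs_mult abs_sgn_eq)
  also have "\<dots> \<le> \<bar>t\<bar>" using m by (simp add: divide_le_eq)
  finally show ?thesis .
qed (simp add: trunc_def)

lemma trunc_diff_le:
  assumes "\<bar>t\<bar> < m" shows "\<bar>t - trunc m t\<bar> \<le> 1 / m"
proof -
  have m: "real m > 0" using assms by linarith
  define u where "u = \<lfloor>\<bar>t\<bar> * m\<rfloor> / m"
  have "u \<le> \<bar>t\<bar>" using m by (simp add: u_def divide_le_eq)
  moreover have "\<bar>t\<bar> * m - 1 \<le> of_int \<lfloor>\<bar>t\<bar> * m\<rfloor>" by linarith
  then have "(\<bar>t\<bar> * m - 1) / m \<le> u" unfolding u_def using m by (intro divide_right_mono) auto
  then have "\<bar>t\<bar> - 1 / m \<le> u" using m by (simp add: diff_divide_distrib)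
  moreover have "t - trunc m t = sgn t * (\<bar>t\<bar> - u)"
    using assms by (simp add: trunc_def u_def right_diff_distrib sgn_mult_abs mult.commute[of "sgn t" "\<bar>t\<bar>"] flip: mult_sgn_abs)
  moreover have "\<bar>sgn t * (\<bar>t\<bar> - u)\<bar> \<le> \<bar>\<bar>t\<bar> - u\<bar>" by (simp add: abs_mult abs_sgn_eq)
  ultimately show ?thesis by linarith
qed

lemma finite_range_trunc: "finite (range (trunc m))"
proof (rule finite_subset)
  show "range (trunc m) \<subseteq> (\<lambda>i :: int. of_int i / m) ` {- (int m * int m)..int m * int m}"
  proof
    fix y assume "y \<in> range (trunc m)"
    then obtain t where y: "y = trunc m t" by auto
    show "y \<in> (\<lambda>i :: int. of_int i / m) ` {- (int m * int m)..int m * int m}"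
    proof (cases "\<bar>t\<bar> < m \<and> t \<noteq> 0")
      case False
      then show ?thesis by (auto simp: y trunc_def intro!: image_eqI[of _ _ 0])
    next
      case True
      define k where "k = \<lfloor>\<bar>t\<bar> * m\<rfloor>"
      have "\<bar>t\<bar> * m \<le> real m * real m" using True by (intro mult_right_mono) auto
      then have k: "0 \<le> k" "k \<le> int m * int m" by (auto simp: k_def floor_le_iff)
      have "y = of_int (if t > 0 then k else - k) / m"
        using True by (auto simp: y trunc_def k_def sgn_if)
      then show ?thesis using k by (auto intro!: image_eqI[of _ _ "if t > 0 then k else - k"])
    qed
  qed
qed simp

lemma simple_approximableI:
  assumes q: "q \<in> exponents M"
    and "\<And>f e. f \<in> Lvar M q \<Longrightarrow> e > 0 \<Longrightarrow> \<exists>m. modular M q (\<lambda>x. (f x - trunc m (f x)) / e) \<le> 1"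
  shows "simple_approximable M q"
  unfolding simple_approximable_def
proof (intro ballI allI impI)
  fix f and e :: real assume f: "f \<in> Lvar M q" and e: "e > 0"
  note [measurable] = Lvar_measurable[OF f]
  obtain m where "modular M q (\<lambda>x. (f x - trunc m (f x)) / e) \<le> 1" using assms(2)[OF f e] by blast
  then have "Lvar_norm M q (\<lambda>x. f x - trunc m (f x)) \<le> e" using e by (intro Lvar_norm_le)
  moreover have "finite ((\<lambda>x. trunc m (f x)) ` space M)"
    by (rule finite_subset[OF _ finite_range_trunc[of m]]) auto
  ultimately show "\<exists>s\<in>borel_measurable M. finite (s ` space M) \<and> (\<forall>x. \<bar>s x\<bar> \<le> \<bar>f x\<bar>) \<and> Lvar_norm M q (\<lambda>x. f x - s x) \<le> e"
    by (intro bexI[of _ "\<lambda>x. trunc m (f x)"]) (auto simp: abs_trunc_le)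
qed

lemma infinity_in_exponents: "(\<lambda>_. \<infinity>) \<in> exponents M"
  by (simp add: exponents_def)

lemma simple_approximable_infinity: "simple_approximable M (\<lambda>_. \<infinity>)"
proof (rule simple_approximableI[OF infinity_in_exponents])
  fix f and e :: real assume f: "f \<in> Lvar M (\<lambda>_. \<infinity>)" and e: "e > 0"
  note [measurable] = Lvar_measurable[OF f]
  obtain c where c: "c > 0" "modular M (\<lambda>_. \<infinity>) (\<lambda>x. f x / c) \<le> 1"
    using Lvar_norm_set_nonempty[OF infinity_in_exponents f] .
  then have AE: "AE x in M. \<bar>f x / c\<bar> \<le> 1" by (subst (asm) modular_infinity_le_1_iff) auto
  obtain m :: nat where m: "max c (1 / e) < m" using reals_Archimedean2 by blast
  then have m': "c < m" "1 / e < m" by auto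
  have "1 / m \<le> e" using m'(2) e c m'(1) by (simp add: field_simps)
  from AE have "AE x in M. \<bar>(f x - trunc m (f x)) / e\<bar> \<le> 1"
  proof eventually_elim
    case (elim x)
    then have "\<bar>f x\<bar> < m" using c m' by (simp add: abs_divide divide_le_eq)
    then have "\<bar>f x - trunc m (f x)\<bar> \<le> e"
      using \<open>1 / m \<le> e\<close> by (blast intro: order_trans trunc_diff_le)
    then show ?case using e by (simp add: abs_divide)
  qed
  then show "\<exists>m. modular M (\<lambda>_. \<infinity>) (\<lambda>x. (f x - trunc m (f x)) / e) \<le> 1"
    by (intro exI[of _ m]) (subst modular_infinity_le_1_iff, auto)
qed

text \<open>Dominated convergence for the modular at scale e; the majorant built from 2 |f| / e is
  integrable because the exponent is bounded.\<close>

lemma simple_approximable_finite: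
  assumes q: "q \<in> exponents M" and Q: "0 \<le> Q" "AE x in M. q x \<le> ennreal Q"
  shows "simple_approximable M q"
proof (rule simple_approximableI[OF q])
  fix f and e :: real assume f: "f \<in> Lvar M q" and e: "e > 0"
  note [measurable] = Lvar_measurable[OF f]
  have [measurable]: "q \<in> borel_measurable M" using q by (simp add: exponents_def)
  note eq = modular_eq_nn_integral[OF q AE_finite_exponent[OF Q(2)]]
  have "(\<lambda>m. \<integral>\<^sup>+ x. ennreal (\<bar>(f x - trunc m (f x)) / e\<bar> powr enn2real (q x)) \<partial>M) \<longlonglongrightarrow> (\<integral>\<^sup>+ x. 0 \<partial>M)"
  proof (rule nn_integral_dominated_convergence)
    show "(\<integral>\<^sup>+ x. ennreal (\<bar>f x / (e / 2)\<bar> powr enn2real (q x)) \<partial>M) < \<infinity>"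
      using modular_finite[OF q Q f, of "e / 2"] e eq[of "\<lambda>x. f x / (e / 2)"] by simp
    show "AE x in M. ennreal (\<bar>(f x - trunc m (f x)) / e\<bar> powr enn2real (q x)) \<le> ennreal (\<bar>f x / (e / 2)\<bar> powr enn2real (q x))" for m
    proof (intro AE_I2 ennreal_leI powr_mono2)
      fix x
      have "\<bar>f x - trunc m (f x)\<bar> \<le> 2 * \<bar>f x\<bar>" using abs_trunc_le[of m "f x"] by linarith
      then show "\<bar>(f x - trunc m (f x)) / e\<bar> \<le> \<bar>f x / (e / 2)\<bar>"
        using e by (simp add: abs_divide abs_mult divide_right_mono)
    qed auto
    show "AE x in M. (\<lambda>m. ennreal (\<bar>(f x - trunc m (f x)) / e\<bar> powr enn2real (q x))) \<longlonglongrightarrow> 0"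
      using AE_enn2real_bounds[OF q Q(2,1)]
    proof eventually_elim
      case (elim x)
      have "(\<lambda>m. \<bar>(f x - trunc m (f x)) / e\<bar>) \<longlonglongrightarrow> 0"
      proof (rule tendsto_sandwich[of "\<lambda>_. 0" _ _ "\<lambda>m. 1 / real m / e"])
        show "\<forall>\<^sub>F m in sequentially. \<bar>(f x - trunc m (f x)) / e\<bar> \<le> 1 / real m / e"
        proof -
          obtain m0 :: nat where "\<bar>f x\<bar> < m0" using reals_Archimedean2 by blast
          then have "\<bar>f x\<bar> < m" if "m \<ge> m0" for m using that by linarith
          then show ?thesis
            using e by (intro eventually_sequentiallyI[of m0]) (simp only: abs_divide abs_of_pos divide_right_mono trunc_diff_le less_imp_le)
        qed
        show "(\<lambda>m. 1 / real m / e) \<longlonglongrightarrow> 0" using tendsto_divide[OF lim_1_over_n tendsto_const[of e]] e by simp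
      qed auto
      then have "(\<lambda>m. \<bar>(f x - trunc m (f x)) / e\<bar> powr enn2real (q x)) \<longlonglongrightarrow> 0 powr enn2real (q x)"
        using elim by (intro tendsto_powr') auto
      then show ?case using elim by (auto intro!: tendsto_ennrealI[of _ 0, simplified])
    qed
  qed measurable
  then have "(\<lambda>m. modular M q (\<lambda>x. (f x - trunc m (f x)) / e)) \<longlonglongrightarrow> 0"
    by (simp add: eq)
  then have "\<forall>\<^sub>F m in sequentially. modular M q (\<lambda>x. (f x - trunc m (f x)) / e) < 1"
    by (rule order_tendstoD(2)) simp
  then obtain m where "modular M q (\<lambda>x. (f x - trunc m (f x)) / e) < 1"
    using eventually_happens'[OF sequentially_bot] by blast
  then show "\<exists>m. modular M q (\<lambda>x. (f x - trunc m (f x)) / e) \<le> 1" by (auto intro: less_imp_le)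
qed

text \<open>The pieces of a common partition for finitely many simple functions are indexed by the tuple of
  their values, since a definition may not introduce a type variable for the index set.\<close>

definition simple_vv_bound :: "'b measure \<Rightarrow> ('b \<Rightarrow> ennreal) \<Rightarrow> 'a measure \<Rightarrow> ('a \<Rightarrow> ennreal) \<Rightarrow> real \<Rightarrow> real \<Rightarrow> bool" where
  "simple_vv_bound M q N p r K \<longleftrightarrow>
    (\<forall>T n (J :: (nat \<Rightarrow> real) set) A a. bounded_operator M q N p T \<longrightarrow> finite J \<longrightarrow> disjoint_family_on A J \<longrightarrow>
      (\<forall>j\<in>J. A j \<in> sets M \<and> indicator (A j) \<in> Lvar M q) \<longrightarrow>
      Lvar_norm N p (\<lambda>x. lnorm r {1..n} (\<lambda>k. T (\<lambda>y. \<Sum>j\<in>J. a k j * indicator (A j) y) x))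
        \<le> K * operator_norm M q N p T * Lvar_norm M q (\<lambda>y. lnorm r {1..n :: nat} (\<lambda>k. \<Sum>j\<in>J. a k j * indicator (A j) y)))"

text \<open>With n fixed, the errors of the approximants add at most n e times the operator norm,
  and e tends to 0.\<close>

lemma vv_bound_if_simple:
  assumes p: "p \<in> exponents N" and q: "q \<in> exponents M" and r: "1 \<le> r" and K: "0 \<le> K"
    and approx: "simple_approximable M q" and simple: "simple_vv_bound M q N p r K"
  shows "vv_bound M q N p r K"
  unfolding vv_bound_def
proof (intro allI impI)
  fix T and n :: nat and f
  assume T: "bounded_operator M q N p T" and n: "1 \<le> n" and f': "\<forall>k\<in>{1..n}. f k \<in> Lvar M q"
  define S where "S = {1..n}"
  have S: "finite S" and f: "\<And>k. k \<in> S \<Longrightarrow> f k \<in> Lvar M q" using f' by (auto simp: S_def)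
  have nn: "0 \<le> operator_norm M q N p T" by (rule bounded_operator_norm(1)[OF q T])
  define F where "F = Lvar_norm M q (\<lambda>x. lnorm r S (\<lambda>k. f k x))"
  have step: "Lvar_norm N p (\<lambda>x. lnorm r S (\<lambda>k. T (f k) x)) \<le> K * operator_norm M q N p T * F + n * operator_norm M q N p T * e"
    if e: "e > 0" for e
  proof -
    have "\<forall>k\<in>S. \<exists>s. s \<in> borel_measurable M \<and> finite (s ` space M) \<and> (\<forall>x. \<bar>s x\<bar> \<le> \<bar>f k x\<bar>) \<and> Lvar_norm M q (\<lambda>x. f k x - s x) \<le> e"
      using approx f e unfolding simple_approximable_def by blast
    from bchoice[OF this] obtain s where s: "\<And>k. k \<in> S \<Longrightarrow> s k \<in> borel_measurable M"
      "\<And>k. k \<in> S \<Longrightarrow> finite (s k ` space M)" "\<And>k x. k \<in> S \<Longrightarrow> \<bar>s k x\<bar> \<le> \<bar>f k x\<bar>"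
      "\<And>k. k \<in> S \<Longrightarrow> Lvar_norm M q (\<lambda>x. f k x - s k x) \<le> e"
      by blast
    note [measurable] = s(1)
    have sL: "s k \<in> Lvar M q" if "k \<in> S" for k
      using s that by (intro Lvar_mono(1)[OF q f[OF that]]) auto
    define v where "v x = restrict (\<lambda>k. s k x) S" for x
    \<comment> \<open>The cell where all \<open>s k\<close> vanish is left out, since its indicator
      need not lie in \<open>Lvar\<close>. On every other cell some \<open>s k\<close> is a nonzero
      constant, and a multiple of it dominates the indicator.\<close>
    define J where "J = v ` space M - {restrict (\<lambda>_. 0) S}"
    define A where "A j = {x \<in> space M. v x = j}" for j
    have fJ: "finite J"
    proof -
      have "v ` space M \<subseteq> PiE S (\<lambda>k. s k ` space M)" by (auto simp: v_def)
      moreover have "finite (PiE S (\<lambda>k. s k ` space M))" using S s(2) by (intro finite_PiE)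
      ultimately show ?thesis unfolding J_def by (auto intro: finite_subset)
    qed
    have disj: "disjoint_family_on A J" by (auto simp: disjoint_family_on_def A_def)
    have veq: "v x = j \<longleftrightarrow> (\<forall>k\<in>S. s k x = j k)" if "j \<in> J" for x j
      using that by (auto simp: J_def v_def restrict_def fun_eq_iff)
    have Aj: "A j \<in> sets M" if "j \<in> J" for j
    proof -
      have "A j = {x \<in> space M. \<forall>k\<in>S. s k x = j k}" using veq[OF that] by (auto simp: A_def)
      then show ?thesis using S by simp
    qed
    have ind: "indicator (A j) \<in> Lvar M q" if j: "j \<in> J" for j
    proof -
      have "\<exists>k\<in>S. j k \<noteq> 0"
      proof (rule ccontr)
        assume "\<not> (\<exists>k\<in>S. j k \<noteq> 0)"
        then have "j = restrict (\<lambda>_. 0) S" using j by (auto simp: J_def v_def restrict_def fun_eq_iff)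
        then show False using j by (simp add: J_def)
      qed
      then obtain k where k: "k \<in> S" "j k \<noteq> 0" by blast
      show ?thesis
      proof (rule Lvar_mono(1)[OF q Lvar_cmult(1)[OF q sL[OF k(1)], of "1 / j k"]])
        show "(indicator (A j) :: _ \<Rightarrow> real) \<in> borel_measurable M" using Aj[OF j] by simp
        show "AE x in M. \<bar>indicator (A j) x\<bar> \<le> \<bar>1 / j k * s k x\<bar>"
          using veq[OF j] k by (intro AE_I2) (auto simp: A_def split: split_indicator)
      qed
    qed
    have rep: "s k x = (\<Sum>j\<in>J. j k * indicator (A j) x)" if k: "k \<in> S" and x: "x \<in> space M" for k x
    proof (cases "v x \<in> J")
      case True
      have "(\<Sum>j\<in>J. j k * indicator (A j) x) = (\<Sum>j\<in>J. if j = v x then v x k else 0)"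
        using x by (intro sum.cong) (auto simp: A_def)
      also have "\<dots> = v x k" using True fJ by simp
      finally show ?thesis using k by (simp add: v_def)
    next
      case False
      then have "v x = restrict (\<lambda>_. 0) S" using x by (auto simp: J_def)
      then have "s k x = 0" using k by (metis restrict_apply' v_def)
      moreover have "(\<Sum>j\<in>J. j k * indicator (A j) x) = 0"
        using False by (intro sum.neutral) (auto simp: A_def split: split_indicator)
      ultimately show ?thesis by simp
    qed
    define s' where "s' k y = (\<Sum>j\<in>J. j k * indicator (A j) y)" for k y
    have s'L: "s' k \<in> Lvar M q" for k
      unfolding s'_def[abs_def] by (intro Lvar_sum(1)[OF q fJ] Lvar_cmult(1)[OF q] ind)
    have Ts': "AE x in N. \<forall>k\<in>S. T (f k) x = T (s' k) x + T (\<lambda>y. f k y - s k y) x"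
    proof (subst AE_ball_countable, use S in \<open>auto intro: countable_finite\<close>)
      fix k assume k: "k \<in> S"
      have d: "(\<lambda>y. f k y - s k y) \<in> Lvar M q"
        using Lvar_add(1)[OF q f[OF k] Lvar_cmult(1)[OF q sL[OF k], of "-1"]] by simp
      have "AE x in N. T (\<lambda>y. s' k y + (f k y - s k y)) x = T (s' k) x + T (\<lambda>y. f k y - s k y) x"
        by (rule bounded_operator_add[OF T s'L d])
      moreover have "AE x in N. T (\<lambda>y. s' k y + (f k y - s k y)) x = T (f k) x"
      proof -
        have "AE y in M. s' k y + (f k y - s k y) = f k y" using rep[OF k] by (intro AE_I2) (simp add: s'_def)
        then show ?thesis using T Lvar_add(1)[OF q s'L d] f[OF k] by (auto simp: bounded_operator_def)
      qed
      ultimately show "AE x in N. T (f k) x = T (s' k) x + T (\<lambda>y. f k y - s k y) x" by eventually_elim simp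
    qed
    have dL: "(\<lambda>y. f k y - s k y) \<in> Lvar M q" if "k \<in> S" for k
      using Lvar_add(1)[OF q f[OF that] Lvar_cmult(1)[OF q sL[OF that], of "-1"]] by simp
    define H where "H x = lnorm r S (\<lambda>k. T (s' k) x)" for x
    define D where "D x = (\<Sum>k\<in>S. \<bar>T (\<lambda>y. f k y - s k y) x\<bar>)" for x
    have H: "H \<in> Lvar N p" unfolding H_def[abs_def] by (intro lnorm_Lvar[OF p r S] bounded_operator_Lvar[OF T] s'L)
    have D: "D \<in> Lvar N p" unfolding D_def[abs_def] by (intro Lvar_sum(1)[OF p S] Lvar_abs(1)[OF p] bounded_operator_Lvar[OF T] dL)
    have "Lvar_norm N p D \<le> (\<Sum>k\<in>S. Lvar_norm N p (\<lambda>x. \<bar>T (\<lambda>y. f k y - s k y) x\<bar>))"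
      unfolding D_def[abs_def] by (intro Lvar_sum(2)[OF p S] Lvar_abs(1)[OF p] bounded_operator_Lvar[OF T] dL)
    also have "\<dots> \<le> (\<Sum>k\<in>S. operator_norm M q N p T * e)"
    proof (rule sum_mono)
      fix k assume k: "k \<in> S"
      have "Lvar_norm N p (\<lambda>x. \<bar>T (\<lambda>y. f k y - s k y) x\<bar>) \<le> Lvar_norm N p (T (\<lambda>y. f k y - s k y))"
        by (rule Lvar_abs(2)[OF p bounded_operator_Lvar[OF T dL[OF k]]])
      also have "\<dots> \<le> operator_norm M q N p T * Lvar_norm M q (\<lambda>y. f k y - s k y)"
        by (rule bounded_operator_norm(2)[OF q T dL[OF k]])
      also have "\<dots> \<le> operator_norm M q N p T * e" using s(4)[OF k] nn by (rule mult_left_mono)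
      finally show "Lvar_norm N p (\<lambda>x. \<bar>T (\<lambda>y. f k y - s k y) x\<bar>) \<le> operator_norm M q N p T * e" .
    qed
    also have "\<dots> = n * operator_norm M q N p T * e" by (simp add: S_def)
    finally have normD: "Lvar_norm N p D \<le> n * operator_norm M q N p T * e" .
    have "Lvar_norm N p H \<le> K * operator_norm M q N p T * Lvar_norm M q (\<lambda>y. lnorm r S (\<lambda>k. s' k y))"
      using simple[unfolded simple_vv_bound_def, rule_format, OF T fJ disj, of n "\<lambda>k j. j k"] Aj ind
      unfolding H_def[abs_def] s'_def[abs_def] S_def by blast
    also have "\<dots> \<le> K * operator_norm M q N p T * F"
      unfolding F_def
    proof (intro mult_left_mono Lvar_mono(2)[OF q])
      show "(\<lambda>x. lnorm r S (\<lambda>k. f k x)) \<in> Lvar M q" by (rule lnorm_Lvar[OF q r S f])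
      show "(\<lambda>y. lnorm r S (\<lambda>k. s' k y)) \<in> borel_measurable M"
        by (rule Lvar_measurable[OF lnorm_Lvar[OF q r S s'L]])
      show "AE y in M. \<bar>lnorm r S (\<lambda>k. s' k y)\<bar> \<le> \<bar>lnorm r S (\<lambda>k. f k y)\<bar>"
      proof (rule AE_I2)
        fix y assume y: "y \<in> space M"
        have "lnorm r S (\<lambda>k. s' k y) \<le> lnorm r S (\<lambda>k. f k y)"
        proof (rule lnorm_mono)
          fix k assume k: "k \<in> S"
          show "\<bar>s' k y\<bar> \<le> \<bar>f k y\<bar>" using s(3)[OF k, of y] by (simp only: s'_def rep[OF k y])
        qed (use r in simp)
        then show "\<bar>lnorm r S (\<lambda>k. s' k y)\<bar> \<le> \<bar>lnorm r S (\<lambda>k. f k y)\<bar>" by simp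
      qed
    qed (use K nn in auto)
    finally have normH: "Lvar_norm N p H \<le> K * operator_norm M q N p T * F" .
    have "Lvar_norm N p (\<lambda>x. lnorm r S (\<lambda>k. T (f k) x)) \<le> Lvar_norm N p (\<lambda>x. H x + D x)"
    proof (rule Lvar_mono(2)[OF p Lvar_add(1)[OF p H D]])
      show "(\<lambda>x. lnorm r S (\<lambda>k. T (f k) x)) \<in> borel_measurable N"
        by (intro Lvar_measurable[OF lnorm_Lvar[OF p r S]] bounded_operator_Lvar[OF T] f)
      show "AE x in N. \<bar>lnorm r S (\<lambda>k. T (f k) x)\<bar> \<le> \<bar>H x + D x\<bar>"
        using Ts'
      proof eventually_elim
        case (elim x)
        have "lnorm r S (\<lambda>k. T (f k) x) = lnorm r S (\<lambda>k. T (s' k) x + T (\<lambda>y. f k y - s k y) x)"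
          using elim by (intro lnorm_cong) simp
        also have "\<dots> \<le> H x + lnorm r S (\<lambda>k. T (\<lambda>y. f k y - s k y) x)"
          unfolding H_def by (rule lnorm_triangle[OF r S])
        also have "\<dots> \<le> H x + D x" unfolding D_def by (intro add_left_mono lnorm_le_sum[OF r S])
        finally show ?case using lnorm_nonneg[of r S "\<lambda>k. T (f k) x"] by linarith
      qed
    qed
    also have "\<dots> \<le> Lvar_norm N p H + Lvar_norm N p D" by (rule Lvar_add(2)[OF p H D])
    finally show ?thesis using normH normD by linarith
  qed
  have "Lvar_norm N p (\<lambda>x. lnorm r S (\<lambda>k. T (f k) x)) - K * operator_norm M q N p T * F \<le> n * operator_norm M q N p T * 0"
  proof (rule le_mult_of_greater)
    fix e :: real assume "e > 0"
    from step[OF this] show "Lvar_norm N p (\<lambda>x. lnorm r S (\<lambda>k. T (f k) x)) - K * operator_norm M q N p T * F \<le> n * operator_norm M q N p T * e"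
      by linarith
  qed (use nn in simp)
  then show "Lvar_norm N p (\<lambda>x. lnorm r {1..n} (\<lambda>k. T (f k) x)) \<le> K * operator_norm M q N p T * Lvar_norm M q (\<lambda>x. lnorm r {1..n} (\<lambda>k. f k x))"
    by (simp add: F_def S_def)
qed

section \<open>Operators on L^1\<close>

lemma sum_indicator_disjoint:
  fixes g :: "'j \<Rightarrow> real"
  assumes J: "finite J" "disjoint_family_on A J" and j: "j \<in> J" "y \<in> A j"
  shows "(\<Sum>i\<in>J. g i * indicator (A i) y) = g j"
proof -
  have "y \<notin> A i" if "i \<in> J" "i \<noteq> j" for i
    using J(2) j that unfolding disjoint_family_on_def by blast
  then have "(\<Sum>i\<in>J. g i * indicator (A i) y) = (\<Sum>i\<in>J. if i = j then g j else 0)"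
    using j by (intro sum.cong) auto
  also have "\<dots> = g j" using J j by simp
  finally show ?thesis .
qed

lemma lnorm_sum_indicator_disjoint:
  assumes J: "finite J" "disjoint_family_on A J"
  shows "lnorm r S (\<lambda>k. \<Sum>j\<in>J. a k j * indicator (A j) y) = (\<Sum>j\<in>J. lnorm r S (\<lambda>k. a k j) * indicator (A j) y)"
proof (cases "\<exists>j\<in>J. y \<in> A j")
  case True
  then obtain j where j: "j \<in> J" "y \<in> A j" by blast
  show ?thesis by (simp only: sum_indicator_disjoint[OF J j])
next
  case False
  then have "(\<Sum>j\<in>J. g j * indicator (A j) y) = 0" for g :: "_ \<Rightarrow> real"
    by (intro sum.neutral) auto
  then show ?thesis by (simp add: lnorm_def)
qed

lemma one_in_exponents: "(\<lambda>_. 1) \<in> exponents M"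
  by (simp add: exponents_def)

lemma modular_one:
  assumes "f \<in> borel_measurable M"
  shows "modular M (\<lambda>_. 1) f = (\<integral>\<^sup>+ x. ennreal \<bar>f x\<bar> \<partial>M)"
  using assms by (subst modular_eq_nn_integral[OF one_in_exponents]) auto

text \<open>In L^1 the norm of \<Sum> Fj 1_{A j} is exactly \<Sum> Fj \<mu>(A j). On the target side
  Minkowski and the operator bound for each single indicator give the same sum times the operator
  norm.\<close>

lemma simple_vv_bound_L1:
  assumes p: "p \<in> exponents N" and r: "1 \<le> r"
  shows "simple_vv_bound M (\<lambda>_. 1) N p r 1"
  unfolding simple_vv_bound_def
proof (intro allI impI)
  fix T and n :: nat and J :: "(nat \<Rightarrow> real) set" and A :: "(nat \<Rightarrow> real) \<Rightarrow> 'b set" and a :: "nat \<Rightarrow> (nat \<Rightarrow> real) \<Rightarrow> real"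
  assume T: "bounded_operator M (\<lambda>_. 1) N p T" and J: "finite J" "disjoint_family_on A J"
    and A': "\<forall>j\<in>J. A j \<in> sets M \<and> indicator (A j) \<in> Lvar M (\<lambda>_. 1)"
  then have A: "\<And>j. j \<in> J \<Longrightarrow> A j \<in> sets M" and ind: "\<And>j. j \<in> J \<Longrightarrow> indicator (A j) \<in> Lvar M (\<lambda>_. 1)" by auto
  note [measurable] = A
  note q = one_in_exponents
  define S where "S = {1..n}"
  have S: "finite S" by (simp add: S_def)
  define opn where "opn = operator_norm M (\<lambda>_. 1) N p T"
  have nn: "0 \<le> opn" unfolding opn_def by (rule bounded_operator_norm(1)[OF q T])
  define Fj where "Fj j = lnorm r S (\<lambda>k. a k j)" for j
  have Fj0: "0 \<le> Fj j" for j by (simp add: Fj_def)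
  define x where "x j = T (indicator (A j))" for j
  have x: "x j \<in> Lvar N p" if "j \<in> J" for j
    unfolding x_def by (rule bounded_operator_Lvar[OF T ind[OF that]])
  have fL: "(\<lambda>y. \<Sum>j\<in>J. a k j * indicator (A j) y) \<in> Lvar M (\<lambda>_. 1)" for k
    by (intro Lvar_sum(1)[OF q J(1)] Lvar_cmult(1)[OF q] ind)
  have AE: "AE z in N. \<forall>k\<in>S. T (\<lambda>y. \<Sum>j\<in>J. a k j * indicator (A j) y) z = (\<Sum>j\<in>J. a k j * x j z)"
    unfolding x_def by (subst AE_ball_countable) (use S in \<open>auto intro!: bounded_operator_sum[OF q T J(1) ind] countable_finite\<close>)
  define F where "F = (\<lambda>y. \<Sum>j\<in>J. Fj j * indicator (A j) y)"
  have F: "F = (\<lambda>y. lnorm r S (\<lambda>k. \<Sum>j\<in>J. a k j * indicator (A j) y))"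
    unfolding F_def Fj_def by (intro ext lnorm_sum_indicator_disjoint[OF J, symmetric])
  have FL: "F \<in> Lvar M (\<lambda>_. 1)" unfolding F by (intro lnorm_Lvar[OF q r S] fL)
  have FjL: "(\<lambda>z. Fj j * \<bar>x j z\<bar>) \<in> Lvar N p" if "j \<in> J" for j
    by (intro Lvar_cmult(1)[OF p] Lvar_abs(1)[OF p] x that)
  have "Lvar_norm N p (\<lambda>z. lnorm r S (\<lambda>k. T (\<lambda>y. \<Sum>j\<in>J. a k j * indicator (A j) y) z)) \<le> Lvar_norm N p (\<lambda>z. \<Sum>j\<in>J. Fj j * \<bar>x j z\<bar>)"
  proof (rule Lvar_mono(2)[OF p])
    show "(\<lambda>z. \<Sum>j\<in>J. Fj j * \<bar>x j z\<bar>) \<in> Lvar N p" by (intro Lvar_sum(1)[OF p J(1)] FjL)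
    show "(\<lambda>z. lnorm r S (\<lambda>k. T (\<lambda>y. \<Sum>j\<in>J. a k j * indicator (A j) y) z)) \<in> borel_measurable N"
      by (intro Lvar_measurable[OF lnorm_Lvar[OF p r S]] bounded_operator_Lvar[OF T] fL)
    show "AE z in N. \<bar>lnorm r S (\<lambda>k. T (\<lambda>y. \<Sum>j\<in>J. a k j * indicator (A j) y) z)\<bar> \<le> \<bar>\<Sum>j\<in>J. Fj j * \<bar>x j z\<bar>\<bar>"
      using AE
    proof eventually_elim
      case (elim z)
      have "lnorm r S (\<lambda>k. T (\<lambda>y. \<Sum>j\<in>J. a k j * indicator (A j) y) z) = lnorm r S (\<lambda>k. \<Sum>j\<in>J. a k j * x j z)"
        using elim by (intro lnorm_cong) simp
      also have "\<dots> \<le> (\<Sum>j\<in>J. lnorm r S (\<lambda>k. a k j * x j z))" by (rule lnorm_sum[OF r S J(1)])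
      also have "\<dots> = (\<Sum>j\<in>J. Fj j * \<bar>x j z\<bar>)"
      proof (intro sum.cong refl)
        fix j show "lnorm r S (\<lambda>k. a k j * x j z) = Fj j * \<bar>x j z\<bar>"
          using lnorm_cmult[of r S "x j z" "\<lambda>k. a k j"] r by (simp add: Fj_def mult.commute)
      qed
      finally show ?case using lnorm_nonneg[of r S] by (simp add: abs_le_iff)
    qed
  qed
  also have "\<dots> \<le> (\<Sum>j\<in>J. Lvar_norm N p (\<lambda>z. Fj j * \<bar>x j z\<bar>))" by (rule Lvar_sum(2)[OF p J(1) FjL])
  also have "\<dots> \<le> (\<Sum>j\<in>J. Fj j * (opn * measure M (A j)))"
  proof (rule sum_mono)
    fix j assume j: "j \<in> J"
    have ind_le: "Lvar_norm M (\<lambda>_. 1) (indicator (A j)) \<le> measure M (A j)"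
    proof (rule Lvar_norm_leI)
      obtain d where d: "d > 0" "modular M (\<lambda>_. 1) (\<lambda>y. indicator (A j) y / d) \<le> 1"
        using Lvar_norm_set_nonempty[OF q ind[OF j]] .
      have mod: "modular M (\<lambda>_. 1) (\<lambda>y. indicator (A j) y / c) = ennreal (1 / c) * emeasure M (A j)" if "c > 0" for c
      proof -
        have "modular M (\<lambda>_. 1) (\<lambda>y. indicator (A j) y / c) = (\<integral>\<^sup>+ y. ennreal (1 / c) * indicator (A j) y \<partial>M)"
          using that A[OF j] by (subst modular_one) (auto intro!: nn_integral_cong split: split_indicator)
        then show ?thesis using A[OF j] by (simp add: nn_integral_cmult)
      qed
      \<comment> \<open>For a cell of infinite measure the real-valued \<open>measure\<close> would
        be 0 by convention; that its indicator lies in \<open>Lvar\<close> rules this out.\<close>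
      have "emeasure M (A j) < \<infinity>"
      proof (rule ccontr)
        assume "\<not> emeasure M (A j) < \<infinity>"
        then have "emeasure M (A j) = \<infinity>" by (simp add: not_less top_unique)
        then show False using d mod[OF d(1)] by (simp add: ennreal_mult_top top_unique)
      qed
      then have e: "emeasure M (A j) = ennreal (measure M (A j))" by (intro emeasure_eq_ennreal_measure) auto
      fix c assume c: "measure M (A j) < c" "0 < c"
      show "modular M (\<lambda>_. 1) (\<lambda>y. indicator (A j) y / c) \<le> 1"
        unfolding mod[OF c(2)] e using c by (simp flip: ennreal_mult')
    qed simp
    have "Lvar_norm N p (\<lambda>z. Fj j * \<bar>x j z\<bar>) \<le> \<bar>Fj j\<bar> * Lvar_norm N p (\<lambda>z. \<bar>x j z\<bar>)"
      by (intro Lvar_cmult(2)[OF p] Lvar_abs(1)[OF p] x j)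
    also have "\<dots> \<le> Fj j * Lvar_norm N p (x j)"
      using Fj0 Lvar_abs(2)[OF p x[OF j]] by (simp add: mult_left_mono)
    also have "\<dots> \<le> Fj j * (opn * Lvar_norm M (\<lambda>_. 1) (indicator (A j)))"
      unfolding x_def opn_def using Fj0 by (intro mult_left_mono bounded_operator_norm(2)[OF q T] ind j) 
    also have "\<dots> \<le> Fj j * (opn * measure M (A j))"
      using Fj0 nn ind_le by (intro mult_left_mono)
    finally show "Lvar_norm N p (\<lambda>z. Fj j * \<bar>x j z\<bar>) \<le> Fj j * (opn * measure M (A j))" .
  qed
  also have "\<dots> = opn * (\<Sum>j\<in>J. Fj j * measure M (A j))" by (simp add: sum_distrib_left mult.left_commute)
  also have "\<dots> \<le> opn * Lvar_norm M (\<lambda>_. 1) F"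
  proof (rule mult_left_mono[OF dense_ge nn])
    fix c assume c: "Lvar_norm M (\<lambda>_. 1) F < c"
    then have c0: "c > 0" using Lvar_norm_nonneg[OF q FL] by simp
    have "ennreal ((\<Sum>j\<in>J. Fj j * measure M (A j)) / c) = (\<Sum>j\<in>J. ennreal (Fj j / c) * ennreal (measure M (A j)))"
      using Fj0 c0 by (simp add: sum_divide_distrib sum_ennreal flip: ennreal_mult')
    also have "\<dots> \<le> (\<Sum>j\<in>J. ennreal (Fj j / c) * emeasure M (A j))"
      by (intro sum_mono mult_left_mono) (auto simp: measure_def ennreal_enn2real_if)
    also have "\<dots> = (\<integral>\<^sup>+ y. (\<Sum>j\<in>J. ennreal (Fj j / c) * indicator (A j) y) \<partial>M)"
      by (subst nn_integral_sum) (auto simp: nn_integral_cmult_indicator)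
    also have "\<dots> = (\<integral>\<^sup>+ y. ennreal \<bar>F y / c\<bar> \<partial>M)"
    proof (rule nn_integral_cong)
      fix y
      have "(\<Sum>j\<in>J. ennreal (Fj j / c) * indicator (A j) y) = (\<Sum>j\<in>J. ennreal (Fj j / c * indicator (A j) y))"
        by (intro sum.cong) (auto split: split_indicator)
      also have "\<dots> = ennreal (\<Sum>j\<in>J. Fj j / c * indicator (A j) y)" using Fj0 c0 by (intro sum_ennreal) auto
      also have "(\<Sum>j\<in>J. Fj j / c * indicator (A j) y) = \<bar>F y / c\<bar>"
        using Fj0 c0 by (simp add: F_def sum_divide_distrib sum_nonneg abs_of_nonneg)
      finally show "(\<Sum>j\<in>J. ennreal (Fj j / c) * indicator (A j) y) = ennreal \<bar>F y / c\<bar>" .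
    qed
    also have "\<dots> = modular M (\<lambda>_. 1) (\<lambda>y. F y / c)"
      using Lvar_measurable[OF FL] by (subst modular_one) auto
    also have "\<dots> \<le> 1" by (rule modular_le_1[OF q FL c])
    finally have "(\<Sum>j\<in>J. Fj j * measure M (A j)) / c \<le> 1" by simp
    then show "(\<Sum>j\<in>J. Fj j * measure M (A j)) \<le> c" using c0 by (simp add: divide_le_eq)
  qed
  finally show "Lvar_norm N p (\<lambda>x. lnorm r {1..n} (\<lambda>k. T (\<lambda>y. \<Sum>j\<in>J. a k j * indicator (A j) y) x))
      \<le> 1 * operator_norm M (\<lambda>_. 1) N p T * Lvar_norm M (\<lambda>_. 1) (\<lambda>y. lnorm r {1..n} (\<lambda>k. \<Sum>j\<in>J. a k j * indicator (A j) y))"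
    by (simp add: F S_def opn_def)
qed

section \<open>Randomisation in the target\<close>

lemma Young_conjugate:
  fixes P :: real
  assumes "1 < P" "0 \<le> a" "0 \<le> b"
  shows "a * b \<le> a powr (P / (P - 1)) + b powr P"
proof -
  have 1: "1 < P / (P - 1)" using assms by simp
  have "1 / (P / (P - 1)) + 1 / P = (P - 1 + 1) / P" by (simp only: add_divide_distrib) simp
  then have "1 / (P / (P - 1)) + 1 / P = 1" using assms by simp
  from Youngs_inequality[OF 1 assms(1) this assms(2,3)]
  have "a * b \<le> a powr (P / (P - 1)) / (P / (P - 1)) + b powr P / P" .
  \<comment> \<open>Dropping the factors 1 / P and 1 / P' leaves no coefficients that would vary
    with the point.\<close>
  also have "\<dots> \<le> a powr (P / (P - 1)) + b powr P"
  proof -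
    have "u / v \<le> u" if "0 \<le> u" "1 < v" for u v :: real
      using that by (simp add: divide_le_eq mult_le_cancel_left1)
    from this[of _ "P / (P - 1)"] this[of _ P] show ?thesis using 1 assms(1) by (intro add_mono) auto
  qed
  finally show ?thesis .
qed

text \<open>Randomisation in the target, by duality: with \<open>g\<^sub>k\<close> norming \<open>(T f\<^sub>k)\<^sub>k\<close>, a stable system for the
  conjugate exponent is applied to the numbers \<open>\<integral> g\<^sub>k T 1\<^bsub>A\<^sub>j\<^esub>\<close>. This replaces the adjoint of \<open>T\<close>, so that
  no representation of the dual space is needed.\<close>

lemma simple_vv_bound_target:
  assumes p: "p \<in> exponents N" and P1: "1 < P1" "P1 \<le> P2" and pb: "AE x in N. ennreal P1 \<le> p x \<and> p x \<le> ennreal P2"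
    and q: "q \<in> exponents M" and r: "2 \<le> r" "r < P1 \<or> r = 2"
  shows "\<exists>K\<ge>0. simple_vv_bound M q N p r K"
proof -
  \<comment> \<open>The conjugate of \<open>P x\<close> is at most t0, the conjugate of P1, and r <
    P1 becomes t0 < r': moments of order t0 exist for a stable system of index r'.\<close>
  define r' where "r' = r / (r - 1)"
  define t0 where "t0 = P1 / (P1 - 1)"
  have r': "1 < r'" "r' \<le> 2" "1 / r + 1 / r' = 1" "r' = 2 \<longleftrightarrow> r = 2"
    using r(1) by (auto simp: r'_def field_simps)
  have t0: "0 < t0" using P1 by (simp add: t0_def)
  have t0': "t0 < r' \<or> r' = 2" using r P1 r'(4) by (auto simp: t0_def r'_def field_simps)
  from stable_system_exists[where 'i = nat, OF r'(1,2) t0 t0'] obtain c C where c: "c > 0" and C: "C \<ge> 1"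
    and sys: "\<And>S :: nat set. finite S \<Longrightarrow> \<exists>(\<Omega> :: ((nat \<Rightarrow> nat) \<times> nat set) set) \<theta>. finite \<Omega> \<and> \<Omega> \<noteq> {} \<and>
      (\<forall>a. c * lnorm r' S a \<le> avg \<Omega> (\<lambda>\<omega>. \<bar>\<Sum>k\<in>S. a k * \<theta> k \<omega>\<bar>)) \<and>
      (\<forall>a. avg \<Omega> (\<lambda>\<omega>. \<bar>\<Sum>k\<in>S. a k * \<theta> k \<omega>\<bar> powr t0) \<le> C * lnorm r' S a powr t0)"
    by blast
  \<comment> \<open>Chosen so that c \<Lambda> = 2 + C. The final estimate then reads (2 + C) Ar <=
    1 + (1 + C) Ar, that is, Ar <= 1.\<close>
  define \<Lambda> where "\<Lambda> = (2 + C) / c"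
  have \<Lambda>: "\<Lambda> > 0" using c C by (simp add: \<Lambda>_def)
  define P where "P x = enn2real (p x)" for x
  have [measurable]: "p \<in> borel_measurable N" using p by (simp add: exponents_def)
  have [measurable]: "P \<in> borel_measurable N" unfolding P_def by measurable
  have Pb: "AE x in N. P1 \<le> P x \<and> P x \<le> P2"
    using pb by eventually_elim (use P1 enn2real_bounds in \<open>auto simp: P_def\<close>)
  have P2: "AE x in N. p x \<le> ennreal P2" using pb by eventually_elim simp
  have P20: "0 \<le> P2" using P1 by simp
  note mod_eq = modular_eq_nn_integral[OF p AE_finite_exponent[OF P2], folded P_def]
  have P'b: "AE x in N. 0 < P x / (P x - 1) \<and> P x / (P x - 1) \<le> t0"
    using Pb
  proof eventually_elim
    case (elim x)
    have "P x / (P x - 1) = 1 + 1 / (P x - 1)" using elim P1 by (simp add: field_simps)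
    also have "\<dots> \<le> 1 + 1 / (P1 - 1)" using elim P1 by (intro add_left_mono divide_left_mono) auto
    also have "\<dots> = t0" using P1 by (simp add: t0_def field_simps)
    finally show ?case using elim P1 by simp
  qed
  have "simple_vv_bound M q N p r \<Lambda>"
    unfolding simple_vv_bound_def
  proof (intro allI impI)
    fix T and n :: nat and J :: "(nat \<Rightarrow> real) set" and A :: "(nat \<Rightarrow> real) \<Rightarrow> 'b set" and a :: "nat \<Rightarrow> (nat \<Rightarrow> real) \<Rightarrow> real"
    assume T: "bounded_operator M q N p T" and J: "finite J" "disjoint_family_on A J"
      and A': "\<forall>j\<in>J. A j \<in> sets M \<and> indicator (A j) \<in> Lvar M q"
    then have A: "\<And>j. j \<in> J \<Longrightarrow> A j \<in> sets M" and ind: "\<And>j. j \<in> J \<Longrightarrow> indicator (A j) \<in> Lvar M q" by auto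
    define S where "S = {1..n}"
    have S: "finite S" by (simp add: S_def)
    obtain \<Omega> :: "((nat \<Rightarrow> nat) \<times> nat set) set" and \<theta> where \<Omega>: "finite \<Omega>" "\<Omega> \<noteq> {}"
      and lower: "\<And>a. c * lnorm r' S a \<le> avg \<Omega> (\<lambda>\<omega>. \<bar>\<Sum>k\<in>S. a k * \<theta> k \<omega>\<bar>)"
      and upper: "\<And>a. avg \<Omega> (\<lambda>\<omega>. \<bar>\<Sum>k\<in>S. a k * \<theta> k \<omega>\<bar> powr t0) \<le> C * lnorm r' S a powr t0"
      using sys[OF S] by blast
    have card: "real (card \<Omega>) > 0" using \<Omega> by (simp add: card_gt_0_iff)
    define opn where "opn = operator_norm M q N p T"
    have nn: "0 \<le> opn" unfolding opn_def by (rule bounded_operator_norm(1)[OF q T])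
    define Fj where "Fj j = lnorm r S (\<lambda>k. a k j)" for j
    have Fj0: "0 \<le> Fj j" for j by (simp add: Fj_def)
    define x where "x j = T (indicator (A j))" for j
    have x: "x j \<in> Lvar N p" if "j \<in> J" for j
      unfolding x_def by (rule bounded_operator_Lvar[OF T ind[OF that]])
    define f where "f k = (\<lambda>y. \<Sum>j\<in>J. a k j * indicator (A j) y)" for k
    have fL: "f k \<in> Lvar M q" for k
      unfolding f_def by (intro Lvar_sum(1)[OF q J(1)] Lvar_cmult(1)[OF q] ind)
    have Tf: "AE z in N. \<forall>k\<in>S. T (f k) z = (\<Sum>j\<in>J. a k j * x j z)"
      unfolding x_def f_def by (subst AE_ball_countable) (use S in \<open>auto intro!: bounded_operator_sum[OF q T J(1) ind] countable_finite\<close>)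
    define F where "F y = lnorm r S (\<lambda>k. f k y)" for y
    have F: "F y = (\<Sum>j\<in>J. Fj j * indicator (A j) y)" for y
      unfolding F_def Fj_def f_def by (rule lnorm_sum_indicator_disjoint[OF J])
    have FL: "F \<in> Lvar M q" unfolding F_def[abs_def] using r by (intro lnorm_Lvar[OF q _ S] fL) auto
    define G where "G z = lnorm r S (\<lambda>k. T (f k) z)" for z
    have GL: "G \<in> Lvar N p" unfolding G_def[abs_def] using r by (intro lnorm_Lvar[OF p _ S] bounded_operator_Lvar[OF T] fL) auto
    have G0: "0 \<le> G z" for z by (simp add: G_def)
    note [measurable] = Lvar_measurable[OF GL] Lvar_measurable[OF bounded_operator_Lvar[OF T fL]]
    have [measurable]: "x j \<in> borel_measurable N" if "j \<in> J" for j using x[OF that] by (rule Lvar_measurable)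
    have "Lvar_norm N p G \<le> \<Lambda> * (opn * Lvar_norm M q F)"
    proof (rule le_mult_of_greater)
      fix B assume B: "opn * Lvar_norm M q F < B"
      then have B0: "B > 0" using nn Lvar_norm_nonneg[OF q FL] mult_nonneg_nonneg[of opn "Lvar_norm M q F"] by linarith
      define L where "L = B * \<Lambda>"
      have L: "L > 0" using B0 \<Lambda> by (simp add: L_def)
      define U where "U z = (G z / L) powr P z" for z
      \<comment> \<open>The norming family for l^r at each point, weighted by a power of G / L: the
        pairing with \<open>T (f k) z / L\<close> and the conjugate power of the l^r' norm of
        \<open>g\<close> are both equal to \<open>U\<close>.\<close>
      define g where "g k z = (G z / L) powr (P z - r) * \<bar>T (f k) z / L\<bar> powr (r - 1) * sgn (T (f k) z)" for k z
      have [measurable]: "U \<in> borel_measurable N" "g k \<in> borel_measurable N" for k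
        unfolding U_def g_def by measurable
      have U0: "0 \<le> U z" for z by (simp add: U_def)
      \<comment> \<open>The aim is Ar <= 1, which bounds the norm of \<open>G\<close> by
        \<open>L\<close>. Finiteness of the modular, due to the bounded exponent, permits absorbing
        Ar on the left at the end.\<close>
      define Ar where "Ar = enn2real (modular N p (\<lambda>z. G z / L))"
      have fin: "modular N p (\<lambda>z. G z / L) < \<infinity>" by (rule modular_finite[OF p P20 P2 GL L])
      have Ar: "modular N p (\<lambda>z. G z / L) = ennreal Ar" "0 \<le> Ar" using fin by (simp_all add: Ar_def)
      have modU: "(\<integral>\<^sup>+ z. ennreal (U z) \<partial>N) = ennreal Ar"
        using L G0 unfolding Ar(1)[symmetric] by (subst mod_eq) (auto simp: U_def abs_divide)
      have Uint: "integrable N U" "integral\<^sup>L N U = Ar"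
      proof -
        show "integrable N U" using modU by (intro integrableI_nonneg) (auto simp: U0)
        show "integral\<^sup>L N U = Ar" using modU Ar(2) by (subst integral_eq_nn_integral) (auto simp: U0)
      qed
      have sum_r: "(\<Sum>k\<in>S. \<bar>T (f k) z / L\<bar> powr r) = (G z / L) powr r" for z
        using lnorm_cmult[of r S "1 / L" "\<lambda>k. T (f k) z"] L r(1) lnorm_powr[of r S "\<lambda>k. T (f k) z / L"]
        by (simp add: G_def)
      have gh: "(\<Sum>k\<in>S. g k z * (T (f k) z / L)) = U z" if "P z > 0" for z
      proof -
        have "g k z * (T (f k) z / L) = (G z / L) powr (P z - r) * \<bar>T (f k) z / L\<bar> powr r" for k
        proof -
          have e1: "sgn (T (f k) z) * (T (f k) z / L) = \<bar>T (f k) z / L\<bar>"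
            using L by (simp add: abs_divide sgn_mult_self_eq flip: abs_sgn) (simp add: abs_sgn mult.commute)
          have e2: "\<bar>T (f k) z / L\<bar> powr (r - 1) * \<bar>T (f k) z / L\<bar> = \<bar>T (f k) z / L\<bar> powr r"
            by (cases "T (f k) z / L = 0") (auto simp: powr_diff)
          show ?thesis by (simp only: g_def mult.assoc e1 e2)
        qed
        then have "(\<Sum>k\<in>S. g k z * (T (f k) z / L)) = (G z / L) powr (P z - r) * (\<Sum>k\<in>S. \<bar>T (f k) z / L\<bar> powr r)"
          by (simp only: sum_distrib_left)
        also have "\<dots> = U z" unfolding sum_r U_def by (simp flip: powr_add)
        finally show ?thesis .
      qed
      have gnorm: "lnorm r' S (\<lambda>k. g k z) = (G z / L) powr (P z - 1)" for z
      proof -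
        have e1: "(r - 1) * r' = r" using r(1) by (simp add: r'_def)
        have "\<bar>g k z\<bar> powr r' = (G z / L) powr ((P z - r) * r') * \<bar>T (f k) z / L\<bar> powr r" for k
        proof (cases "T (f k) z = 0")
          case False
          then have "\<bar>g k z\<bar> = (G z / L) powr (P z - r) * \<bar>T (f k) z / L\<bar> powr (r - 1)"
            by (simp add: g_def abs_mult abs_sgn_eq)
          then show ?thesis by (simp add: powr_mult powr_powr e1)
        qed (simp add: g_def)
        then have "(\<Sum>k\<in>S. \<bar>g k z\<bar> powr r') = (G z / L) powr ((P z - r) * r') * (G z / L) powr r"
          by (simp only: sum_r flip: sum_distrib_left)
        also have "\<dots> = (G z / L) powr ((P z - r) * r' + r)" by (simp add: powr_add)
        finally have "lnorm r' S (\<lambda>k. g k z) = (G z / L) powr (((P z - r) * r' + r) * (1 / r'))"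
          by (simp add: lnorm_def powr_powr)
        also have "((P z - r) * r' + r) * (1 / r') = P z - r + r / r'" using r'(1) by (simp add: field_simps)
        also have "r / r' = r - 1" using r(1) by (simp add: r'_def)
        finally show ?thesis by simp
      qed
      have gU: "lnorm r' S (\<lambda>k. g k z) powr (P z / (P z - 1)) = U z" if "P z > 1" for z
        unfolding gnorm U_def using that by (simp add: powr_powr)
      \<comment> \<open>Young's inequality bounds the product by \<open>U\<close> plus the P-th
        power of |x j|, both integrable.\<close>
      have gx: "integrable N (\<lambda>z. g k z * x j z)" if k: "k \<in> S" and j: "j \<in> J" for k j
      proof (rule Bochner_Integration.integrable_bound)
        define V where "V z = \<bar>x j z\<bar> powr P z" for z
        have [measurable]: "V \<in> borel_measurable N" unfolding V_def using j by measurable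
        have "(\<integral>\<^sup>+ z. ennreal (V z) \<partial>N) < \<infinity>"
          using modular_finite[OF p P20 P2 x[OF j], of 1] mod_eq[of "x j"] j by (simp add: V_def)
        then have "integrable N V" by (intro integrableI_nonneg) (auto simp: V_def)
        then show "integrable N (\<lambda>z. U z + V z)" using Uint by simp
        show "(\<lambda>z. g k z * x j z) \<in> borel_measurable N" using j by measurable
        show "AE z in N. norm (g k z * x j z) \<le> norm (U z + V z)"
          using Pb
        proof eventually_elim
          case (elim z)
          then have Pz: "P z > 1" using P1 by simp
          have "\<bar>g k z * x j z\<bar> \<le> \<bar>g k z\<bar> powr (P z / (P z - 1)) + \<bar>x j z\<bar> powr P z"
            unfolding abs_mult by (intro Young_conjugate Pz) auto
          also have "\<bar>g k z\<bar> powr (P z / (P z - 1)) \<le> lnorm r' S (\<lambda>k. g k z) powr (P z / (P z - 1))"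
            using Pz r'(1) S k by (intro powr_mono2 abs_le_lnorm) auto
          also have "\<dots> = U z" by (rule gU[OF Pz])
          finally show ?case using U0[of z] by (simp add: V_def)
        qed
      qed
      define \<tau> where "\<tau> k j = (\<integral>z. g k z * x j z \<partial>N)" for k j
      have LAr: "L * Ar = (\<Sum>j\<in>J. \<Sum>k\<in>S. a k j * \<tau> k j)"
      proof -
        have "L * Ar = (\<integral>z. L * U z \<partial>N)" using Uint by simp
        also have "\<dots> = (\<integral>z. (\<Sum>j\<in>J. \<Sum>k\<in>S. a k j * (g k z * x j z)) \<partial>N)"
        proof (rule integral_cong_AE)
          show "AE z in N. L * U z = (\<Sum>j\<in>J. \<Sum>k\<in>S. a k j * (g k z * x j z))"
            using Pb Tf
          proof eventually_elim
            case (elim z)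
            have "(\<Sum>k\<in>S. g k z * T (f k) z) / L = U z"
              using gh[of z] P1 elim(1) by (simp add: sum_divide_distrib)
            then have "L * U z = (\<Sum>k\<in>S. g k z * T (f k) z)"
              using L by (metis less_numeral_extra(3) mult.commute nonzero_eq_divide_eq)
            also have "\<dots> = (\<Sum>k\<in>S. \<Sum>j\<in>J. a k j * (g k z * x j z))"
              using elim by (intro sum.cong) (auto simp: sum_distrib_left mult_ac)
            finally show ?case by (subst sum.swap)
          qed
        qed measurable
        also have "\<dots> = (\<Sum>j\<in>J. \<integral>z. (\<Sum>k\<in>S. a k j * (g k z * x j z)) \<partial>N)"
          by (rule Bochner_Integration.integral_sum)
            (intro Bochner_Integration.integrable_sum integrable_mult_right gx; assumption)
        also have "\<dots> = (\<Sum>j\<in>J. \<Sum>k\<in>S. a k j * \<tau> k j)"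
        proof (intro sum.cong refl)
          fix j assume j: "j \<in> J"
          have "(\<integral>z. (\<Sum>k\<in>S. a k j * (g k z * x j z)) \<partial>N) = (\<Sum>k\<in>S. \<integral>z. a k j * (g k z * x j z) \<partial>N)"
            by (rule Bochner_Integration.integral_sum) (intro integrable_mult_right gx j)
          then show "(\<integral>z. (\<Sum>k\<in>S. a k j * (g k z * x j z)) \<partial>N) = (\<Sum>k\<in>S. a k j * \<tau> k j)"
            by (simp add: \<tau>_def)
        qed
        finally show ?thesis .
      qed
      define R where "R \<omega> = (\<integral>\<^sup>+ z. ennreal (\<bar>\<Sum>k\<in>S. g k z * \<theta> k \<omega>\<bar> powr (P z / (P z - 1))) \<partial>N)" for \<omega>
      \<comment> \<open>The signs in \<open>s j\<close> turn the left side into the integral of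
        \<open>gg\<close> against T \<Phi> with |\<Phi>| <= F. Hence T \<Phi> / B has modular at
        most 1, and Young's inequality leaves B times one plus the modular R \<omega> of
        \<open>gg\<close>.\<close>
      have main: "(\<Sum>j\<in>J. Fj j * \<bar>\<Sum>k\<in>S. \<tau> k j * \<theta> k \<omega>\<bar>) \<le> B * (1 + enn2real (R \<omega>))"
        if R: "R \<omega> < \<infinity>" for \<omega>
      proof -
        define s where "s j = sgn (\<Sum>k\<in>S. \<tau> k j * \<theta> k \<omega>) * Fj j" for j
        define y where "y z = (\<Sum>j\<in>J. s j * x j z)" for z
        define gg where "gg z = (\<Sum>k\<in>S. g k z * \<theta> k \<omega>)" for z
        define \<Phi> where "\<Phi> = (\<lambda>w. \<Sum>j\<in>J. s j * indicator (A j) w)"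
        have sF: "\<bar>s j\<bar> \<le> Fj j" for j using Fj0[of j] by (simp add: s_def abs_mult abs_sgn_eq)
        have \<Phi>m: "\<Phi> \<in> borel_measurable M" unfolding \<Phi>_def using A by measurable
        have \<Phi>F: "AE w in M. \<bar>\<Phi> w\<bar> \<le> \<bar>F w\<bar>"
        proof (rule AE_I2)
          fix w
          have "\<bar>\<Phi> w\<bar> \<le> (\<Sum>j\<in>J. \<bar>s j * indicator (A j) w\<bar>)" unfolding \<Phi>_def by (rule sum_abs)
          also have "\<dots> \<le> F w" unfolding F
            using sF by (intro sum_mono) (auto simp: abs_mult split: split_indicator)
          finally show "\<bar>\<Phi> w\<bar> \<le> \<bar>F w\<bar>" by linarith
        qed
        have \<Phi>: "\<Phi> \<in> Lvar M q" "Lvar_norm M q \<Phi> \<le> Lvar_norm M q F"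
          using Lvar_mono[OF q FL \<Phi>m \<Phi>F] by auto
        have Ty: "AE z in N. T \<Phi> z = y z"
          unfolding \<Phi>_def y_def x_def by (rule bounded_operator_sum[OF q T J(1) ind])
        have [measurable]: "y \<in> borel_measurable N" unfolding y_def by measurable
        have [measurable]: "gg \<in> borel_measurable N" unfolding gg_def by measurable
        have "Lvar_norm N p (T \<Phi>) \<le> opn * Lvar_norm M q \<Phi>"
          unfolding opn_def by (rule bounded_operator_norm(2)[OF q T \<Phi>(1)])
        also have "\<dots> \<le> opn * Lvar_norm M q F" using \<Phi>(2) nn by (rule mult_left_mono)
        finally have "Lvar_norm N p (T \<Phi>) < B" using B by simp
        then have "modular N p (\<lambda>z. T \<Phi> z / B) \<le> 1" by (rule modular_le_1[OF p bounded_operator_Lvar[OF T \<Phi>(1)]])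
        moreover have "modular N p (\<lambda>z. y z / B) \<le> modular N p (\<lambda>z. T \<Phi> z / B)"
          using Ty by (intro modular_mono[OF p]) (auto elim: eventually_mono)
        ultimately have mody: "(\<integral>\<^sup>+ z. ennreal (\<bar>y z / B\<bar> powr P z) \<partial>N) \<le> 1"
          by (subst (asm) mod_eq) auto
        have int: "integrable N (\<lambda>z. s j * \<theta> k \<omega> * (g k z * x j z))" if "k \<in> S" "j \<in> J" for k j
          using gx[OF that] by simp
        have split: "gg z * y z = (\<Sum>j\<in>J. \<Sum>k\<in>S. s j * \<theta> k \<omega> * (g k z * x j z))" for z
        proof -
          have "gg z * y z = (\<Sum>k\<in>S. \<Sum>j\<in>J. s j * \<theta> k \<omega> * (g k z * x j z))"
            unfolding gg_def y_def sum_product by (intro sum.cong refl) (simp add: mult_ac)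
          then show ?thesis by (subst sum.swap)
        qed
        have igy: "integrable N (\<lambda>z. gg z * y z)" unfolding split by (intro Bochner_Integration.integrable_sum int)
        have "(\<Sum>j\<in>J. Fj j * \<bar>\<Sum>k\<in>S. \<tau> k j * \<theta> k \<omega>\<bar>) = (\<Sum>j\<in>J. \<Sum>k\<in>S. s j * \<theta> k \<omega> * \<tau> k j)"
        proof (intro sum.cong refl)
          fix j
          have "Fj j * \<bar>\<Sum>k\<in>S. \<tau> k j * \<theta> k \<omega>\<bar> = s j * (\<Sum>k\<in>S. \<tau> k j * \<theta> k \<omega>)"
            by (simp add: s_def abs_sgn mult_ac)
          then show "Fj j * \<bar>\<Sum>k\<in>S. \<tau> k j * \<theta> k \<omega>\<bar> = (\<Sum>k\<in>S. s j * \<theta> k \<omega> * \<tau> k j)"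
            by (simp add: sum_distrib_left mult_ac)
        qed
        also have "\<dots> = (\<Sum>j\<in>J. \<integral>z. (\<Sum>k\<in>S. s j * \<theta> k \<omega> * (g k z * x j z)) \<partial>N)"
        proof (intro sum.cong refl)
          fix j assume j: "j \<in> J"
          have "(\<integral>z. (\<Sum>k\<in>S. s j * \<theta> k \<omega> * (g k z * x j z)) \<partial>N) = (\<Sum>k\<in>S. \<integral>z. s j * \<theta> k \<omega> * (g k z * x j z) \<partial>N)"
            by (rule Bochner_Integration.integral_sum) (intro int j)
          then show "(\<Sum>k\<in>S. s j * \<theta> k \<omega> * \<tau> k j) = (\<integral>z. (\<Sum>k\<in>S. s j * \<theta> k \<omega> * (g k z * x j z)) \<partial>N)"
            by (simp add: \<tau>_def)
        qed
        also have "\<dots> = (\<integral>z. gg z * y z \<partial>N)"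
          unfolding split by (rule Bochner_Integration.integral_sum[symmetric])
            (intro Bochner_Integration.integrable_sum int; assumption)
        finally have eq: "(\<Sum>j\<in>J. Fj j * \<bar>\<Sum>k\<in>S. \<tau> k j * \<theta> k \<omega>\<bar>) = (\<integral>z. gg z * y z \<partial>N)" .
        have "ennreal \<bar>\<integral>z. gg z * y z \<partial>N\<bar> \<le> (\<integral>\<^sup>+ z. ennreal \<bar>gg z * y z\<bar> \<partial>N)"
          using integral_norm_bound_ennreal[OF igy] by simp
        also have "\<dots> \<le> (\<integral>\<^sup>+ z. ennreal B * (ennreal (\<bar>gg z\<bar> powr (P z / (P z - 1))) + ennreal (\<bar>y z / B\<bar> powr P z)) \<partial>N)"
        proof (rule nn_integral_mono_AE)
          show "AE z in N. ennreal \<bar>gg z * y z\<bar> \<le> ennreal B * (ennreal (\<bar>gg z\<bar> powr (P z / (P z - 1))) + ennreal (\<bar>y z / B\<bar> powr P z))"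
            using Pb
          proof eventually_elim
            case (elim z)
            have "\<bar>gg z * y z\<bar> = B * (\<bar>gg z\<bar> * \<bar>y z / B\<bar>)" using B0 by (simp add: abs_mult abs_divide)
            also have "\<dots> \<le> B * (\<bar>gg z\<bar> powr (P z / (P z - 1)) + \<bar>y z / B\<bar> powr P z)"
              using elim P1 B0 by (intro mult_left_mono Young_conjugate) auto
            finally show ?case using B0 by (simp add: ennreal_leI flip: ennreal_plus ennreal_mult')
          qed
        qed
        also have "\<dots> = ennreal B * (R \<omega> + (\<integral>\<^sup>+ z. ennreal (\<bar>y z / B\<bar> powr P z) \<partial>N))"
          unfolding R_def gg_def[symmetric] by (subst nn_integral_cmult, measurable) (subst nn_integral_add, auto)
        also have "\<dots> \<le> ennreal B * (ennreal (enn2real (R \<omega>)) + 1)"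
          using R mody by (intro mult_left_mono add_mono) auto
        also have "\<dots> = ennreal (B * (1 + enn2real (R \<omega>)))"
          using B0 by (simp add: ennreal_mult' add.commute)
        finally have "\<bar>\<integral>z. gg z * y z \<partial>N\<bar> \<le> B * (1 + enn2real (R \<omega>))"
          by (rule ennreal_le_iff[THEN iffD1, rotated]) (use B0 in simp)
        then show ?thesis unfolding eq by linarith
      qed
      have "(\<Sum>\<omega>\<in>\<Omega>. R \<omega>) \<le> ennreal (card \<Omega> * (1 + C)) * (\<integral>\<^sup>+ z. ennreal (lnorm r' S (\<lambda>k. g k z) powr (P z / (P z - 1))) \<partial>N)"
        unfolding R_def using P'b C r'(1) S \<Omega>
        by (intro sum_modular_le[of S \<Omega> r' C \<theta> t0] upper) auto
      also have "(\<integral>\<^sup>+ z. ennreal (lnorm r' S (\<lambda>k. g k z) powr (P z / (P z - 1))) \<partial>N) = (\<integral>\<^sup>+ z. ennreal (U z) \<partial>N)"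
        using Pb by (intro nn_integral_cong_AE) (auto elim!: eventually_mono simp: gU P1 intro!: arg_cong[where f = ennreal] gU less_le_trans[OF P1(1)])
      also have "\<dots> = ennreal Ar" by (rule modU)
      finally have sumR: "(\<Sum>\<omega>\<in>\<Omega>. R \<omega>) \<le> ennreal (card \<Omega> * (1 + C) * Ar)"
        using C card by (simp add: ennreal_mult')
      then have "(\<Sum>\<omega>\<in>\<Omega>. R \<omega>) < \<infinity>" by (rule le_less_trans) simp
      then have finR: "R \<omega> < \<infinity>" if "\<omega> \<in> \<Omega>" for \<omega> using that \<Omega> by (auto simp: less_top)
      have "enn2real (\<Sum>\<omega>\<in>\<Omega>. R \<omega>) \<le> card \<Omega> * (1 + C) * Ar"
        using enn2real_mono[OF sumR] C card Ar(2) by simp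
      then have sumR': "(\<Sum>\<omega>\<in>\<Omega>. enn2real (R \<omega>)) \<le> card \<Omega> * (1 + C) * Ar"
        using finR by (subst (asm) enn2real_sum) auto
      \<comment> \<open>Holder in k separates the coefficients \<open>a k j\<close> from the numbers
        \<tau>; the lower moment bound then replaces the l^r' norm of \<tau> by an average over
        \<Omega>, where the preceding estimate applies.\<close>
      have "c * (L * Ar) \<le> c * (\<Sum>j\<in>J. Fj j * lnorm r' S (\<lambda>k. \<tau> k j))"
        unfolding LAr
      proof (intro mult_left_mono sum_mono)
        fix j
        have "\<bar>\<Sum>k\<in>S. a k j * \<tau> k j\<bar> \<le> Fj j * lnorm r' S (\<lambda>k. \<tau> k j)"
          unfolding Fj_def using r(1) r'(1) by (intro lnorm_Holder r'(3) S) auto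
        then show "(\<Sum>k\<in>S. a k j * \<tau> k j) \<le> Fj j * lnorm r' S (\<lambda>k. \<tau> k j)" by linarith
      qed (use c in simp)
      also have "\<dots> = (\<Sum>j\<in>J. Fj j * (c * lnorm r' S (\<lambda>k. \<tau> k j)))" by (simp add: sum_distrib_left mult.left_commute)
      also have "\<dots> \<le> (\<Sum>j\<in>J. Fj j * avg \<Omega> (\<lambda>\<omega>. \<bar>\<Sum>k\<in>S. \<tau> k j * \<theta> k \<omega>\<bar>))"
        by (intro sum_mono mult_left_mono lower Fj0)
      also have "\<dots> = avg \<Omega> (\<lambda>\<omega>. \<Sum>j\<in>J. Fj j * \<bar>\<Sum>k\<in>S. \<tau> k j * \<theta> k \<omega>\<bar>)"
        by (simp only: avg_sum avg_cmult)
      also have "\<dots> \<le> avg \<Omega> (\<lambda>\<omega>. B * (1 + enn2real (R \<omega>)))"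
        using main finR by (intro avg_mono) auto
      also have "\<dots> = B * (1 + (\<Sum>\<omega>\<in>\<Omega>. enn2real (R \<omega>)) / card \<Omega>)"
        unfolding avg_cmult avg_add avg_const[OF \<Omega>] by (simp add: avg_def)
      also have "\<dots> \<le> B * (1 + (1 + C) * Ar)"
      proof (intro mult_left_mono add_left_mono)
        show "(\<Sum>\<omega>\<in>\<Omega>. enn2real (R \<omega>)) / card \<Omega> \<le> (1 + C) * Ar"
          unfolding pos_divide_le_eq[OF card] using sumR' by (simp only: mult_ac)
      qed (use B0 in simp)
      finally have "B * (c * \<Lambda> * Ar) \<le> B * (1 + (1 + C) * Ar)" by (simp add: L_def mult_ac)
      then have "c * \<Lambda> * Ar \<le> 1 + (1 + C) * Ar" using B0 by simp
      moreover have "c * \<Lambda> = 2 + C" using c by (simp add: \<Lambda>_def)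
      ultimately have "Ar \<le> 1" by (simp add: distrib_right)
      then have "modular N p (\<lambda>z. G z / L) \<le> 1" using Ar by simp
      then have "Lvar_norm N p G \<le> L" by (intro Lvar_norm_le L)
      then show "Lvar_norm N p G \<le> \<Lambda> * B" by (simp add: L_def mult.commute)
    qed (use \<Lambda> in simp)
    then show "Lvar_norm N p (\<lambda>z. lnorm r {1..n} (\<lambda>k. T (\<lambda>y. \<Sum>j\<in>J. a k j * indicator (A j) y) z))
        \<le> \<Lambda> * operator_norm M q N p T * Lvar_norm M q (\<lambda>y. lnorm r {1..n} (\<lambda>k. \<Sum>j\<in>J. a k j * indicator (A j) y))"
      unfolding G_def[abs_def] F_def[abs_def] f_def S_def opn_def by (simp only: mult.assoc)
  qed
  then show ?thesis using \<Lambda> less_imp_le by blast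
qed

section \<open>Lower bounds\<close>

text \<open>A set of finite positive measure with cells of equal measure, so that integrals of step
  functions become averages over \<open>J\<close>.\<close>

locale partitioned =
  fixes M :: "'a measure" and q :: "'a \<Rightarrow> ennreal" and D :: "'a set" and J :: "'j set" and idx :: "'a \<Rightarrow> 'j"
  assumes q: "q \<in> exponents M" and fin: "AE x in M. q x < \<infinity>"
    and D: "D \<in> fmeasurable M" "measure M D > 0" and J: "finite J" "J \<noteq> {}"
    and idx: "\<And>x. x \<in> D \<Longrightarrow> idx x \<in> J" "\<And>j. j \<in> J \<Longrightarrow> {x\<in>D. idx x = j} \<in> sets M"
      "\<And>j. j \<in> J \<Longrightarrow> measure M {x\<in>D. idx x = j} = measure M D / card J"
begin

abbreviation "\<delta> \<equiv> measure M D"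
abbreviation "Q x \<equiv> enn2real (q x)"
abbreviation "Dj j \<equiv> {x\<in>D. idx x = j}"

lemma D_sets[measurable]: "D \<in> sets M"
  using D by (auto simp: fmeasurable_def)

lemma q_measurable[measurable]: "q \<in> borel_measurable M"
  using q by (simp add: exponents_def)

lemma Dj_finite: "emeasure M (Dj j) < \<infinity>"
proof -
  have "emeasure M (Dj j) \<le> emeasure M D" by (intro emeasure_mono) auto
  then show ?thesis using D by (auto simp: fmeasurable_def intro: le_less_trans)
qed

lemma Q_ge_1: "AE x in M. 1 \<le> Q x"
  using fin AE_space
proof eventually_elim
  case (elim x)
  then have "1 \<le> ennreal (Q x)" using exponents_ge_1[OF q] by simp
  then show ?case by simp
qed

lemma card_J: "real (card J) > 0"
  using J by (simp add: card_gt_0_iff)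

lemma indicator_idx: "indicator D x * v (idx x) = (\<Sum>j\<in>J. v j * indicator (Dj j) x)" for v :: "'j \<Rightarrow> real"
proof (cases "x \<in> D")
  case True
  have "(\<Sum>j\<in>J. v j * indicator (Dj j) x) = (\<Sum>j\<in>J. if j = idx x then v (idx x) else 0)"
    using True by (intro sum.cong) auto
  also have "\<dots> = v (idx x)" using J idx(1)[OF True] by simp
  finally show ?thesis using True by simp
qed simp

lemma indicator_idx_measurable[measurable]: "(\<lambda>x. indicator D x * v (idx x)) \<in> borel_measurable M" for v :: "'j \<Rightarrow> real"
  unfolding indicator_idx using idx(2) by measurable

lemma nn_integral_idx:
  assumes "\<And>j. j \<in> J \<Longrightarrow> 0 \<le> h j"
  shows "(\<integral>\<^sup>+ x. ennreal (indicator D x * h (idx x)) \<partial>M) = ennreal (\<delta> * avg J h)"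
proof -
  have "(\<integral>\<^sup>+ x. ennreal (indicator D x * h (idx x)) \<partial>M) = (\<integral>\<^sup>+ x. (\<Sum>j\<in>J. ennreal (h j) * indicator (Dj j) x) \<partial>M)"
  proof (rule nn_integral_cong)
    fix x
    have "ennreal (\<Sum>j\<in>J. h j * indicator (Dj j) x) = (\<Sum>j\<in>J. ennreal (h j * indicator (Dj j) x))"
      using assms by (intro sum_ennreal[symmetric]) auto
    also have "\<dots> = (\<Sum>j\<in>J. ennreal (h j) * indicator (Dj j) x)"
      by (intro sum.cong) (auto split: split_indicator)
    finally show "ennreal (indicator D x * h (idx x)) = (\<Sum>j\<in>J. ennreal (h j) * indicator (Dj j) x)"
      unfolding indicator_idx .
  qed
  also have "\<dots> = (\<Sum>j\<in>J. ennreal (h j) * emeasure M (Dj j))"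
    using idx(2) by (subst nn_integral_sum) (auto simp: nn_integral_cmult_indicator)
  also have "\<dots> = (\<Sum>j\<in>J. ennreal (h j * (\<delta> / card J)))"
  proof (intro sum.cong refl)
    fix j assume j: "j \<in> J"
    have "emeasure M (Dj j) = ennreal (\<delta> / card J)"
      using Dj_finite[of j] idx(3)[OF j] by (metis emeasure_eq_ennreal_measure infinity_ennreal_def order_less_irrefl)
    then show "ennreal (h j) * emeasure M (Dj j) = ennreal (h j * (\<delta> / card J))"
      using assms[OF j] by (simp only: ennreal_mult')
  qed
  also have "\<dots> = ennreal (\<Sum>j\<in>J. h j * (\<delta> / card J))"
    using assms by (intro sum_ennreal) auto
  also have "(\<Sum>j\<in>J. h j * (\<delta> / card J)) = \<delta> * avg J h"
    unfolding sum_distrib_right[symmetric] by (simp add: avg_def)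
  finally show ?thesis .
qed

text \<open>The weight makes the embedding of step functions isometric for the modular of the
  normalised measure on \<open>D\<close>.\<close>

definition emb :: "('j \<Rightarrow> real) \<Rightarrow> 'a \<Rightarrow> real" where
  "emb v x = indicator D x * \<delta> powr (- 1 / Q x) * v (idx x)"

lemma emb_measurable[measurable]: "emb v \<in> borel_measurable M"
proof -
  have "emb v = (\<lambda>x. \<delta> powr (- 1 / Q x) * (indicator D x * v (idx x)))"
    by (auto simp: emb_def fun_eq_iff)
  then show ?thesis by simp
qed

lemma modular_emb: "modular M q (emb v) = (\<integral>\<^sup>+ x. ennreal (indicator D x * (\<bar>v (idx x)\<bar> powr Q x / \<delta>)) \<partial>M)"
  unfolding modular_eq_nn_integral[OF q fin emb_measurable]
proof (rule nn_integral_cong_AE)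
  show "AE x in M. ennreal (\<bar>emb v x\<bar> powr Q x) = ennreal (indicator D x * (\<bar>v (idx x)\<bar> powr Q x / \<delta>))"
    using Q_ge_1
  proof eventually_elim
    case (elim x)
    show ?case
    proof (cases "x \<in> D")
      case True
      have "\<bar>emb v x\<bar> powr Q x = \<delta> powr (- 1) * \<bar>v (idx x)\<bar> powr Q x"
        using True elim by (simp add: emb_def abs_mult powr_mult powr_powr)
      then show ?thesis using True D by (simp add: powr_minus divide_inverse mult.commute)
    qed (simp add: emb_def)
  qed
qed

lemma emb_divide: "emb v x / c = emb (\<lambda>j. v j / c) x"
  by (simp add: emb_def)

lemma emb_upper:
  assumes U: "U > 0" and v: "\<And>j. j \<in> J \<Longrightarrow> \<bar>v j\<bar> \<le> U"
  shows "emb v \<in> Lvar M q" "Lvar_norm M q (emb v) \<le> U"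
proof -
  have "modular M q (\<lambda>x. emb v x / U) = modular M q (emb (\<lambda>j. v j / U))"
    by (simp only: emb_divide)
  also have "\<dots> \<le> (\<integral>\<^sup>+ x. ennreal (indicator D x * (1 / \<delta>)) \<partial>M)"
    unfolding modular_emb
  proof (intro nn_integral_mono ennreal_leI)
    fix x
    show "indicator D x * (\<bar>v (idx x) / U\<bar> powr Q x / \<delta>) \<le> indicator D x * (1 / \<delta>)"
    proof (cases "x \<in> D")
      case True
      then have "\<bar>v (idx x) / U\<bar> \<le> 1" using U v[OF idx(1)] by (simp add: abs_divide)
      then have "\<bar>v (idx x) / U\<bar> powr Q x \<le> 1 powr Q x" by (intro powr_mono2) auto
      then show ?thesis using True D by (simp add: divide_right_mono)
    qed simp
  qed
  also have "\<dots> = ennreal (\<delta> * avg J (\<lambda>_. 1 / \<delta>))" using D by (intro nn_integral_idx) simp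
  also have "\<dots> = 1" using D J by (simp add: avg_const)
  finally have "modular M q (\<lambda>x. emb v x / U) \<le> 1" .
  then show "emb v \<in> Lvar M q" "Lvar_norm M q (emb v) \<le> U"
    using U by (auto intro: Lvar_I Lvar_norm_le)
qed

lemma emb_Lvar: "emb v \<in> Lvar M q"
proof (rule emb_upper(1))
  show "\<bar>v j\<bar> \<le> (\<Sum>j\<in>J. \<bar>v j\<bar>) + 1" if "j \<in> J" for j
    using member_le_sum[of j J "\<lambda>j. \<bar>v j\<bar>"] that J by simp
  show "0 < (\<Sum>j\<in>J. \<bar>v j\<bar>) + 1" by (intro add_nonneg_pos sum_nonneg) auto
qed

text \<open>Values |v| / c >= V / c > 1 only grow under powers Q >= 1, so the modular at any c < V
  is at least V / c > 1. Together with \<open>emb_upper\<close> this determines the norm of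
  functions of constant modulus whatever the exponent is.\<close>

lemma emb_lower:
  assumes V: "\<And>j. j \<in> J \<Longrightarrow> V \<le> \<bar>v j\<bar>"
  shows "V \<le> Lvar_norm M q (emb v)"
proof (rule ccontr)
  assume "\<not> V \<le> Lvar_norm M q (emb v)"
  then have lt: "Lvar_norm M q (emb v) < V" by simp
  define c where "c = (Lvar_norm M q (emb v) + V) / 2"
  have c: "Lvar_norm M q (emb v) < c" "c < V" "0 < c"
    using lt Lvar_norm_nonneg[OF q emb_Lvar, of v] by (auto simp: c_def)
  have "ennreal (V / c) = ennreal (\<delta> * avg J (\<lambda>_. V / c / \<delta>))" using D J by (simp add: avg_const)
  also have "\<dots> = (\<integral>\<^sup>+ x. ennreal (indicator D x * (V / c / \<delta>)) \<partial>M)"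
    using D c by (intro nn_integral_idx[symmetric]) simp
  also have "\<dots> \<le> (\<integral>\<^sup>+ x. ennreal (indicator D x * (\<bar>v (idx x) / c\<bar> powr Q x / \<delta>)) \<partial>M)"
  proof (rule nn_integral_mono_AE)
    show "AE x in M. ennreal (indicator D x * (V / c / \<delta>)) \<le> ennreal (indicator D x * (\<bar>v (idx x) / c\<bar> powr Q x / \<delta>))"
      using Q_ge_1
    proof eventually_elim
      case (elim x)
      show ?case
      proof (cases "x \<in> D")
        case True
        have 1: "V / c \<le> \<bar>v (idx x) / c\<bar>" using V[OF idx(1)[OF True]] c by (simp add: abs_divide divide_right_mono)
        moreover have "1 \<le> V / c" using c by simp
        ultimately have "\<bar>v (idx x) / c\<bar> powr 1 \<le> \<bar>v (idx x) / c\<bar> powr Q x" using elim by (intro powr_mono) auto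
        then have "V / c \<le> \<bar>v (idx x) / c\<bar> powr Q x" using 1 by simp
        then have "V / c / \<delta> \<le> \<bar>v (idx x) / c\<bar> powr Q x / \<delta>" by (rule divide_right_mono) simp
        then show ?thesis using True by (intro ennreal_leI) (simp only: indicator_simps mult_1)
      qed simp
    qed
  qed
  also have "\<dots> = modular M q (\<lambda>x. emb v x / c)" by (simp only: emb_divide modular_emb)
  also have "\<dots> \<le> 1" by (rule modular_le_1[OF q emb_Lvar c(1)])
  finally show False using c by simp
qed

text \<open>Where Q <= t, the power Q of |v| / s is at most 1 plus its t-th power. The modular at s
  is thus at most 2, and the norm at most (1 + 2) s.\<close>

lemma emb_moment:
  assumes Qt: "AE x in M. x \<in> D \<longrightarrow> Q x \<le> t" and s: "s > 0" and v: "avg J (\<lambda>j. \<bar>v j\<bar> powr t) \<le> s powr t"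
  shows "Lvar_norm M q (emb v) \<le> 3 * s"
proof -
  have "modular M q (\<lambda>x. emb v x / s) = (\<integral>\<^sup>+ x. ennreal (indicator D x * (\<bar>v (idx x) / s\<bar> powr Q x / \<delta>)) \<partial>M)"
    by (simp only: emb_divide modular_emb)
  also have "\<dots> \<le> (\<integral>\<^sup>+ x. ennreal (indicator D x * ((1 + \<bar>v (idx x) / s\<bar> powr t) / \<delta>)) \<partial>M)"
  proof (rule nn_integral_mono_AE)
    show "AE x in M. ennreal (indicator D x * (\<bar>v (idx x) / s\<bar> powr Q x / \<delta>)) \<le> ennreal (indicator D x * ((1 + \<bar>v (idx x) / s\<bar> powr t) / \<delta>))"
      using Q_ge_1 Qt
    proof eventually_elim
      case (elim x)
      show ?case
      proof (cases "x \<in> D")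
        case True
        then have "\<bar>v (idx x) / s\<bar> powr Q x \<le> 1 + \<bar>v (idx x) / s\<bar> powr t"
          using elim by (intro powr_le_one_plus_powr) auto
        then show ?thesis using True D by (intro ennreal_leI) (simp add: divide_right_mono)
      qed simp
    qed
  qed
  also have "\<dots> = ennreal (\<delta> * avg J (\<lambda>j. (1 + \<bar>v j / s\<bar> powr t) / \<delta>))"
    using D by (intro nn_integral_idx) auto
  also have "\<delta> * avg J (\<lambda>j. (1 + \<bar>v j / s\<bar> powr t) / \<delta>) = 1 + avg J (\<lambda>j. \<bar>v j\<bar> powr t) / s powr t"
  proof -
    have "avg J (\<lambda>j. (1 + \<bar>v j / s\<bar> powr t) / \<delta>) = avg J (\<lambda>j. (1 / \<delta>) * (1 + (1 / s powr t) * \<bar>v j\<bar> powr t))"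
      using s by (intro avg_cong) (simp add: abs_divide powr_divide)
    also have "\<dots> = (1 / \<delta>) * (1 + (1 / s powr t) * avg J (\<lambda>j. \<bar>v j\<bar> powr t))"
      by (simp only: avg_cmult avg_add avg_const[OF J])
    finally show ?thesis using D by simp
  qed
  also have "\<dots> \<le> 2" using v s by (simp add: divide_le_eq)
  then have "ennreal (1 + avg J (\<lambda>j. \<bar>v j\<bar> powr t) / s powr t) \<le> ennreal 2" by (rule ennreal_leI)
  finally have "modular M q (\<lambda>x. emb v x / s) \<le> ennreal 2" .
  from Lvar_norm_le_one_plus_modular(2)[OF q _ s _ this] show ?thesis by simp
qed

text \<open>The mean over a cell after the weight of \<open>emb\<close> has been undone. These
  functionals form a left inverse of \<open>emb\<close>; composed with \<open>emb\<close> they are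
  the averaging projection onto weighted step functions.\<close>

definition coef :: "'j \<Rightarrow> ('a \<Rightarrow> real) \<Rightarrow> real" where
  "coef j f = card J / \<delta> * (\<integral>x. f x * \<delta> powr (1 / Q x) * indicator (Dj j) x \<partial>M)"

text \<open>One integrable majorant on \<open>D\<close> for all powers of order at most Q of the
  weighted function f / c.\<close>

lemma Lvar_dominated:
  assumes f: "f \<in> Lvar M q" and c: "Lvar_norm M q f < c"
  shows "integrable M (\<lambda>x. indicator D x * (1 + \<delta> * \<bar>f x / c\<bar> powr Q x))"
    and "(\<integral>x. indicator D x * (1 + \<delta> * \<bar>f x / c\<bar> powr Q x) \<partial>M) \<le> 2 * \<delta>"
proof -
  note [measurable] = Lvar_measurable[OF f]
  have "(\<integral>\<^sup>+ x. ennreal (indicator D x * (1 + \<delta> * \<bar>f x / c\<bar> powr Q x)) \<partial>M)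
     \<le> (\<integral>\<^sup>+ x. indicator D x + ennreal \<delta> * ennreal (\<bar>f x / c\<bar> powr Q x) \<partial>M)"
    by (intro nn_integral_mono) (auto split: split_indicator simp: ennreal_plus ennreal_mult')
  also have "\<dots> = emeasure M D + ennreal \<delta> * modular M q (\<lambda>x. f x / c)"
    by (subst nn_integral_add) (auto simp: nn_integral_cmult modular_eq_nn_integral[OF q fin])
  also have "\<dots> \<le> ennreal \<delta> + ennreal \<delta> * 1"
    using modular_le_1[OF q f c] D(1) by (intro add_mono mult_left_mono) (auto simp: emeasure_eq_measure2)
  also have "\<dots> = ennreal (2 * \<delta>)" by (simp flip: ennreal_plus)
  finally have le: "(\<integral>\<^sup>+ x. ennreal (indicator D x * (1 + \<delta> * \<bar>f x / c\<bar> powr Q x)) \<partial>M) \<le> ennreal (2 * \<delta>)" .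
  then have lt: "(\<integral>\<^sup>+ x. ennreal (indicator D x * (1 + \<delta> * \<bar>f x / c\<bar> powr Q x)) \<partial>M) < \<infinity>"
    by (rule le_less_trans) simp
  have nonneg: "0 \<le> indicator D x * (1 + \<delta> * \<bar>f x / c\<bar> powr Q x)" for x by simp
  show int: "integrable M (\<lambda>x. indicator D x * (1 + \<delta> * \<bar>f x / c\<bar> powr Q x))"
    using lt by (intro integrableI_nonneg) (auto simp: nonneg)
  show "(\<integral>x. indicator D x * (1 + \<delta> * \<bar>f x / c\<bar> powr Q x) \<partial>M) \<le> 2 * \<delta>"
    using le by (subst (asm) nn_integral_eq_integral[OF int]) (auto simp: nonneg)
qed

lemma weight_powr: "1 \<le> Q x \<Longrightarrow> \<bar>y * \<delta> powr (1 / Q x)\<bar> powr Q x = \<delta> * \<bar>y\<bar> powr Q x"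
  using D by (simp add: abs_mult powr_mult powr_powr)

lemma coef_moment_integrable:
  assumes f: "f \<in> Lvar M q" and c: "Lvar_norm M q f < c" and t: "0 \<le> t" "AE x in M. x \<in> D \<longrightarrow> t \<le> Q x"
    and E: "E \<in> sets M" "E \<subseteq> D"
  shows "integrable M (\<lambda>x. \<bar>f x / c * \<delta> powr (1 / Q x)\<bar> powr t * indicator E x)"
proof (rule Bochner_Integration.integrable_bound[OF Lvar_dominated(1)[OF f c]])
  note [measurable] = Lvar_measurable[OF f] E(1)
  show "(\<lambda>x. \<bar>f x / c * \<delta> powr (1 / Q x)\<bar> powr t * indicator E x) \<in> borel_measurable M" by measurable
  show "AE x in M. norm (\<bar>f x / c * \<delta> powr (1 / Q x)\<bar> powr t * indicator E x)
      \<le> norm (indicator D x * (1 + \<delta> * \<bar>f x / c\<bar> powr Q x))"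
    using Q_ge_1 t(2)
  proof eventually_elim
    case (elim x)
    show ?case
    proof (cases "x \<in> E")
      case True
      then have "\<bar>f x / c * \<delta> powr (1 / Q x)\<bar> powr t \<le> 1 + \<bar>f x / c * \<delta> powr (1 / Q x)\<bar> powr Q x"
        using elim E t by (intro powr_le_one_plus_powr) auto
      then have "\<bar>f x / c * \<delta> powr (1 / Q x)\<bar> powr t \<le> 1 + \<delta> * \<bar>f x / c\<bar> powr Q x"
        by (simp only: weight_powr[OF elim(1)])
      moreover have "x \<in> D" using True E by auto
      ultimately show ?thesis using True by simp
    qed simp
  qed
qed

lemma coef_integrable:
  assumes f: "f \<in> Lvar M q" and j: "j \<in> J"
  shows "integrable M (\<lambda>x. f x * \<delta> powr (1 / Q x) * indicator (Dj j) x)"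
proof -
  define c where "c = Lvar_norm M q f + 1"
  have c: "Lvar_norm M q f < c" "0 < c" using Lvar_norm_nonneg[OF q f] by (auto simp: c_def)
  note [measurable] = Lvar_measurable[OF f] idx(2)[OF j]
  have "integrable M (\<lambda>x. \<bar>f x / c * \<delta> powr (1 / Q x)\<bar> powr 1 * indicator (Dj j) x)"
    using Q_ge_1 idx(2)[OF j] by (intro coef_moment_integrable[OF f c(1)]) (auto elim: eventually_mono)
  then have "integrable M (\<lambda>x. \<bar>f x / c * \<delta> powr (1 / Q x) * indicator (Dj j) x\<bar>)"
    by (simp add: abs_mult)
  then have "integrable M (\<lambda>x. f x / c * \<delta> powr (1 / Q x) * indicator (Dj j) x)"
    by (subst (asm) integrable_abs_iff) measurable
  then have "integrable M (\<lambda>x. c * (f x / c * \<delta> powr (1 / Q x) * indicator (Dj j) x))"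
    by (rule integrable_mult_right)
  moreover have "(\<lambda>x. c * (f x / c * \<delta> powr (1 / Q x) * indicator (Dj j) x)) = (\<lambda>x. f x * \<delta> powr (1 / Q x) * indicator (Dj j) x)"
    using c(2) by auto
  ultimately show ?thesis by simp
qed

lemma coef_add:
  assumes "f \<in> Lvar M q" "g \<in> Lvar M q" "j \<in> J"
  shows "coef j (\<lambda>x. f x + g x) = coef j f + coef j g"
  using coef_integrable[OF assms(1,3)] coef_integrable[OF assms(2,3)]
  by (simp add: coef_def distrib_right distrib_left)

lemma coef_cmult: "coef j (\<lambda>x. a * f x) = a * coef j f"
  by (simp add: coef_def mult.assoc)

lemma coef_cong_AE:
  assumes "f \<in> Lvar M q" "g \<in> Lvar M q" "AE x in M. f x = g x" "j \<in> J"
  shows "coef j f = coef j g"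
proof -
  note [measurable] = Lvar_measurable[OF assms(1)] Lvar_measurable[OF assms(2)] idx(2)[OF assms(4)]
  have "(\<integral>x. f x * \<delta> powr (1 / Q x) * indicator (Dj j) x \<partial>M) = (\<integral>x. g x * \<delta> powr (1 / Q x) * indicator (Dj j) x \<partial>M)"
  proof (rule integral_cong_AE)
    show "AE x in M. f x * \<delta> powr (1 / Q x) * indicator (Dj j) x = g x * \<delta> powr (1 / Q x) * indicator (Dj j) x"
      using assms(3) by eventually_elim simp
  qed measurable
  then show ?thesis by (simp add: coef_def)
qed

lemma coef_emb:
  assumes j: "j \<in> J" shows "coef j (emb v) = v j"
proof -
  have "(\<integral>x. emb v x * \<delta> powr (1 / Q x) * indicator (Dj j) x \<partial>M) = (\<integral>x. v j * indicator (Dj j) x \<partial>M)"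
    using D by (intro Bochner_Integration.integral_cong) (auto simp: emb_def powr_minus split: split_indicator)
  also have "\<dots> = v j * (\<delta> / card J)"
    using idx(2,3)[OF j] Dj_finite[of j] by simp
  finally show ?thesis using D card_J by (simp add: coef_def)
qed

text \<open>Jensen on each cell, followed by |h|^t <= 1 + |h|^Q where t <= Q on \<open>D\<close>;
  the two terms contribute one unit each to the constant 2.\<close>

lemma coef_moment:
  assumes f: "f \<in> Lvar M q" and c: "Lvar_norm M q f < c" and t: "1 < t" "AE x in M. x \<in> D \<longrightarrow> t \<le> Q x"
  shows "avg J (\<lambda>j. \<bar>coef j f / c\<bar> powr t) \<le> 2"
proof -
  have c0: "0 < c" using c Lvar_norm_nonneg[OF q f] by simp
  define h where "h x = f x / c * \<delta> powr (1 / Q x)" for x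
  have int: "integrable M (\<lambda>x. \<bar>h x\<bar> powr t * indicator E x)" if "E \<in> sets M" "E \<subseteq> D" for E
    unfolding h_def using t that by (intro coef_moment_integrable[OF f c]) auto
  have each: "\<bar>coef j f / c\<bar> powr t \<le> card J / \<delta> * (\<integral>x. \<bar>h x\<bar> powr t * indicator (Dj j) x \<partial>M)" if j: "j \<in> J" for j
  proof -
    define u where "u = \<bar>coef j f / c\<bar>"
    define w where "w = card J / \<delta>"
    have w: "w > 0" using card_J D by (simp add: w_def)
    have hint: "integrable M (\<lambda>x. h x * indicator (Dj j) x)"
      using coef_integrable[OF f j] by (simp add: h_def)
    have one: "w * (\<integral>x. indicator (Dj j) x \<partial>M) = 1"
      using idx(2,3)[OF j] Dj_finite[of j] D card_J by (simp add: w_def)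
    have "u = w * \<bar>\<integral>x. h x * indicator (Dj j) x \<partial>M\<bar>"
    proof -
      have "coef j f / c = w * (\<integral>x. h x * indicator (Dj j) x \<partial>M)"
        by (simp add: coef_def h_def w_def)
      then show ?thesis using w by (simp add: u_def abs_mult)
    qed
    also have "\<dots> \<le> w * (\<integral>x. \<bar>h x\<bar> * indicator (Dj j) x \<partial>M)"
      using integral_norm_bound[of M "\<lambda>x. h x * indicator (Dj j) x"] w by (intro mult_left_mono) (auto simp: abs_mult)
    finally have u1: "u \<le> w * (\<integral>x. \<bar>h x\<bar> * indicator (Dj j) x \<partial>M)" .
    have hint': "integrable M (\<lambda>x. \<bar>h x\<bar> * indicator (Dj j) x)"
      using integrable_abs[OF hint] by (simp add: abs_mult)
    have conj: "1 < t / (t - 1)" "1 / t + 1 / (t / (t - 1)) = 1" using t by (auto simp: field_simps)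
    \<comment> \<open>Jensen on the cell by way of Young's inequality against the constant u^(t -
      1); the term u^t / t', with t' the conjugate of t, is then moved to the left.\<close>
    have "u powr t = u powr (t - 1) * u"
      by (cases "u = 0") (auto simp: powr_diff u_def)
    also have "\<dots> \<le> u powr (t - 1) * (w * (\<integral>x. \<bar>h x\<bar> * indicator (Dj j) x \<partial>M))"
      using u1 by (rule mult_left_mono) simp
    also have "\<dots> = w * (\<integral>x. \<bar>h x\<bar> * u powr (t - 1) * indicator (Dj j) x \<partial>M)"
      by (simp add: mult_ac flip: integral_mult_left_zero integral_mult_right_zero)
    also have "\<dots> \<le> w * (\<integral>x. (1 / t) * (\<bar>h x\<bar> powr t * indicator (Dj j) x) + (u powr t / (t / (t - 1))) * indicator (Dj j) x \<partial>M)"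
    proof (intro mult_left_mono integral_mono)
      show "integrable M (\<lambda>x. \<bar>h x\<bar> * u powr (t - 1) * indicator (Dj j) x)"
        using integrable_mult_right[OF hint', of "u powr (t - 1)"] by (simp add: mult_ac)
      show "integrable M (\<lambda>x. (1 / t) * (\<bar>h x\<bar> powr t * indicator (Dj j) x) + (u powr t / (t / (t - 1))) * indicator (Dj j) x)"
        using int[OF idx(2)[OF j]] idx(2)[OF j] Dj_finite[of j]
        by (intro Bochner_Integration.integrable_add integrable_mult_right) (auto intro: integrable_real_indicator)
      show "\<bar>h x\<bar> * u powr (t - 1) * indicator (Dj j) x \<le> (1 / t) * (\<bar>h x\<bar> powr t * indicator (Dj j) x) + (u powr t / (t / (t - 1))) * indicator (Dj j) x" for x
        using Youngs_inequality[OF t(1) conj, of "\<bar>h x\<bar>" "u powr (t - 1)"] t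
        by (auto simp: powr_powr split: split_indicator)
    qed (use w in simp)
    also have "\<dots> = (1 / t) * (w * (\<integral>x. \<bar>h x\<bar> powr t * indicator (Dj j) x \<partial>M)) + (u powr t / (t / (t - 1))) * (w * (\<integral>x. indicator (Dj j) x \<partial>M))"
    proof -
      have "integrable M (\<lambda>x. indicator (Dj j) x :: real)"
        using idx(2)[OF j] Dj_finite[of j] by (intro integrable_real_indicator) auto
      then show ?thesis using int[OF idx(2)[OF j]]
        by (subst Bochner_Integration.integral_add) (auto simp: algebra_simps)
    qed
    finally have "u powr t \<le> (1 / t) * (w * (\<integral>x. \<bar>h x\<bar> powr t * indicator (Dj j) x \<partial>M)) + u powr t / (t / (t - 1))"
      unfolding one by simp
    moreover have "u powr t / (t / (t - 1)) = u powr t - (1 / t) * u powr t" using t by (simp add: field_simps)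
    ultimately have "(1 / t) * u powr t \<le> (1 / t) * (w * (\<integral>x. \<bar>h x\<bar> powr t * indicator (Dj j) x \<partial>M))" by linarith
    then have "u powr t \<le> w * (\<integral>x. \<bar>h x\<bar> powr t * indicator (Dj j) x \<partial>M)"
      by (rule mult_left_le_imp_le) (use t in simp)
    then show ?thesis by (simp only: u_def w_def)
  qed
  have "avg J (\<lambda>j. \<bar>coef j f / c\<bar> powr t) \<le> avg J (\<lambda>j. card J / \<delta> * (\<integral>x. \<bar>h x\<bar> powr t * indicator (Dj j) x \<partial>M))"
    by (intro avg_mono each)
  also have "\<dots> = (\<Sum>j\<in>J. \<integral>x. \<bar>h x\<bar> powr t * indicator (Dj j) x \<partial>M) / \<delta>"
    unfolding avg_cmult using card_J by (simp add: avg_def)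
  also have "(\<Sum>j\<in>J. \<integral>x. \<bar>h x\<bar> powr t * indicator (Dj j) x \<partial>M) = (\<integral>x. (\<Sum>j\<in>J. \<bar>h x\<bar> powr t * indicator (Dj j) x) \<partial>M)"
    by (rule Bochner_Integration.integral_sum[symmetric]) (intro int idx(2), auto)
  also have "\<dots> = (\<integral>x. \<bar>h x\<bar> powr t * indicator D x \<partial>M)"
    using indicator_idx[of _ "\<lambda>_. 1"] by (simp flip: sum_distrib_left)
  also have "\<dots> \<le> (\<integral>x. indicator D x * (1 + \<delta> * \<bar>f x / c\<bar> powr Q x) \<partial>M)"
  proof (rule integral_mono_AE[OF int Lvar_dominated(1)[OF f c]])
    show "AE x in M. \<bar>h x\<bar> powr t * indicator D x \<le> indicator D x * (1 + \<delta> * \<bar>f x / c\<bar> powr Q x)"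
      using Q_ge_1 t(2)
    proof eventually_elim
      case (elim x)
      show ?case
      proof (cases "x \<in> D")
        case True
        then have "\<bar>h x\<bar> powr t \<le> 1 + \<bar>h x\<bar> powr Q x" using elim t by (intro powr_le_one_plus_powr) auto
        then have "\<bar>h x\<bar> powr t \<le> 1 + \<delta> * \<bar>f x / c\<bar> powr Q x"
          by (simp only: h_def weight_powr[OF elim(1)])
        then show ?thesis using True by simp
      qed simp
    qed
  qed auto
  also have "\<dots> \<le> 2 * \<delta>" by (rule Lvar_dominated(2)[OF f c])
  finally show ?thesis using D by (simp add: divide_right_mono)
qed

end

section \<open>Admissible constants tested on finite matrices\<close>

definition ell :: "ennreal \<Rightarrow> nat \<Rightarrow> (nat \<Rightarrow> real) \<Rightarrow> real" where
  "ell r n a = ell_norm r n (\<lambda>k (_ :: unit). a k) ()"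

lemma ell_norm_eq_ell: "ell_norm r n f x = ell r n (\<lambda>k. f k x)"
  by (simp add: ell_def ell_norm_def)

lemma ell_eq_lnorm: "0 \<le> R \<Longrightarrow> ell (ennreal R) n a = lnorm R {1..n} a"
  by (simp add: ell_def ell_norm_eq_lnorm)

lemma ell_infinity: "ell \<infinity> n a = Max ((\<lambda>k. \<bar>a k\<bar>) ` {1..n})"
  by (simp add: ell_def ell_norm_def)

lemma ennreal_ge_1_cases:
  assumes "(1::ennreal) \<le> r"
  obtains "r = \<infinity>" | R where "r = ennreal R" "1 \<le> R"
proof (cases "r = \<infinity>")
  case False
  then have eq: "r = ennreal (enn2real r)" by (simp add: less_top)
  then have "1 \<le> ennreal (enn2real r)" using assms by simp
  then have "1 \<le> enn2real r" by simp
  then show thesis using that(2)[OF eq] by blast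
qed (rule that(1))

lemma ell_cmult:
  assumes r: "1 \<le> r" and n: "n \<ge> 1"
  shows "ell r n (\<lambda>k. c * a k) = \<bar>c\<bar> * ell r n a"
  using r
proof (cases rule: ennreal_ge_1_cases)
  case 1
  have "mono (\<lambda>z. \<bar>c\<bar> * z)" by (intro monoI mult_left_mono) auto
  from mono_Max_commute[OF this, of "(\<lambda>k. \<bar>a k\<bar>) ` {1..n}"]
  show ?thesis unfolding 1 ell_infinity using n by (simp add: image_image abs_mult)
next
  case (2 R)
  then show ?thesis by (simp add: ell_eq_lnorm lnorm_cmult)
qed

lemma ell_nonneg:
  assumes r: "1 \<le> r" and n: "n \<ge> 1" shows "0 \<le> ell r n a"
  using r
proof (cases rule: ennreal_ge_1_cases)
  case 1
  have "\<bar>a 1\<bar> \<le> ell r n a" unfolding 1 ell_infinity using n by (intro Max_ge) auto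
  then show ?thesis by linarith
next
  case (2 R)
  then show ?thesis by (simp add: ell_eq_lnorm)
qed

lemma abs_le_ell:
  assumes r: "1 \<le> r" and k: "k \<in> {1..n}" shows "\<bar>a k\<bar> \<le> ell r n a"
  using r
proof (cases rule: ennreal_ge_1_cases)
  case 1
  show ?thesis unfolding 1 ell_infinity using k by (intro Max_ge) auto
next
  case (2 R)
  then show ?thesis using k abs_le_lnorm[of R "{1..n}" k a] by (simp add: ell_eq_lnorm)
qed

definition admissible :: "'b measure \<Rightarrow> ('b \<Rightarrow> ennreal) \<Rightarrow> 'a measure \<Rightarrow> ('a \<Rightarrow> ennreal) \<Rightarrow> ennreal \<Rightarrow> real \<Rightarrow> bool" where
  "admissible M q N p r C \<longleftrightarrow> C \<ge> 1 \<and>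
     (\<forall>T n f. bounded_operator M q N p T \<longrightarrow> n \<ge> 1 \<longrightarrow> (\<forall>k\<in>{1..n}. f k \<in> Lvar M q) \<longrightarrow>
        Lvar_norm N p (ell_norm r n (\<lambda>k. T (f k)))
          \<le> C * operator_norm M q N p T * Lvar_norm M q (ell_norm r n f))"

lemma kconst_finiteE:
  assumes "kconst M q N p r < \<infinity>"
  obtains C where "admissible M q N p r C"
proof -
  have eq: "kconst M q N p r = Inf (ennreal ` Collect (admissible M q N p r))"
    by (simp add: kconst_def admissible_def[abs_def])
  have "Collect (admissible M q N p r) \<noteq> {}"
  proof
    assume "Collect (admissible M q N p r) = {}"
    then show False using assms unfolding eq by (simp only: image_empty Inf_empty infinity_ennreal_def less_irrefl)
  qed
  then show thesis using that by blast
qed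

lemma (in partitioned) emb_linear:
  "emb (\<lambda>j. a * v j + b * w j) x = a * emb v x + b * emb w x"
  by (simp add: emb_def algebra_simps)

text \<open>Makes the matrix \<open>K\<close> an operator: averaging over cells in the source,
  \<open>K\<close>, embedding in the target. \<kappa> is its norm for the exponents q1 and p1 over
  uniform distributions. The test family enters only through pointwise bounds \<open>U\<close> and
  \<open>V\<close>, which the variable exponents do not distort. The factor 6 is 2 from the
  coefficients times 3 from \<open>emb_moment\<close>.\<close>

lemma admissible_matrix_bound:
  fixes K :: "'i \<Rightarrow> 'j \<Rightarrow> real"
  assumes adm: "admissible M q N p r C" and r: "1 \<le> r"
    and S: "partitioned M q D J \<phi>" and Tg: "partitioned N p B I \<psi>"
    and q1: "1 < q1" "AE x in M. x \<in> D \<longrightarrow> q1 \<le> enn2real (q x)"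
    and p1: "0 < p1" "AE x in N. x \<in> B \<longrightarrow> enn2real (p x) \<le> p1"
    and \<kappa>: "0 < \<kappa>" "\<And>u. avg J (\<lambda>j. \<bar>u j\<bar> powr q1) \<le> 1 \<Longrightarrow> avg I (\<lambda>i. \<bar>\<Sum>j\<in>J. K i j * u j\<bar> powr p1) \<le> \<kappa> powr p1"
    and n: "n \<ge> 1" and U: "0 < U" "\<And>j. j \<in> J \<Longrightarrow> ell r n (\<lambda>k. u k j) \<le> U"
    and V: "\<And>i. i \<in> I \<Longrightarrow> V \<le> ell r n (\<lambda>k. \<Sum>j\<in>J. K i j * u k j)"
  shows "V \<le> 6 * C * \<kappa> * U"
proof -
  interpret S: partitioned M q D J \<phi> by (rule S)
  interpret Tg: partitioned N p B I \<psi> by (rule Tg)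
  define T where "T f = Tg.emb (\<lambda>i. \<Sum>j\<in>J. K i j * S.coef j f)" for f
  have norm: "Lvar_norm N p (T f) \<le> 6 * \<kappa> * Lvar_norm M q f" if f: "f \<in> Lvar M q" for f
  proof (rule le_mult_of_greater)
    fix c assume c: "Lvar_norm M q f < c"
    then have c0: "c > 0" using Lvar_norm_nonneg[OF S.q f] by simp
    \<comment> \<open>At scale c the q1-th moment is at most 2; the scale 2 c brings it below 1
      because 2^q1 >= 2.\<close>
    have "avg J (\<lambda>j. \<bar>S.coef j f / (2 * c)\<bar> powr q1) = (1 / 2 powr q1) * avg J (\<lambda>j. \<bar>S.coef j f / c\<bar> powr q1)"
      unfolding avg_cmult[symmetric] using c0
      by (intro avg_cong) (simp add: abs_divide powr_divide powr_mult abs_mult)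
    also have "\<dots> \<le> (1 / 2 powr q1) * 2" by (intro mult_left_mono S.coef_moment[OF f c q1]) auto
    also have "\<dots> \<le> 1" using powr_mono[of 1 q1 2] q1(1) by simp
    finally have "avg I (\<lambda>i. \<bar>\<Sum>j\<in>J. K i j * (S.coef j f / (2 * c))\<bar> powr p1) \<le> \<kappa> powr p1" by (rule \<kappa>(2))
    then have "(2 * c) powr p1 * avg I (\<lambda>i. \<bar>\<Sum>j\<in>J. K i j * (S.coef j f / (2 * c))\<bar> powr p1) \<le> (2 * c) powr p1 * \<kappa> powr p1"
      by (rule mult_left_mono) simp
    also have "(2 * c) powr p1 * avg I (\<lambda>i. \<bar>\<Sum>j\<in>J. K i j * (S.coef j f / (2 * c))\<bar> powr p1) = avg I (\<lambda>i. \<bar>\<Sum>j\<in>J. K i j * S.coef j f\<bar> powr p1)"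
      unfolding avg_cmult[symmetric]
    proof (rule avg_cong)
      fix i
      have "\<bar>\<Sum>j\<in>J. K i j * S.coef j f\<bar> = 2 * c * \<bar>\<Sum>j\<in>J. K i j * (S.coef j f / (2 * c))\<bar>"
        using c0 by (simp add: abs_divide flip: sum_divide_distrib)
      then show "(2 * c) powr p1 * \<bar>\<Sum>j\<in>J. K i j * (S.coef j f / (2 * c))\<bar> powr p1 = \<bar>\<Sum>j\<in>J. K i j * S.coef j f\<bar> powr p1"
        using c0 by (simp add: powr_mult)
    qed
    also have "(2 * c) powr p1 * \<kappa> powr p1 = (2 * c * \<kappa>) powr p1" using c0 \<kappa>(1) by (simp add: powr_mult)
    finally have "Lvar_norm N p (T f) \<le> 3 * (2 * c * \<kappa>)"
      unfolding T_def using c0 \<kappa>(1) by (intro Tg.emb_moment[OF p1(2)]) auto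
    then show "Lvar_norm N p (T f) \<le> 6 * \<kappa> * c" by (simp add: mult_ac)
  qed (use \<kappa> in simp)
  \<comment> \<open>One relation between coefficients serves additivity, homogeneity and
    compatibility with almost everywhere equality.\<close>
  have lin: "T h x = a * T f x + b * T g x"
    if "\<And>j. j \<in> J \<Longrightarrow> S.coef j h = a * S.coef j f + b * S.coef j g" for a b f g h x
  proof -
    have "(\<Sum>j\<in>J. K i j * S.coef j h) = a * (\<Sum>j\<in>J. K i j * S.coef j f) + b * (\<Sum>j\<in>J. K i j * S.coef j g)" for i
      using that by (simp add: sum_distrib_left sum.distrib[symmetric] distrib_left mult.left_commute)
    then show ?thesis unfolding T_def by (simp only: Tg.emb_linear)
  qed
  have bop: "bounded_operator M q N p T"
    unfolding bounded_operator_def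
  proof (intro conjI ballI allI impI)
    show "T f \<in> Lvar N p" for f unfolding T_def by (rule Tg.emb_Lvar)
    show "AE x in N. T f x = T g x" if "f \<in> Lvar M q" "g \<in> Lvar M q" "AE x in M. f x = g x" for f g
      using lin[of f 1 g 0 g] S.coef_cong_AE[OF that] by simp
    show "AE x in N. T (\<lambda>y. f y + g y) x = T f x + T g x" if "f \<in> Lvar M q" "g \<in> Lvar M q" for f g
      using lin[of "\<lambda>y. f y + g y" 1 f 1 g] S.coef_add[OF that] by simp
    show "AE x in N. T (\<lambda>y. c * f y) x = c * T f x" if "f \<in> Lvar M q" for f c
      using lin[of "\<lambda>y. c * f y" c f 0 f] S.coef_cmult by simp
    show "\<exists>C. \<forall>f\<in>Lvar M q. Lvar_norm N p (T f) \<le> C * Lvar_norm M q f" using norm by blast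
  qed
  have opn: "operator_norm M q N p T \<le> 6 * \<kappa>" using \<kappa>(1) norm by (intro operator_norm_le) auto
  define f where "f k = S.emb (u k)" for k
  have f: "\<forall>k\<in>{1..n}. f k \<in> Lvar M q" unfolding f_def by (simp add: S.emb_Lvar)
  \<comment> \<open>At each point the weight of \<open>emb\<close> is a common scalar, so the l^r
    norm passes inside the embedding.\<close>
  have F: "ell_norm r n f = S.emb (\<lambda>j. ell r n (\<lambda>k. u k j))"
  proof
    fix x
    have "f k x = indicator D x * S.\<delta> powr (- 1 / S.Q x) * u k (\<phi> x)" for k by (simp add: f_def S.emb_def)
    then show "ell_norm r n f x = S.emb (\<lambda>j. ell r n (\<lambda>k. u k j)) x"
      using ell_cmult[OF r n, of "indicator D x * S.\<delta> powr (- 1 / S.Q x)" "\<lambda>k. u k (\<phi> x)"]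
      by (simp add: ell_norm_eq_ell S.emb_def)
  qed
  have normF: "Lvar_norm M q (ell_norm r n f) \<le> U" "0 \<le> Lvar_norm M q (ell_norm r n f)"
    unfolding F using U ell_nonneg[OF r n] by (auto intro!: S.emb_upper(2) Lvar_norm_nonneg[OF S.q S.emb_Lvar])
  have G: "ell_norm r n (\<lambda>k. T (f k)) = Tg.emb (\<lambda>i. ell r n (\<lambda>k. \<Sum>j\<in>J. K i j * u k j))"
  proof
    fix x
    have "T (f k) x = indicator B x * Tg.\<delta> powr (- 1 / Tg.Q x) * (\<Sum>j\<in>J. K (\<psi> x) j * u k j)" for k
    proof -
      have "(\<Sum>j\<in>J. K i j * S.coef j (f k)) = (\<Sum>j\<in>J. K i j * u k j)" for i
        by (intro sum.cong) (auto simp: f_def S.coef_emb)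
      then show ?thesis by (simp add: T_def Tg.emb_def)
    qed
    then show "ell_norm r n (\<lambda>k. T (f k)) x = Tg.emb (\<lambda>i. ell r n (\<lambda>k. \<Sum>j\<in>J. K i j * u k j)) x"
      using ell_cmult[OF r n, of "indicator B x * Tg.\<delta> powr (- 1 / Tg.Q x)" "\<lambda>k. \<Sum>j\<in>J. K (\<psi> x) j * u k j"]
      by (simp add: ell_norm_eq_ell Tg.emb_def)
  qed
  have C: "C \<ge> 1" using adm by (simp add: admissible_def)
  have "V \<le> Lvar_norm N p (ell_norm r n (\<lambda>k. T (f k)))"
    unfolding G using V ell_nonneg[OF r n] by (intro Tg.emb_lower) auto
  also have "\<dots> \<le> C * operator_norm M q N p T * Lvar_norm M q (ell_norm r n f)"
    using adm bop n f unfolding admissible_def by blast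
  also have "\<dots> \<le> C * (6 * \<kappa>) * U"
    using C opn normF \<kappa>(1) by (intro mult_mono mult_left_mono) auto
  finally show ?thesis by (simp add: mult_ac)
qed

lemma exists_partitioned:
  assumes "sigma_finite_measure M" "nonatomic M" "q \<in> exponents M" "AE x in M. q x < \<infinity>"
    and X: "X \<in> sets M" "emeasure M X > 0" and J: "finite J" "J \<noteq> {}"
  shows "\<exists>D \<phi>. D \<subseteq> X \<and> partitioned M q D J \<phi>"
proof -
  interpret sigma_finite_measure M by fact
  \<comment> \<open>The weight in \<open>emb\<close> involves the measure of \<open>D\<close>, which
    must therefore be finite and positive; sigma-finiteness supplies such a subset when X is
    infinite.\<close>
  have "\<exists>D. D \<in> sets M \<and> D \<subseteq> X \<and> 0 < emeasure M D \<and> emeasure M D < \<infinity>"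
  proof (cases "emeasure M X = \<infinity>")
    case True
    obtain D where "D \<in> sets M" "D \<subseteq> X" "emeasure M D < \<infinity>" "emeasure M D > 1"
      using approx_PInf_emeasure_with_finite[OF X(1) True, of 1] by (auto simp: less_top)
    moreover from this have "0 < emeasure M D" by (meson less_trans zero_less_one)
    ultimately show ?thesis by blast
  next
    case False
    then show ?thesis using X by (intro exI[of _ X]) (auto simp: less_top)
  qed
  then obtain D where D: "D \<in> sets M" "D \<subseteq> X" "0 < emeasure M D" "emeasure M D < \<infinity>" by blast
  have Df: "D \<in> fmeasurable M" using D by (intro fmeasurableI) auto
  have "measure M D > 0" using D by (simp add: measure_def enn2real_positive_iff)
  moreover obtain \<phi> where "\<forall>x\<in>D. \<phi> x \<in> J"
      "\<forall>j\<in>J. {x\<in>D. \<phi> x = j} \<in> fmeasurable M \<and> measure M {x\<in>D. \<phi> x = j} = measure M D / card J"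
    using nonatomic_partition[OF assms(2) J Df] by blast
  ultimately have "partitioned M q D J \<phi>"
    using assms Df J by unfold_locales auto
  then show ?thesis using D(2) by blast
qed

lemma ell_le_if_lnorm:
  fixes r :: ennreal
  assumes "1 \<le> r" "n \<ge> 1" "\<And>k. k \<in> {1..n} \<Longrightarrow> \<bar>a k\<bar> \<le> 1"
  shows "ell r n a \<le> real n powr (if r = \<infinity> then 0 else 1 / enn2real r)"
  using assms(1)
proof (cases rule: ennreal_ge_1_cases)
  case 1
  show ?thesis unfolding 1 ell_infinity using assms by auto
next
  case (2 R)
  have "lnorm R {1..n} a \<le> lnorm R {1..n} (\<lambda>_. 1)" using 2 assms by (intro lnorm_mono) auto
  also have "\<dots> = real n powr (1 / R)" by (simp add: lnorm_def)
  finally show ?thesis using 2 by (simp add: ell_eq_lnorm)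
qed

text \<open>The columns of the matrix are a stable system, tested on unit vectors.\<close>

lemma column_matrix_bound:
  fixes \<theta> :: "nat \<Rightarrow> 'w \<Rightarrow> real"
  assumes adm: "admissible M q N p (ennreal r) C" and r: "1 \<le> r"
    and S: "partitioned M q D {..<m} \<phi>" and Tg: "partitioned N p B \<Omega> \<psi>"
    and q1: "1 < q1" "AE x in M. x \<in> D \<longrightarrow> q1 \<le> enn2real (q x)"
    and p1: "1 \<le> p1" "AE x in N. x \<in> B \<longrightarrow> enn2real (p x) \<le> p1"
    and m: "m \<ge> 1" and s: "0 < s" and C0: "1 \<le> C0"
    and sys: "\<And>a. avg \<Omega> (\<lambda>\<omega>. \<bar>\<Sum>k<m. a k * \<theta> k \<omega>\<bar> powr p1) \<le> C0 * lnorm s {..<m} a powr p1"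
    and V: "\<And>\<omega>. \<omega> \<in> \<Omega> \<Longrightarrow> V \<le> lnorm r {..<m} (\<lambda>k. \<theta> k \<omega>)"
  shows "V \<le> 6 * C * C0 * m powr (1 / min s q1)"
proof -
  have reindex: "lnorm r {1..m} a = lnorm r {..<m} (\<lambda>k. a (Suc k))" for a
    by (simp add: lnorm_def sum.atLeast1_atMost_eq)
  have "V \<le> 6 * C * (C0 * m powr (1 / min s q1)) * 1"
  \<comment> \<open>Families in \<open>admissible\<close> are indexed by {1..m}, the columns by
    {..<m}; hence the unit vectors test \<open>Suc j = k\<close>.\<close>
  proof (rule admissible_matrix_bound[OF adm _ S Tg q1 _ p1(2), where K = "\<lambda>\<omega> k. \<theta> k \<omega>" and u = "\<lambda>k j. if Suc j = k then 1 else 0"])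
    show "0 < C0 * m powr (1 / min s q1)" using C0 m by simp
    fix u assume "avg {..<m} (\<lambda>j. \<bar>u j\<bar> powr q1) \<le> 1"
    then have "(\<Sum>j<m. \<bar>u j\<bar> powr q1) \<le> m" using m by (simp add: avg_def divide_le_eq)
    then have u: "lnorm q1 {..<m} u \<le> m powr (1 / q1)"
      unfolding lnorm_def using q1(1) by (intro powr_mono2 sum_nonneg) auto
    \<comment> \<open>The normalised unit ball has radius m^(1 / q1) in l^q1. Passing to l^s costs
      nothing if q1 <= s and the factor m^(1/s - 1/q1) otherwise.\<close>
    have "lnorm s {..<m} u \<le> m powr (1 / min s q1)"
    proof (cases "q1 \<le> s")
      case True
      then show ?thesis using lnorm_antimono[of q1 s "{..<m}" u] u q1(1) by (simp add: min_def)
    next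
      case False
      have "lnorm s {..<m} u \<le> m powr (1 / s - 1 / q1) * lnorm q1 {..<m} u"
        using lnorm_le_card[of s q1 "{..<m}" u] False s m by (simp add: lessThan_empty_iff)
      also have "\<dots> \<le> m powr (1 / s - 1 / q1) * m powr (1 / q1)" using u by (intro mult_left_mono) auto
      also have "\<dots> = m powr (1 / s)" by (simp flip: powr_add)
      finally show ?thesis using False by simp
    qed
    then have "C0 * lnorm s {..<m} u powr p1 \<le> C0 powr p1 * (m powr (1 / min s q1)) powr p1"
      using C0 p1(1) powr_mono[of 1 p1 C0] by (intro mult_mono powr_mono2) auto
    then show "avg \<Omega> (\<lambda>i. \<bar>\<Sum>j<m. \<theta> j i * u j\<bar> powr p1) \<le> (C0 * m powr (1 / min s q1)) powr p1"
      using sys[of u] C0 by (simp add: powr_mult mult.commute)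
  next
    fix j assume j: "j \<in> {..<m}"
    have "lnorm r {1..m} (\<lambda>k. if Suc j = k then 1 else 0) = 1"
    proof -
      have "(\<Sum>k<m. \<bar>if Suc j = Suc k then 1 else 0\<bar> powr r) = (\<Sum>k<m. if k = j then 1 else 0)"
        using r by (intro sum.cong) auto
      then have "lnorm r {..<m} (\<lambda>k. if Suc j = Suc k then 1 else 0) = 1"
        unfolding lnorm_def using j by simp
      then show ?thesis by (simp only: reindex)
    qed
    then show "ell (ennreal r) m (\<lambda>k. if Suc j = k then 1 else 0) \<le> 1" using r by (simp add: ell_eq_lnorm)
  next
    fix \<omega> assume \<omega>: "\<omega> \<in> \<Omega>"
    have "(\<Sum>j<m. \<theta> j \<omega> * (if Suc j = Suc k then 1 else 0)) = \<theta> k \<omega>" if "k < m" for k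
    proof -
      have "(\<Sum>j<m. \<theta> j \<omega> * (if Suc j = Suc k then 1 else 0)) = (\<Sum>j<m. if j = k then \<theta> k \<omega> else 0)"
        by (intro sum.cong) auto
      then show ?thesis using that by simp
    qed
    then have "lnorm r {1..m} (\<lambda>k. \<Sum>j<m. \<theta> j \<omega> * (if Suc j = k then 1 else 0)) = lnorm r {..<m} (\<lambda>k. \<theta> k \<omega>)"
      unfolding reindex by (intro lnorm_cong) auto
    then show "V \<le> ell (ennreal r) m (\<lambda>k. \<Sum>j<m. \<theta> j \<omega> * (if Suc j = k then 1 else 0))"
      using V[OF \<omega>] r by (simp add: ell_eq_lnorm)
  qed (use r m p1 in auto)
  then show ?thesis by (simp add: mult_ac)
qed

text \<open>The transposed matrix acts by averages against \<theta>. Its norm is found by duality: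
  pairing with a norming sequence \<open>b\<close> leads back to the combinations \<Sum> b_k
  \<theta>_k, whose moments of the conjugate order of q1 are controlled. The lower bound uses
  diagonal entries only.\<close>

lemma row_matrix_bound:
  fixes \<theta> :: "nat \<Rightarrow> 'w \<Rightarrow> real"
  assumes adm: "admissible M q N p r C" and r: "1 \<le> r"
    and S: "partitioned M q D \<Omega> \<phi>" and Tg: "partitioned N p B {..<m} \<psi>"
    and q1: "1 < q1" "AE x in M. x \<in> D \<longrightarrow> q1 \<le> enn2real (q x)"
    and p1: "1 \<le> p1" "AE x in N. x \<in> B \<longrightarrow> enn2real (p x) \<le> p1"
    and m: "m \<ge> 1" and s: "1 < s" and C0: "1 \<le> C0"
    and sys: "\<And>a. avg \<Omega> (\<lambda>\<omega>. \<bar>\<Sum>k<m. a k * \<theta> k \<omega>\<bar> powr (q1 / (q1 - 1))) \<le> C0 * lnorm s {..<m} a powr (q1 / (q1 - 1))"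
    and U: "0 < U" "\<And>\<omega>. \<omega> \<in> \<Omega> \<Longrightarrow> ell r m (\<lambda>k. w (k - 1) \<omega>) \<le> U"
    and V: "\<And>i. i < m \<Longrightarrow> V \<le> avg \<Omega> (\<lambda>\<omega>. \<theta> i \<omega> * w i \<omega>)"
  shows "V \<le> 6 * C * C0 * m powr (- 1 / max p1 (s / (s - 1))) * U"
proof -
  interpret S: partitioned M q D \<Omega> \<phi> by (rule S)
  define t where "t = q1 / (q1 - 1)"
  define s' where "s' = s / (s - 1)"
  have t: "1 < t" "1 / q1 + 1 / t = 1" using q1(1) by (auto simp: t_def field_simps)
  have s': "1 < s'" "1 / s' + 1 / s = 1" using s by (auto simp: s'_def field_simps)
  have card: "real (card \<Omega>) > 0" by (rule S.card_J)
  have "V \<le> 6 * C * (C0 * m powr (- 1 / max p1 s')) * U"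
  proof (rule admissible_matrix_bound[OF adm r S Tg q1 _ p1(2), where K = "\<lambda>k \<omega>. \<theta> k \<omega> / card \<Omega>" and u = "\<lambda>k \<omega>. w (k - 1) \<omega>"])
    show "0 < C0 * m powr (- 1 / max p1 s')" using C0 m by simp
    fix u assume u: "avg \<Omega> (\<lambda>\<omega>. \<bar>u \<omega>\<bar> powr q1) \<le> 1"
    define a where "a k = avg \<Omega> (\<lambda>\<omega>. \<theta> k \<omega> * u \<omega>)" for k
    \<comment> \<open>Norms \<open>a\<close> in the duality of l^s' and l^s: both a_k b_k and
      |b_k|^s equal |a_k|^s'.\<close>
    define b where "b k = \<bar>a k\<bar> powr (s' - 1) * sgn (a k)" for k
    define X where "X = (\<Sum>k<m. \<bar>a k\<bar> powr s')"
    have X0: "0 \<le> X" by (simp add: X_def sum_nonneg)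
    have ab: "a k * b k = \<bar>a k\<bar> powr s'" for k
    proof (cases "a k = 0")
      case False
      have "a k * b k = \<bar>a k\<bar> powr (s' - 1) * \<bar>a k\<bar>" by (simp add: b_def abs_sgn)
      also have "\<dots> = \<bar>a k\<bar> powr s'" using False by (simp add: powr_diff)
      finally show ?thesis .
    qed (use s' in simp)
    have bs: "\<bar>b k\<bar> powr s = \<bar>a k\<bar> powr s'" for k
    proof (cases "a k = 0")
      case False
      have "(s' - 1) * s = s'" using s by (simp add: s'_def field_simps)
      then show ?thesis using False by (simp add: b_def abs_mult abs_sgn_eq powr_powr)
    qed (use s' s in \<open>simp add: b_def\<close>)
    have avg_Holder: "\<bar>avg \<Omega> (\<lambda>\<omega>. u \<omega> * v \<omega>)\<bar> \<le> avg \<Omega> (\<lambda>\<omega>. \<bar>u \<omega>\<bar> powr q1) powr (1 / q1) * avg \<Omega> (\<lambda>\<omega>. \<bar>v \<omega>\<bar> powr t) powr (1 / t)" for v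
    proof -
      have "\<bar>avg \<Omega> (\<lambda>\<omega>. u \<omega> * v \<omega>)\<bar> \<le> lnorm q1 \<Omega> u * lnorm t \<Omega> v / card \<Omega>"
        unfolding avg_def using lnorm_Holder[OF q1(1) t(1,2) S.J(1), of u v] card
        by (simp add: abs_divide divide_right_mono)
      also have "real (card \<Omega>) = real (card \<Omega>) powr (1 / q1) * real (card \<Omega>) powr (1 / t)"
        using card t(2) by (simp flip: powr_add)
      also have "lnorm q1 \<Omega> u * lnorm t \<Omega> v / (real (card \<Omega>) powr (1 / q1) * real (card \<Omega>) powr (1 / t)) =
          avg \<Omega> (\<lambda>\<omega>. \<bar>u \<omega>\<bar> powr q1) powr (1 / q1) * avg \<Omega> (\<lambda>\<omega>. \<bar>v \<omega>\<bar> powr t) powr (1 / t)"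
        by (simp add: lnorm_def avg_def powr_divide sum_nonneg)
      finally show ?thesis .
    qed
    have "X = (\<Sum>k<m. b k * a k)" by (simp add: X_def ab[symmetric] mult.commute)
    also have "\<dots> = avg \<Omega> (\<lambda>\<omega>. \<Sum>k<m. b k * (\<theta> k \<omega> * u \<omega>))" by (simp only: avg_sum avg_cmult a_def)
    also have "\<dots> = avg \<Omega> (\<lambda>\<omega>. u \<omega> * (\<Sum>k<m. b k * \<theta> k \<omega>))"
      by (intro avg_cong) (simp add: sum_distrib_left mult_ac)
    also have "\<dots> \<le> avg \<Omega> (\<lambda>\<omega>. \<bar>u \<omega>\<bar> powr q1) powr (1 / q1) * avg \<Omega> (\<lambda>\<omega>. \<bar>\<Sum>k<m. b k * \<theta> k \<omega>\<bar> powr t) powr (1 / t)"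
      using avg_Holder[of "\<lambda>\<omega>. \<Sum>k<m. b k * \<theta> k \<omega>"] by linarith
    also have "\<dots> \<le> 1 * (C0 * lnorm s {..<m} b powr t) powr (1 / t)"
    proof (intro mult_mono)
      have "avg \<Omega> (\<lambda>\<omega>. \<bar>u \<omega>\<bar> powr q1) powr (1 / q1) \<le> 1 powr (1 / q1)"
        using u q1(1) by (intro powr_mono2 avg_nonneg) auto
      then show "avg \<Omega> (\<lambda>\<omega>. \<bar>u \<omega>\<bar> powr q1) powr (1 / q1) \<le> 1" by simp
      show "avg \<Omega> (\<lambda>\<omega>. \<bar>\<Sum>k<m. b k * \<theta> k \<omega>\<bar> powr t) powr (1 / t) \<le> (C0 * lnorm s {..<m} b powr t) powr (1 / t)"
        using sys[of b] t(1) unfolding t_def[symmetric] by (intro powr_mono2 avg_nonneg) auto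
    qed auto
    also have "\<dots> = C0 powr (1 / t) * lnorm s {..<m} b" using C0 t(1) by (simp add: powr_mult powr_powr)
    also have "\<dots> \<le> C0 * lnorm s {..<m} b" using C0 t(1) powr_mono[of "1 / t" 1 C0] by (intro mult_right_mono) auto
    also have "lnorm s {..<m} b = X powr (1 / s)" by (simp add: lnorm_def bs X_def)
    finally have XC: "X \<le> C0 * X powr (1 / s)" .
    have as': "lnorm s' {..<m} a \<le> C0"
    proof (cases "X = 0")
      case True
      then show ?thesis using C0 by (simp add: lnorm_def X_def)
    next
      case False
      then have Xp: "X > 0" using X0 by simp
      have e: "1 / s' = 1 - 1 / s" using s'(2) by simp
      have "X powr (1 / s') * X powr (1 / s) = X" using Xp s'(2) by (simp flip: powr_add)
      then have "X powr (1 / s') * X powr (1 / s) \<le> C0 * X powr (1 / s)" using XC by simp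
      then have "X powr (1 / s') \<le> C0" using Xp by simp
      then show ?thesis by (simp add: lnorm_def X_def)
    qed
    \<comment> \<open>From l^s' to l^p1; after dividing by m^(1 / p1) for the average over the rows,
      m^(-1 / max p1 s') remains.\<close>
    have ap: "lnorm p1 {..<m} a \<le> m powr (1 / p1 - 1 / max p1 s') * C0"
    proof (cases "s' \<le> p1")
      case True
      then show ?thesis using lnorm_antimono[of s' p1 "{..<m}" a] as' s'(1) m by (simp add: max_def)
    next
      case False
      have "lnorm p1 {..<m} a \<le> m powr (1 / p1 - 1 / s') * lnorm s' {..<m} a"
        using lnorm_le_card[of p1 s' "{..<m}" a] False p1(1) m by (simp add: lessThan_empty_iff)
      also have "\<dots> \<le> m powr (1 / p1 - 1 / s') * C0" using as' by (intro mult_left_mono) auto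
      finally show ?thesis using False by simp
    qed
    have "avg {..<m} (\<lambda>k. \<bar>a k\<bar> powr p1) = lnorm p1 {..<m} a powr p1 / m"
      using p1(1) by (simp add: avg_def lnorm_powr)
    also have "\<dots> \<le> (m powr (1 / p1 - 1 / max p1 s') * C0) powr p1 / m"
      using ap p1(1) by (intro divide_right_mono powr_mono2) auto
    also have "\<dots> = (C0 * m powr (- 1 / max p1 s')) powr p1"
    proof -
      have "(m powr (1 / p1 - 1 / max p1 s') * C0) powr p1 / m = ((m powr (1 / p1) * m powr (- 1 / max p1 s')) * C0) powr p1 / m"
        by (simp flip: powr_add)
      also have "\<dots> = m * (m powr (- 1 / max p1 s') * C0) powr p1 / m"
        using C0 p1(1) by (simp add: powr_mult powr_powr)
      finally show ?thesis using m by (simp add: mult.commute)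
    qed
    finally show "avg {..<m} (\<lambda>i. \<bar>\<Sum>j\<in>\<Omega>. \<theta> i j / card \<Omega> * u j\<bar> powr p1) \<le> (C0 * m powr (- 1 / max p1 s')) powr p1"
      by (simp add: a_def avg_def sum_divide_distrib)
  next
    fix i assume i: "i \<in> {..<m}"
    have "V \<le> avg \<Omega> (\<lambda>\<omega>. \<theta> i \<omega> * w i \<omega>)" using V i by simp
    also have "\<dots> = (\<Sum>\<omega>\<in>\<Omega>. \<theta> i \<omega> / card \<Omega> * w (Suc i - 1) \<omega>)" by (simp add: avg_def sum_divide_distrib)
    also have "\<dots> \<le> ell r m (\<lambda>k. \<Sum>\<omega>\<in>\<Omega>. \<theta> i \<omega> / card \<Omega> * w (k - 1) \<omega>)"
      using abs_le_ell[OF r, of "Suc i" m "\<lambda>k. \<Sum>\<omega>\<in>\<Omega>. \<theta> i \<omega> / card \<Omega> * w (k - 1) \<omega>"] i by auto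
    finally show "V \<le> ell r m (\<lambda>k. \<Sum>\<omega>\<in>\<Omega>. \<theta> i \<omega> / card \<Omega> * w (k - 1) \<omega>)" .
  qed (use m p1 U in auto)
  then show ?thesis by (simp add: s'_def mult_ac)
qed

section \<open>Choice of sets, sizes and exponents\<close>

lemma exists_target_partition:
  assumes "sigma_finite_measure \<nu>" "nonatomic \<nu>" and p: "p \<in> bounded_exponents \<nu>"
    and P1: "essinf \<nu> p = ennreal P1" "P1 < p1" "0 < p1" and I: "finite I" "I \<noteq> {}"
  shows "\<exists>B \<psi>. partitioned \<nu> p B I \<psi> \<and> (AE y in \<nu>. y \<in> B \<longrightarrow> enn2real (p y) \<le> p1)"
proof -
  obtain P2 where pe: "p \<in> exponents \<nu>" and P2: "AE x in \<nu>. p x \<le> ennreal P2"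
    using p by (rule bounded_exponentsE) (auto elim: eventually_mono)
  note [measurable] = exponents_measurable[OF pe]
  define X where "X = {y \<in> space \<nu>. p y < ennreal p1}"
  have X: "X \<in> sets \<nu>" unfolding X_def by measurable
  \<comment> \<open>Otherwise p1, which exceeds the essential infimum, would be a lower bound almost
    everywhere.\<close>
  have "emeasure \<nu> X \<noteq> 0"
  proof
    assume "emeasure \<nu> X = 0"
    then have "AE y in \<nu>. y \<notin> X" using X by (intro AE_not_in) auto
    then have "AE y in \<nu>. ennreal p1 \<le> p y" using AE_space by eventually_elim (auto simp: X_def)
    then have "ennreal p1 \<le> essinf \<nu> p" unfolding essinf_def by (intro Sup_upper) simp
    then show False using P1 by (simp add: ennreal_le_iff2)
  qed
  then have "0 < emeasure \<nu> X" by (simp add: zero_less_iff_neq_zero)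
  then obtain B \<psi> where B: "B \<subseteq> X" "partitioned \<nu> p B I \<psi>"
    using exists_partitioned[OF assms(1,2) pe AE_finite_exponent[OF P2] X _ I] by blast
  have "enn2real (p y) \<le> p1" if "y \<in> B" for y
  proof -
    have "p y < ennreal p1" using that B(1) by (auto simp: X_def)
    then have "enn2real (p y) \<le> enn2real (ennreal p1)" by (intro enn2real_mono) auto
    then show ?thesis using P1(3) by simp
  qed
  then show ?thesis using B(2) by blast
qed

lemma exists_source_partition:
  assumes "sigma_finite_measure \<mu>" "nonatomic \<mu>" and q: "q \<in> bounded_exponents \<mu>"
    and Q2: "esssup \<mu> q = ennreal Q2" "q1 < Q2" "0 \<le> q1" and J: "finite J" "J \<noteq> {}"
  shows "\<exists>D \<phi>. partitioned \<mu> q D J \<phi> \<and> (AE x in \<mu>. x \<in> D \<longrightarrow> q1 \<le> enn2real (q x))"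
proof -
  obtain P2 where qe: "q \<in> exponents \<mu>" and P2: "AE x in \<mu>. q x \<le> ennreal P2"
    using q by (rule bounded_exponentsE) (auto elim: eventually_mono)
  note [measurable] = exponents_measurable[OF qe]
  define X where "X = {x \<in> space \<mu>. ennreal q1 < q x}"
  have X: "X \<in> sets \<mu>" unfolding X_def by measurable
  have "0 < emeasure \<mu> X"
    unfolding X_def using Q2 by (intro esssup_pos_measure) (auto simp: ennreal_less_iff)
  then obtain D \<phi> where D: "D \<subseteq> X" "partitioned \<mu> q D J \<phi>"
    using exists_partitioned[OF assms(1,2) qe AE_finite_exponent[OF P2] X _ J] by blast
  have "AE x in \<mu>. x \<in> D \<longrightarrow> q1 \<le> enn2real (q x)"
    using AE_finite_exponent[OF P2]
  proof eventually_elim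
    case (elim x)
    show ?case
    proof
      assume "x \<in> D"
      then have "ennreal q1 \<le> q x" using D(1) by (auto simp: X_def)
      then have "enn2real (ennreal q1) \<le> enn2real (q x)" using elim by (intro enn2real_mono) auto
      then show "q1 \<le> enn2real (q x)" using Q2(3) by simp
    qed
  qed
  then show ?thesis using D(2) by blast
qed

lemma exists_nat_powr_greater:
  assumes "\<alpha> > (0::real)" obtains m :: nat where "m \<ge> 1" "X < real m powr \<alpha>"
proof -
  obtain m :: nat where m: "max 1 X powr (1 / \<alpha>) < m" using reals_Archimedean2 by blast
  have "X \<le> (max 1 X powr (1 / \<alpha>)) powr \<alpha>" using assms by (simp add: powr_powr)
  also have "\<dots> < real m powr \<alpha>" using m assms by (intro powr_less_mono2) auto
  finally have "X < real m powr \<alpha>" .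
  moreover have "0 < real m" using m by (rule le_less_trans[rotated]) simp
  ultimately show thesis by (intro that[of m]) simp_all
qed

lemma exists_harm_powr_greater:
  assumes "\<alpha> > (0::real)" obtains m :: nat where "m \<ge> 1" "X < harm m powr \<alpha>"
proof -
  have "\<forall>\<^sub>F m in sequentially. max 1 X powr (1 / \<alpha>) < (harm m :: real)"
    using harm_at_top by (rule filterlim_at_top_dense[THEN iffD1, rule_format])
  then have "\<forall>\<^sub>F m in sequentially. max 1 X powr (1 / \<alpha>) < (harm m :: real) \<and> 1 \<le> m"
    using eventually_ge_at_top by (rule eventually_conj)
  then obtain m :: nat where m: "max 1 X powr (1 / \<alpha>) < harm m" "1 \<le> m"
    using eventually_happens'[OF sequentially_bot] by blast
  have "X \<le> (max 1 X powr (1 / \<alpha>)) powr \<alpha>" using assms by (simp add: powr_powr)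
  also have "\<dots> < harm m powr \<alpha>" using m assms by (intro powr_less_mono2) auto
  finally show thesis using that m(2) by blast
qed

text \<open>For fixed m both powers are continuous in x and equal 1 at x = r. This pays for
  replacing an end point exponent by a nearby one.\<close>

lemma eventually_powr_close:
  assumes "0 < (r::real)" "m \<ge> (1::real)"
  shows "\<forall>\<^sub>F x in at r. m powr (1 / x - 1 / r) \<le> 2" "\<forall>\<^sub>F x in at r. m powr (1 / r - 1 / x) \<le> 2"
proof -
  have "((\<lambda>x. m powr (1 / x - 1 / r)) \<longlongrightarrow> m powr (1 / r - 1 / r)) (at r)"
    using assms by (intro tendsto_intros) auto
  then have "\<forall>\<^sub>F x in at r. m powr (1 / x - 1 / r) < 2" using assms by (intro order_tendstoD(2)) auto
  then show "\<forall>\<^sub>F x in at r. m powr (1 / x - 1 / r) \<le> 2" by (rule eventually_mono) simp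
  have "((\<lambda>x. m powr (1 / r - 1 / x)) \<longlongrightarrow> m powr (1 / r - 1 / r)) (at r)"
    using assms by (intro tendsto_intros) auto
  then have "\<forall>\<^sub>F x in at r. m powr (1 / r - 1 / x) < 2" using assms by (intro order_tendstoD(2)) auto
  then show "\<forall>\<^sub>F x in at r. m powr (1 / r - 1 / x) \<le> 2" by (rule eventually_mono) simp
qed

lemma exists_close_below:
  assumes "a < r" "0 < r" "m \<ge> (1::real)"
  obtains x where "a < x" "x < r" "m powr (1 / x - 1 / r) \<le> 2"
proof -
  have "\<forall>\<^sub>F x in at_left r. m powr (1 / x - 1 / r) \<le> 2"
    using eventually_powr_close(1)[OF assms(2,3)] by (simp add: eventually_at_split)
  moreover have "\<forall>\<^sub>F x in at_left r. x \<in> {a<..<r}" using assms by (intro eventually_at_leftI[of a]) auto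
  ultimately have "\<forall>\<^sub>F x in at_left r. m powr (1 / x - 1 / r) \<le> 2 \<and> x \<in> {a<..<r}" by (rule eventually_conj)
  then obtain x where "m powr (1 / x - 1 / r) \<le> 2" "x \<in> {a<..<r}"
    using eventually_happens'[OF trivial_limit_at_left_real] by blast
  then show thesis using that by auto
qed

lemma exists_close_above:
  assumes "0 < r" "m \<ge> (1::real)"
  obtains x where "r < x" "m powr (1 / r - 1 / x) \<le> 2"
proof -
  have "\<forall>\<^sub>F x in at_right r. m powr (1 / r - 1 / x) \<le> 2"
    using eventually_powr_close(2)[OF assms(1,2)] by (simp add: eventually_at_split)
  moreover have "\<forall>\<^sub>F x in at_right r. x \<in> {r<..<r + 1}" by (intro eventually_at_rightI[of _ "r + 1"]) auto
  ultimately have "\<forall>\<^sub>F x in at_right r. m powr (1 / r - 1 / x) \<le> 2 \<and> x \<in> {r<..<r + 1}" by (rule eventually_conj)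
  then obtain x where "m powr (1 / r - 1 / x) \<le> 2" "x \<in> {r<..<r + 1}"
    using eventually_happens'[OF trivial_limit_at_right_real] by blast
  then show thesis using that by auto
qed

section \<open>Failure outside the interval\<close>

locale nonatomic_exponents =
  fixes \<nu> :: "'a measure" and \<mu> :: "'b measure" and p :: "'a \<Rightarrow> ennreal" and q :: "'b \<Rightarrow> ennreal" and P Q :: real
  assumes \<nu>: "sigma_finite_measure \<nu>" "nonatomic \<nu>" and \<mu>: "sigma_finite_measure \<mu>" "nonatomic \<mu>"
    and p: "p \<in> bounded_exponents \<nu>" "essinf \<nu> p = ennreal P" "1 < P"
    and q: "q \<in> bounded_exponents \<mu>" "esssup \<mu> q = ennreal Q" "1 < Q"
begin

lemma column_bound:
  fixes \<theta> :: "nat \<Rightarrow> 'w \<Rightarrow> real"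
  assumes "admissible \<mu> q \<nu> p (ennreal r) C" "1 \<le> r" "1 < q1" "q1 < Q" "P < p1" "m \<ge> 1" "0 < s" "1 \<le> C0"
    and \<Omega>: "finite \<Omega>" "\<Omega> \<noteq> {}"
    and sys: "\<And>a. avg \<Omega> (\<lambda>\<omega>. \<bar>\<Sum>k<m. a k * \<theta> k \<omega>\<bar> powr p1) \<le> C0 * lnorm s {..<m} a powr p1"
    and V: "\<And>\<omega>. \<omega> \<in> \<Omega> \<Longrightarrow> V \<le> lnorm r {..<m} (\<lambda>k. \<theta> k \<omega>)"
  shows "V \<le> 6 * C * C0 * m powr (1 / min s q1)"
proof -
  have J: "finite {..<m}" "{..<m} \<noteq> {}" using assms by (auto simp: lessThan_empty_iff)
  obtain B \<psi> where "partitioned \<nu> p B \<Omega> \<psi>" "AE y in \<nu>. y \<in> B \<longrightarrow> enn2real (p y) \<le> p1"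
    using exists_target_partition[OF \<nu> p(1,2) _ _ \<Omega>, of p1] assms p(3) by auto
  moreover obtain D \<phi> where "partitioned \<mu> q D {..<m} \<phi>" "AE x in \<mu>. x \<in> D \<longrightarrow> q1 \<le> enn2real (q x)"
    using exists_source_partition[OF \<mu> q(1,2) _ _ J, of q1] assms by auto
  ultimately show ?thesis
    using assms p(3) by (intro column_matrix_bound[of \<mu> q \<nu> p r C D m \<phi> B \<Omega> \<psi> q1 p1 s C0 \<theta> V]) auto
qed

lemma row_bound:
  fixes \<theta> :: "nat \<Rightarrow> 'w \<Rightarrow> real"
  assumes "admissible \<mu> q \<nu> p r C" "1 \<le> r" "1 < q1" "q1 < Q" "P < p1" "m \<ge> 1" "1 < s" "1 \<le> C0"
    and \<Omega>: "finite \<Omega>" "\<Omega> \<noteq> {}"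
    and sys: "\<And>a. avg \<Omega> (\<lambda>\<omega>. \<bar>\<Sum>k<m. a k * \<theta> k \<omega>\<bar> powr (q1 / (q1 - 1))) \<le> C0 * lnorm s {..<m} a powr (q1 / (q1 - 1))"
    and U: "0 < U" "\<And>\<omega>. \<omega> \<in> \<Omega> \<Longrightarrow> ell r m (\<lambda>k. w (k - 1) \<omega>) \<le> U"
    and V: "\<And>i. i < m \<Longrightarrow> V \<le> avg \<Omega> (\<lambda>\<omega>. \<theta> i \<omega> * w i \<omega>)"
  shows "V \<le> 6 * C * C0 * m powr (- 1 / max p1 (s / (s - 1))) * U"
proof -
  have I: "finite {..<m}" "{..<m} \<noteq> {}" using assms by (auto simp: lessThan_empty_iff)
  obtain B \<psi> where "partitioned \<nu> p B {..<m} \<psi>" "AE y in \<nu>. y \<in> B \<longrightarrow> enn2real (p y) \<le> p1"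
    using exists_target_partition[OF \<nu> p(1,2) _ _ I, of p1] assms p(3) by auto
  moreover obtain D \<phi> where "partitioned \<mu> q D \<Omega> \<phi>" "AE x in \<mu>. x \<in> D \<longrightarrow> q1 \<le> enn2real (q x)"
    using exists_source_partition[OF \<mu> q(1,2) _ _ \<Omega>, of q1] assms by auto
  ultimately show ?thesis
    using assms p(3) by (intro row_matrix_bound[of \<mu> q \<nu> p r C D \<Omega> \<phi> B m \<psi> q1 p1 s C0 \<theta> U w V]) auto
qed

text \<open>Rademacher columns: their l^r norm is m^(1 / r) for every sign pattern, whereas the
  operator side allows only order m^(1 / min 2 q1). With r < 2 and r < q1 this fails for large
  m.\<close>

lemma not_admissible_below:
  assumes r: "1 \<le> r" "r < 2" "r < Q" shows "\<not> admissible \<mu> q \<nu> p (ennreal r) C"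
proof
  assume adm: "admissible \<mu> q \<nu> p (ennreal r) C"
  define q1 where "q1 = (r + Q) / 2"
  have q1: "r < q1" "q1 < Q" using r by (auto simp: q1_def)
  \<comment> \<open>Any p1 above P would do, as Rademacher sums have all moments.\<close>
  have "0 < P + 1" using p(3) by simp
  from khinchine_upper[OF this] obtain C0 where C0: "C0 \<ge> 1" "\<And>(S :: nat set) a. finite S \<Longrightarrow>
      avg (Pow S) (\<lambda>A. \<bar>\<Sum>k\<in>S. a k * eps k A\<bar> powr (P + 1)) \<le> C0 * lnorm 2 S a powr (P + 1)" by blast
  have "1 / min 2 q1 < 1 / r" using r q1 by (intro divide_strict_left_mono) auto
  then have "0 < 1 / r - 1 / min 2 q1" by simp
  then obtain m :: nat where m: "m \<ge> 1" "6 * C * C0 < real m powr (1 / r - 1 / min 2 q1)"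
    by (rule exists_nat_powr_greater)
  have "real m powr (1 / r) \<le> 6 * C * C0 * real m powr (1 / min 2 q1)"
  proof (rule column_bound[OF adm, where \<theta> = eps and \<Omega> = "Pow {..<m}" and ?p1.0 = "P + 1"])
    show "avg (Pow {..<m}) (\<lambda>\<omega>. \<bar>\<Sum>k<m. a k * eps k \<omega>\<bar> powr (P + 1)) \<le> C0 * lnorm 2 {..<m} a powr (P + 1)" for a
      by (rule C0(2)) simp
    show "real m powr (1 / r) \<le> lnorm r {..<m} (\<lambda>k. eps k \<omega>)" for \<omega> :: "nat set"
      by (simp add: lnorm_def)
  qed (use r q1 m C0 in auto)
  then have "real m powr (1 / r) / real m powr (1 / min 2 q1) \<le> 6 * C * C0"
    using m(1) by (simp add: divide_le_eq)
  then show False using m by (simp add: powr_diff)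
qed

text \<open>Transposed signs with \<open>w = eps\<close>: the diagonal averages are 1, the l^r norms
  of the signs are at most m^(1 / r), and the operator norm is of order m^(-1 / max p1 2). For max
  p1 2 < r the product tends to 0.\<close>

lemma not_admissible_above:
  assumes r: "2 < r" "ennreal P < r" shows "\<not> admissible \<mu> q \<nu> p r C"
proof
  assume adm: "admissible \<mu> q \<nu> p r C"
  have "(1 :: ennreal) \<le> 2" by simp
  then have r1: "1 \<le> r" using r(1) by order
  \<comment> \<open>The exponent 1 / r, set to 0 for r = \<infinity>, so that both cases share one
    computation.\<close>
  define \<rho> where "\<rho> = (if r = \<infinity> then 0 else 1 / enn2real r)"
  obtain p1 where p1: "P < p1" "\<rho> < 1 / max p1 2"
    using r1
  proof (cases rule: ennreal_ge_1_cases)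
    case 1
    then show ?thesis using that[of "P + 1"] p(3) by (simp add: \<rho>_def)
  next
    case (2 R)
    have "ennreal 2 < ennreal R" using r(1) 2 by (simp add: ennreal_numeral)
    then have R: "2 < R" "P < R" using r(2) 2 p(3) by (auto simp: ennreal_less_iff)
    have "\<rho> = 1 / R" using 2 by (simp add: \<rho>_def)
    also have "\<dots> < 1 / max ((P + R) / 2) 2" using R by (intro divide_strict_left_mono) auto
    finally show ?thesis using that[of "(P + R) / 2"] R by simp
  qed
  define q1 where "q1 = (1 + Q) / 2"
  have q1: "1 < q1" "q1 < Q" using q(3) by (auto simp: q1_def)
  define t where "t = q1 / (q1 - 1)"
  have "t > 0" using q1 by (simp add: t_def)
  from khinchine_upper[OF this] obtain C0 where C0: "C0 \<ge> 1" "\<And>(S :: nat set) a. finite S \<Longrightarrow>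
      avg (Pow S) (\<lambda>A. \<bar>\<Sum>k\<in>S. a k * eps k A\<bar> powr t) \<le> C0 * lnorm 2 S a powr t" by blast
  have "0 < 1 / max p1 2 - \<rho>" using p1 by simp
  then obtain m :: nat where m: "m \<ge> 1" "6 * C * C0 < real m powr (1 / max p1 2 - \<rho>)"
    by (rule exists_nat_powr_greater)
  have "1 \<le> 6 * C * C0 * real m powr (- 1 / max p1 (2 / (2 - 1))) * real m powr \<rho>"
  proof (rule row_bound[OF adm, where \<theta> = eps and w = eps and \<Omega> = "Pow {..<m}"])
    show "avg (Pow {..<m}) (\<lambda>\<omega>. \<bar>\<Sum>k<m. a k * eps k \<omega>\<bar> powr (q1 / (q1 - 1))) \<le> C0 * lnorm 2 {..<m} a powr (q1 / (q1 - 1))" for a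
      unfolding t_def[symmetric] by (rule C0(2)) simp
    show "ell r m (\<lambda>k. eps (k - 1) \<omega>) \<le> real m powr \<rho>" for \<omega> :: "nat set"
      unfolding \<rho>_def using m(1) by (intro ell_le_if_lnorm r1) auto
    have "eps i \<omega> * eps i \<omega> = 1" for i and \<omega> :: "nat set" by (simp add: eps_def)
    moreover have "avg (Pow {..<m}) (\<lambda>_. 1) = 1" by (rule avg_const) auto
    ultimately show "1 \<le> avg (Pow {..<m}) (\<lambda>\<omega>. eps i \<omega> * eps i \<omega>)" for i :: nat by simp
  qed (use r1 q1 p1 m C0 in auto)
  also have "\<dots> = 6 * C * C0 * (real m powr \<rho> / real m powr (1 / max p1 2))"
    by (simp add: powr_minus_divide)
  finally have "real m powr (1 / max p1 2) / real m powr \<rho> \<le> 6 * C * C0"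
    using m(1) by (simp add: field_simps)
  then show False using m by (simp add: powr_diff)
qed

text \<open>P < Q leaves room for p1 < Q, where the Q-stable columns have bounded moments. The
  column bound compares (m H)^(1 / Q), with H the harmonic number, to a constant times m^(1 /
  q1).\<close>

lemma not_admissible_Q:
  assumes PQ: "P < Q" "Q < 2" shows "\<not> admissible \<mu> q \<nu> p (ennreal Q) C"
proof
  assume adm: "admissible \<mu> q \<nu> p (ennreal Q) C"
  have C: "C \<ge> 1" using adm by (simp add: admissible_def)
  define p1 where "p1 = (P + Q) / 2"
  have p1: "P < p1" "p1 < Q" "0 < p1" using PQ p(3) by (auto simp: p1_def)
  define C0 where "C0 = 1 + 2 / (2 - Q) + Q / (Q - p1)"
  have C0: "C0 \<ge> 1" using PQ p1 q(3) by (simp add: C0_def)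
  have Q0: "0 < 1 / Q" using q(3) by simp
  obtain m :: nat where m: "m \<ge> 1" "12 * C * C0 < harm m powr (1 / Q)"
    using exists_harm_powr_greater[OF Q0] .
  have H: "harm m > (0::real)" using m(1) by simp
  obtain \<theta> :: "nat \<Rightarrow> nat \<times> nat set \<Rightarrow> real" where sys:
    "\<And>a. avg ({..<m} \<times> Pow {..<m}) (\<lambda>\<omega>. \<bar>\<Sum>k<m. a k * \<theta> k \<omega>\<bar> powr p1) \<le> C0 * lnorm Q {..<m} a powr p1"
    "\<And>\<omega>. (\<Sum>k<m. \<bar>\<theta> k \<omega>\<bar> powr Q) = m * harm m"
    using cyclic_system_exists[OF p1(3,2) PQ(2) m(1), folded C0_def] by blast
  \<comment> \<open>Depends on m, which already fulfils its own requirement; the loss 2 doubles the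
    factor 6 to the 12 used there.\<close>
  obtain q1 where q1: "1 < q1" "q1 < Q" "real m powr (1 / q1 - 1 / Q) \<le> 2"
    using exists_close_below[of 1 Q "real m"] q(3) m(1) by auto
  have "(m * harm m) powr (1 / Q) \<le> 6 * C * C0 * real m powr (1 / min Q q1)"
  proof (rule column_bound[OF adm, where \<theta> = \<theta> and \<Omega> = "{..<m} \<times> Pow {..<m}" and ?p1.0 = p1])
    show "(m * harm m) powr (1 / Q) \<le> lnorm Q {..<m} (\<lambda>k. \<theta> k \<omega>)" for \<omega>
      by (simp add: lnorm_def sys(2))
  qed (use sys(1) p1 q1 q(3) C0 m in \<open>auto simp: lessThan_empty_iff\<close>)
  also have "real m powr (1 / min Q q1) = real m powr (1 / q1 - 1 / Q) * real m powr (1 / Q)"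
    using q1 by (simp add: min_def flip: powr_add)
  also have "6 * C * C0 * (real m powr (1 / q1 - 1 / Q) * real m powr (1 / Q)) \<le> 6 * C * C0 * (2 * real m powr (1 / Q))"
    using q1 C C0 by (intro mult_left_mono mult_right_mono) auto
  finally have "real m powr (1 / Q) * harm m powr (1 / Q) \<le> real m powr (1 / Q) * (12 * C * C0)"
    using H by (simp add: powr_mult mult_ac)
  then have "harm m powr (1 / Q) \<le> 12 * C * C0" using m(1) by simp
  then show False using m(2) by simp
qed

text \<open>The stability index is s, the conjugate of P; q1 > P makes its conjugate t smaller than
  s, so that moments of order t are bounded. The row bound gives H <= const H^(1 / P) for the
  harmonic number H, which is impossible for large m since 1 - 1 / P > 0.\<close>

lemma not_admissible_P:
  assumes PQ: "P < Q" "2 < P" shows "\<not> admissible \<mu> q \<nu> p (ennreal P) C"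
proof
  assume adm: "admissible \<mu> q \<nu> p (ennreal P) C"
  have C: "C \<ge> 1" using adm by (simp add: admissible_def)
  define s where "s = P / (P - 1)"
  have s: "1 < s" "s < 2" using PQ by (auto simp: s_def field_simps)
  have sP: "s / (s - 1) = P" "(s - 1) * P = s" using PQ by (auto simp: s_def field_simps)
  define q1 where "q1 = (P + Q) / 2"
  have q1: "P < q1" "q1 < Q" "1 < q1" using PQ by (auto simp: q1_def)
  define t where "t = q1 / (q1 - 1)"
  have t: "0 < t" "t < s" using q1 PQ by (auto simp: t_def s_def field_simps)
  define C0 where "C0 = 1 + 2 / (2 - s) + s / (s - t)"
  have C0: "C0 \<ge> 1" using s t by (simp add: C0_def)
  have P0: "0 < 1 - 1 / P" using PQ by simp
  obtain m :: nat where m: "m \<ge> 1" "12 * C * C0 < harm m powr (1 - 1 / P)"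
    using exists_harm_powr_greater[OF P0] .
  have H: "harm m > (0::real)" using m(1) by simp
  obtain \<theta> :: "nat \<Rightarrow> nat \<times> nat set \<Rightarrow> real" where sys:
    "\<And>a. avg ({..<m} \<times> Pow {..<m}) (\<lambda>\<omega>. \<bar>\<Sum>k<m. a k * \<theta> k \<omega>\<bar> powr t) \<le> C0 * lnorm s {..<m} a powr t"
    "\<And>\<omega>. (\<Sum>k<m. \<bar>\<theta> k \<omega>\<bar> powr s) = m * harm m"
    "\<And>k. avg ({..<m} \<times> Pow {..<m}) (\<lambda>\<omega>. \<bar>\<theta> k \<omega>\<bar> powr s) = harm m"
    using cyclic_system_exists[OF t s(2) m(1), folded C0_def] by blast
  obtain p1 where p1: "P < p1" "real m powr (1 / P - 1 / p1) \<le> 2"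
    using exists_close_above[of P "real m"] p(3) m(1) by auto
  \<comment> \<open>Norming family: \<theta> k times \<open>w k\<close> and the P-th power of |w k|
    both equal |\<theta> k|^s. The diagonal averages are then harmonic numbers, and the l^P norm of
    \<open>w\<close> is constant.\<close>
  define w where "w k \<omega> = \<bar>\<theta> k \<omega>\<bar> powr (s - 1) * sgn (\<theta> k \<omega>)" for k \<omega>
  have \<theta>w: "\<theta> k \<omega> * w k \<omega> = \<bar>\<theta> k \<omega>\<bar> powr s" for k \<omega>
  proof (cases "\<theta> k \<omega> = 0")
    case False
    have "\<theta> k \<omega> * w k \<omega> = \<bar>\<theta> k \<omega>\<bar> powr (s - 1) * \<bar>\<theta> k \<omega>\<bar>" by (simp add: w_def abs_sgn)
    also have "\<dots> = \<bar>\<theta> k \<omega>\<bar> powr s" using False by (simp add: powr_diff)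
    finally show ?thesis .
  qed (use s in simp)
  have wP: "\<bar>w k \<omega>\<bar> powr P = \<bar>\<theta> k \<omega>\<bar> powr s" for k \<omega>
    using sP(2) s by (cases "\<theta> k \<omega> = 0") (auto simp: w_def abs_mult abs_sgn_eq powr_powr)
  have "harm m \<le> 6 * C * C0 * real m powr (- 1 / max p1 (s / (s - 1))) * (m * harm m) powr (1 / P)"
  proof (rule row_bound[OF adm, where \<theta> = \<theta> and w = w and \<Omega> = "{..<m} \<times> Pow {..<m}"])
    show "avg ({..<m} \<times> Pow {..<m}) (\<lambda>\<omega>. \<bar>\<Sum>k<m. a k * \<theta> k \<omega>\<bar> powr (q1 / (q1 - 1))) \<le> C0 * lnorm s {..<m} a powr (q1 / (q1 - 1))" for a
      unfolding t_def[symmetric] by (rule sys(1))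
    show "ell (ennreal P) m (\<lambda>k. w (k - 1) \<omega>) \<le> (m * harm m) powr (1 / P)" for \<omega>
    proof -
      have "(\<Sum>k=1..m. \<bar>w (k - 1) \<omega>\<bar> powr P) = m * harm m"
        by (simp add: sum.atLeast1_atMost_eq wP sys(2))
      then show ?thesis using p(3) by (simp add: ell_eq_lnorm lnorm_def)
    qed
    show "harm m \<le> avg ({..<m} \<times> Pow {..<m}) (\<lambda>\<omega>. \<theta> i \<omega> * w i \<omega>)" if "i < m" for i
      unfolding \<theta>w sys(3) by simp
    have "harm m \<noteq> (0::real)" using H by (metis less_irrefl)
    then show "0 < (real m * harm m) powr (1 / P)" using m(1) by simp
  qed (use p1 q1 p(3) s C0 m in \<open>auto simp: lessThan_empty_iff\<close>)
  also have "\<dots> = 6 * C * C0 * real m powr (1 / P - 1 / p1) * harm m powr (1 / P)"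
    using p1 H by (simp add: sP(1) max_def powr_mult powr_diff powr_minus_divide)
  also have "\<dots> \<le> 6 * C * C0 * 2 * harm m powr (1 / P)"
    using p1 C C0 by (intro mult_left_mono mult_right_mono) auto
  finally have le: "harm m \<le> 6 * C * C0 * 2 * harm m powr (1 / P)" .
  define h :: real where "h = harm m"
  have h: "0 < h" using H unfolding h_def .
  have "h powr (1 - 1 / P) * h powr (1 / P) = h" using h by (simp flip: powr_add)
  then have "h powr (1 - 1 / P) * h powr (1 / P) \<le> 12 * C * C0 * h powr (1 / P)"
    using le unfolding h_def by simp
  then have "h powr (1 - 1 / P) \<le> 12 * C * C0" using h by simp
  then show False using m(2) unfolding h_def by simp
qed

end

section \<open>The interval and the assembly of the bounds\<close>

lemma mem_Iset_ennreal_iff: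
  assumes "0 \<le> P" "0 \<le> Q" "0 \<le> R"
  shows "ennreal R \<in> Iset (ennreal P) (ennreal Q) \<longleftrightarrow>
    (if P < Q \<and> Q < 2 then Q < R \<and> R \<le> 2 else if 2 < P \<and> P < Q then 2 \<le> R \<and> R < P
     else min 2 Q \<le> R \<and> R \<le> max 2 P)"
  using assms by (auto simp: Iset_def ennreal_less_iff ennreal_le_iff min_le_iff_disj le_max_iff_disj
      simp flip: ennreal_numeral split: if_splits)

lemma infinity_notin_Iset: "\<infinity> \<notin> Iset (ennreal P) q"
  by (auto simp: Iset_def max_def top_unique simp flip: ennreal_numeral split: if_splits)

theorem theorem3p1:
  fixes \<nu> :: "'a measure" and \<mu> :: "'b measure"
    and p :: "'a \<Rightarrow> ennreal" and q :: "'b \<Rightarrow> ennreal"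
  assumes "sigma_finite_measure \<nu>" and "complete_measure \<nu>" and "nonatomic \<nu>"
    and "sigma_finite_measure \<mu>" and "complete_measure \<mu>" and "nonatomic \<mu>"
    and "p \<in> bounded_exponents \<nu>" and "q \<in> bounded_exponents \<mu>"
  shows "(\<forall>r\<ge>1. kconst \<mu> q \<nu> p r < \<infinity> \<longleftrightarrow> r \<in> Iset (essinf \<nu> p) (esssup \<mu> q)) \<and>
    (\<forall>r. 1 \<le> r \<and> r < \<infinity> \<longrightarrow> kconst \<mu> (\<lambda>_. 1) \<nu> p r < \<infinity>) \<and>
    (\<forall>r\<in>Iset (essinf \<nu> p) \<infinity>. kconst \<mu> (\<lambda>_. \<infinity>) \<nu> p r < \<infinity>)"
proof -
  obtain P P2 where pe: "p \<in> exponents \<nu>" and P: "essinf \<nu> p = ennreal P" "1 < P" "P \<le> P2"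
    and pb: "AE x in \<nu>. ennreal P \<le> p x \<and> p x \<le> ennreal P2"
    using assms(7) by (rule bounded_exponentsE) blast
  obtain Q1 Q where qe: "q \<in> exponents \<mu>" and Q: "esssup \<mu> q = ennreal Q" "1 < Q1" "Q1 \<le> Q"
    and qb': "AE x in \<mu>. ennreal Q1 \<le> q x \<and> q x \<le> ennreal Q"
    using assms(8) by (rule bounded_exponentsE) blast
  have Q1: "1 < Q" using Q by simp
  have qb: "AE x in \<mu>. q x \<le> ennreal Q" using qb' by eventually_elim simp
  have pb2: "AE x in \<nu>. p x \<le> ennreal P2" using pb by eventually_elim simp
  interpret nonatomic_exponents \<nu> \<mu> p q P Q
    by (rule nonatomic_exponents.intro[OF assms(1,3,4,6,7) P(1,2) assms(8) Q(1) Q1])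
  \<comment> \<open>Kept general in the source exponent: it serves the given \<open>q\<close> and
    the constant \<infinity>.\<close>
  have target: "kconst \<mu> q' \<nu> p (ennreal R) < \<infinity>"
    if A: "q' \<in> exponents \<mu>" "simple_approximable \<mu> q'" "2 \<le> R" "R < P \<or> R = 2" for q' R
  proof -
    obtain K where "K \<ge> 0" "simple_vv_bound \<mu> q' \<nu> p R K"
      using simple_vv_bound_target[OF pe P(2,3) pb A(1,3,4)] by blast
    then have "vv_bound \<mu> q' \<nu> p R K" using A pe by (intro vv_bound_if_simple) auto
    then show ?thesis using A by (intro kconst_finite_if) auto
  qed
  have iff: "kconst \<mu> q \<nu> p r < \<infinity> \<longleftrightarrow> r \<in> Iset (essinf \<nu> p) (esssup \<mu> q)" if r: "1 \<le> r" for r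
    using r
  proof (cases rule: ennreal_ge_1_cases)
    case 1
    have "\<not> kconst \<mu> q \<nu> p r < \<infinity>"
    proof
      assume "kconst \<mu> q \<nu> p r < \<infinity>"
      then obtain C where "admissible \<mu> q \<nu> p r C" by (rule kconst_finiteE)
      moreover have "2 < r" "ennreal P < r" unfolding 1 by simp_all
      ultimately show False using not_admissible_above by blast
    qed
    then show ?thesis using 1 infinity_notin_Iset P(1) by metis
  next
    case (2 R)
    have mem: "r \<in> Iset (essinf \<nu> p) (esssup \<mu> q) \<longleftrightarrow>
       (if P < Q \<and> Q < 2 then Q < R \<and> R \<le> 2 else if 2 < P \<and> P < Q then 2 \<le> R \<and> R < P
        else min 2 Q \<le> R \<and> R \<le> max 2 P)"
      unfolding 2 P(1) Q(1) using P Q1 2 by (intro mem_Iset_ennreal_iff) auto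
    show ?thesis
    proof
      assume "kconst \<mu> q \<nu> p r < \<infinity>"
      then obtain C where adm: "admissible \<mu> q \<nu> p (ennreal R) C" unfolding 2 by (rule kconst_finiteE)
      \<comment> \<open>The four excluded ranges together make up the complement of the interval
        within R >= 1.\<close>
      have "\<not> (R < 2 \<and> R < Q)" using not_admissible_below[of R C] adm 2 by blast
      moreover have "\<not> (2 < R \<and> P < R)"
        using not_admissible_above[of "ennreal R" C] adm P 2
        by (auto simp: ennreal_less_iff simp flip: ennreal_numeral)
      moreover have "\<not> (P < Q \<and> Q < 2 \<and> R = Q)" using not_admissible_Q[of C] adm by blast
      moreover have "\<not> (P < Q \<and> 2 < P \<and> R = P)" using not_admissible_P[of C] adm by blast
      ultimately show "r \<in> Iset (essinf \<nu> p) (esssup \<mu> q)" unfolding mem by auto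
    next
      assume "r \<in> Iset (essinf \<nu> p) (esssup \<mu> q)"
      \<comment> \<open>The interval is covered by the ranges of randomisation in the source,
        randomisation in the target, and direct comparison between Q and P.\<close>
      then have "R \<le> 2 \<and> (Q < R \<or> R = 2) \<or> 2 \<le> R \<and> R < P \<or> Q \<le> R \<and> R \<le> P"
        unfolding mem min_def max_def by (smt (verit))
      then consider "R \<le> 2" "Q < R \<or> R = 2" | "2 \<le> R" "R < P" | "Q \<le> R" "R \<le> P"
        by blast
      then show "kconst \<mu> q \<nu> p r < \<infinity>"
      proof cases
        case 1
        then obtain K where "vv_bound \<mu> q \<nu> p R K"
          using vv_bound_source[OF pe qe _ qb, of R] Q1 by auto
        then show ?thesis unfolding 2 using qe 2 by (intro kconst_finite_if)
      next
        case 2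
        then show ?thesis
          unfolding \<open>r = ennreal R\<close> using Q1 by (intro target qe simple_approximable_finite[OF qe _ qb]) auto
      next
        case 3
        have "vv_bound \<mu> q \<nu> p R 1"
        proof (rule vv_bound_between[OF pe qe 2(2)])
          show "AE x in \<mu>. q x \<le> ennreal R"
            using qb by eventually_elim (use 3 in \<open>auto intro: order_trans ennreal_leI\<close>)
          show "AE x in \<nu>. ennreal R \<le> p x"
            using pb by eventually_elim (use 3 in \<open>auto intro: order_trans ennreal_leI\<close>)
        qed (rule AE_finite_exponent[OF pb2])
        then show ?thesis unfolding 2 using qe 2 by (intro kconst_finite_if)
      qed
    qed
  qed
  have L1: "kconst \<mu> (\<lambda>_. 1) \<nu> p r < \<infinity>" if r: "1 \<le> r" "r < \<infinity>" for r
    using r(1)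
  proof (cases rule: ennreal_ge_1_cases)
    case (2 R)
    have "simple_approximable \<mu> (\<lambda>_. 1)"
      by (rule simple_approximable_finite[OF one_in_exponents, of 1]) auto
    then have "vv_bound \<mu> (\<lambda>_. 1) \<nu> p R 1"
      using simple_vv_bound_L1[OF pe 2(2)] 2(2) pe by (intro vv_bound_if_simple one_in_exponents) auto
    then show ?thesis unfolding 2 using 2 by (intro kconst_finite_if one_in_exponents)
  qed (use r in simp)
  have Linf: "kconst \<mu> (\<lambda>_. \<infinity>) \<nu> p r < \<infinity>" if r: "r \<in> Iset (essinf \<nu> p) \<infinity>" for r
  proof -
    \<comment> \<open>For q_+ = \<infinity> the interval is [2, P) if P > 2 and the single point 2
      otherwise, so randomisation in the target covers it.\<close>
    have r': "2 \<le> r" "r < ennreal P \<or> r = 2"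
      using r unfolding P(1) by (auto simp: Iset_def max_def split: if_splits)
    have "r \<noteq> \<infinity>" using r infinity_notin_Iset P(1) by metis
    then have eq: "r = ennreal (enn2real r)" by (simp add: less_top)
    define R where "R = enn2real r"
    have rR: "r = ennreal R" "0 \<le> R" using eq by (simp_all add: R_def)
    have "2 \<le> R" "R < P \<or> R = 2"
      using r' rR P by (auto simp: ennreal_less_iff ennreal_le_iff simp flip: ennreal_numeral)
    then show ?thesis unfolding rR(1) by (intro target infinity_in_exponents simple_approximable_infinity)
  qed
  show ?thesis using iff L1 Linf by blast
qed

end
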